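(* Let $\mathsf{M}$ be a connected split matroid of rank $k$ on $n$ elements. The number of faces of its base polytope $\mathscr{P}(\mathsf{M})$ is given by the polynomial $$f_{\mathscr{P}(\mathsf{M})}(t) = f_{\Delta_{k,n}}(t)-\sum_{r,h} \lambda_{r,h}\cdot u_{r,k,h,n}(t)-\sum_{\alpha,\beta,a,b} \mu_{\alpha,\beta,a,b}\cdot w_{\alpha,\beta,a,b}(t),$$ where the first sum ranges over all integers $r,h$ with $0<r<h<n$ and the second sum ranges over all integers with $0<\alpha<a$, $0<\beta<b$ for which either $a<b$, or $a=b$ and $\alpha\leq\beta$.
   Context: For a $d$-dimensional polytope $\mathscr{P}$, $f_{\mathscr{P}}(t)=\sum_{i=0}^d f_i t^i$, where $f_i$ is the number of $i$-dimensional faces of $\mathscr{P}$ (the empty face is not counted; $f_d=1$). The base polytope $\mathscr{P}(\mathsf{M})\subseteq\mathbb{R}^n$ of a matroid $\mathsf{M}$ on $[n]$ is the convex hull of the indicator vectors of the bases of $\mathsf{M}$. The hypersimplex $\Delta_{k,n}=\{x\in[0,1]^n : \sum_{i=1}^n x_i=k\}$ is the base polytope of the uniform matroid $\mathsf{U}_{k,n}$. Split matroids: a matroid of rank $k$ on a finite set $E$ is elementary split if there are subsets $H_1,\dots,H_q\subseteq E$ ($q\ge 0$) and nonnegative integers $r_1,\dots,r_q$ with $|H_i\cap H_j|\le r_i+r_j-k$ for all $i\neq j$ and $|E\smallsetminus H_i|+r_i\ge k$ for all $i$, such that its bases are exactly the $k$-subsets $X\subseteq E$ with $|X\cap H_i|\le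 r_i$ for all $i$. A matroid is split if it is a direct sum of one elementary split matroid and some (possibly no) uniform matroids. For connected matroids, split and elementary split are equivalent. A cyclic flat is a flat that is a (possibly empty) union of circuits. For the connected split matroid $\mathsf{M}$ with rank function $\mathrm{rk}$: - $\lambda_{r,h}$ is the number of proper non-empty cyclic flats of $\mathsf{M}$ of rank $r$ and size $h$ (in a connected split matroid these are exactly the so-called stressed subsets with non-empty cover). - $\mu_{\alpha,\beta,a,b}$ is the number of unordered modular pairs $\{F_1,F_2\}$ of distinct proper non-empty cyclic flats, i.e. pairs with $\mathrm{rk}(F_1)+\mathrm{rk}(F_2)=\mathrm{rk}(F_1\cap F_2)+\mathrm{rk}(F_1\cup F_2)$, such that, for a suitable labelling of the two members, $a=|F_1\smallsetminus F_2|$, $b=|F_2\smallsetminus F_1|$, $\alpha=\mathrm{rk}(F_1)-\mathrm{rk}(F_1\cap F_2)$, $\beta=\mathrm{rk}(F_2)-\mathrm{rk}(F_1\cap F_2)$. Each unordered pair is counted once; the range of the second sum selects one labelling. Schubert elementary split matroids: $\mathsf{\Lambda}_{k-r,k,n-h,n}$ is the matroid of rank $k$ on $[n]$ with base polytope $\mathscr{P}(\mathsf{\Lambda}_{k-r,k,n-h,n})=\{x\in\Delta_{k,n} : \sum_{i=1}^h x_i\le r\}$. Define $$u_{r,k,h,n}(t):=f_{\Delta_{k,n}}(t)-f_{\mathscr{P}(\mathsf{\Lambda}_{k-r,k,n-h,n})}(t),$$ and, for $0<\alpha<a$ and $0<\beta<b$, $$w_{\alpha,\beta,a,b}(t):=f_{\Delta_{\alpha+\beta,a+b}}(t)-f_{\Delta_{\alpha,a}}(t)\cdot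 f_{\Delta_{\beta,b}}(t)-u_{\alpha,\alpha+\beta,a,a+b}(t)-u_{\beta,\alpha+\beta,b,a+b}(t).$$ Terms with $\lambda_{r,h}=0$ or $\mu_{\alpha,\beta,a,b}=0$ are understood to contribute $0$. *)

theory Defs
  imports "HOL-Analysis.Analysis" "HOL-Analysis.Finite_Function_Topology"
    "HOL-Computational_Algebra.Polynomial"
begin

subsection \<open>Matroids, given by their bases\<close>

locale matroid =
  fixes E :: "'a set" and \<B> :: "'a set set"
  assumes finite_ground: "finite E"
    and bases_nonempty: "\<B> \<noteq> {}"
    and bases_subset: "B \<in> \<B> \<Longrightarrow> B \<subseteq> E"
    and exchange: "\<lbrakk>A \<in> \<B>; B \<in> \<B>; x \<in> A - B\<rbrakk> \<Longrightarrow> \<exists>y\<in>B - A. insert y (A - {x}) \<in> \<B>"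

definition rk :: "'a set set \<Rightarrow> 'a set \<Rightarrow> nat" where
  "rk \<B> X = Max ((\<lambda>B. card (X \<inter> B)) ` \<B>)"

definition indep :: "'a set set \<Rightarrow> 'a set \<Rightarrow> bool" where
  "indep \<B> I \<longleftrightarrow> (\<exists>B\<in>\<B>. I \<subseteq> B)"

definition circuit :: "'a set \<Rightarrow> 'a set set \<Rightarrow> 'a set \<Rightarrow> bool" where
  "circuit E \<B> C \<longleftrightarrow> C \<subseteq> E \<and> \<not> indep \<B> C \<and> (\<forall>D. D \<subset> C \<longrightarrow> indep \<B> D)"

definition flat :: "'a set \<Rightarrow> 'a set set \<Rightarrow> 'a set \<Rightarrow> bool" where
  "flat E \<B> F \<longleftrightarrow> F \<subseteq> E \<and> (\<forall>e\<in>E - F. rk \<B> F < rk \<B> (insert e F))"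

definition cyclic_flat :: "'a set \<Rightarrow> 'a set set \<Rightarrow> 'a set \<Rightarrow> bool" where
  "cyclic_flat E \<B> F \<longleftrightarrow> flat E \<B> F \<and> (\<exists>\<C>. (\<forall>C\<in>\<C>. circuit E \<B> C) \<and> F = \<Union>\<C>)"

definition proper_cyclic_flats :: "'a set \<Rightarrow> 'a set set \<Rightarrow> 'a set set" where
  "proper_cyclic_flats E \<B> = {F. cyclic_flat E \<B> F \<and> F \<noteq> {} \<and> F \<noteq> E}"

definition uniform_bases :: "nat \<Rightarrow> 'a set \<Rightarrow> 'a set set" where
  "uniform_bases k E = {X. X \<subseteq> E \<and> card X = k}"

text \<open>Bases of the direct sum; only used when the two ground sets are disjoint.\<close>

definition sum_bases :: "'a set set \<Rightarrow> 'a set set \<Rightarrow> 'a set set" where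
  "sum_bases \<A> \<B> = {A \<union> B | A B. A \<in> \<A> \<and> B \<in> \<B>}"

definition connected_matroid :: "'a set \<Rightarrow> 'a set set \<Rightarrow> bool" where
  "connected_matroid E \<B> \<longleftrightarrow>
    matroid E \<B> \<and>
    \<not> (\<exists>E1 \<B>1 E2 \<B>2. matroid E1 \<B>1 \<and> matroid E2 \<B>2 \<and> E1 \<noteq> {} \<and> E2 \<noteq> {} \<and>
         E1 \<inter> E2 = {} \<and> E = E1 \<union> E2 \<and> \<B> = sum_bases \<B>1 \<B>2)"

definition elementary_split :: "'a set \<Rightarrow> 'a set set \<Rightarrow> bool" where
  "elementary_split E \<B> \<longleftrightarrow>
    matroid E \<B> \<and>
    (\<exists>(q::nat) (H :: nat \<Rightarrow> 'a set) (r :: nat \<Rightarrow> nat).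
       (\<forall>i\<in>{1..q}. H i \<subseteq> E) \<and>
       (\<forall>i\<in>{1..q}. \<forall>j\<in>{1..q}. i \<noteq> j \<longrightarrow>
          int (card (H i \<inter> H j)) \<le> int (r i) + int (r j) - int (rk \<B> E)) \<and>
       (\<forall>i\<in>{1..q}. card (E - H i) + r i \<ge> rk \<B> E) \<and>
       \<B> = {X. X \<subseteq> E \<and> card X = rk \<B> E \<and> (\<forall>i\<in>{1..q}. card (X \<inter> H i) \<le> r i)})"

inductive split_matroid :: "'a set \<Rightarrow> 'a set set \<Rightarrow> bool" where
  elementary: "elementary_split E \<B> \<Longrightarrow> split_matroid E \<B>"
| sum_uniform: "\<lbrakk>split_matroid E \<B>; finite U; k \<le> card U; E \<inter> U = {}\<rbrakk>
    \<Longrightarrow> split_matroid (E \<union> U) (sum_bases \<B> (uniform_bases k U))"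


subsection \<open>Face-counting polynomials\<close>

text \<open>
  The space \<open>\<real>\<^sup>E\<close> is realised inside the real vector space of finitely supported functions
  \<open>'a \<Rightarrow>\<^sub>0 real\<close>, so that polytopes in \<open>\<real>\<^sup>m\<close> for different \<open>m\<close> live in one type. As \<open>aff_dim\<close>
  is restricted to Euclidean spaces, the affine dimension of a nonempty set is taken to be the
  dimension of the span of the differences of its points; the lemma below shows that this
  agrees with \<open>aff_dim\<close>.
\<close>

definition affine_dim :: "'v::real_vector set \<Rightarrow> nat" where
  "affine_dim S = dim {x - y | x y. x \<in> S \<and> y \<in> S}"

lemma affine_dim_eq_aff_dim:
  fixes S :: "'v::euclidean_space set"
  assumes "S \<noteq> {}"
  shows "int (affine_dim S) = aff_dim S"
proof -
  obtain a where a: "a \<in> S" using assms by auto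
  let ?D = "{x - y | x y. x \<in> S \<and> y \<in> S}" and ?T = "(\<lambda>x. x - a) ` S"
  have "?D \<subseteq> span ?T"
  proof
    fix z assume "z \<in> ?D"
    then obtain x y where "x \<in> S" "y \<in> S" "z = (x - a) - (y - a)" by auto
    then show "z \<in> span ?T" by (simp only:) (intro span_diff span_base imageI)
  qed
  moreover have "?T \<subseteq> span ?D" using a by (auto intro!: span_base)
  ultimately have "span ?D = span ?T" by (simp only: span_eq)
  then have "dim ?D = dim ?T" by (rule span_eq_dim)
  then show ?thesis
    unfolding affine_dim_def using aff_dim_eq_dim_subtract[of a S] a by (simp add: hull_inc)
qed

definition face_poly :: "'v::real_vector set \<Rightarrow> int poly" where
  "face_poly P =
    (\<Sum>i\<le>affine_dim P. monom (int (card {F. F face_of P \<and> F \<noteq> {} \<and> affine_dim F = i})) i)"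

definition indicator_vec :: "'a set \<Rightarrow> 'a \<Rightarrow>\<^sub>0 real" where
  "indicator_vec B = (\<Sum>b\<in>B. Poly_Mapping.single b 1)"

lemma lookup_indicator_vec:
  assumes "finite B"
  shows "Poly_Mapping.lookup (indicator_vec B) i = (if i \<in> B then 1 else 0)"
  using assms by (simp add: indicator_vec_def lookup_sum lookup_single when_def)

definition base_polytope :: "'a set set \<Rightarrow> ('a \<Rightarrow>\<^sub>0 real) set" where
  "base_polytope \<B> = convex hull (indicator_vec ` \<B>)"

definition hypersimplex :: "nat \<Rightarrow> nat \<Rightarrow> (nat \<Rightarrow>\<^sub>0 real) set" where
  "hypersimplex k n =
    {x. Poly_Mapping.keys x \<subseteq> {1..n} \<and>
        (\<forall>i\<in>{1..n}. 0 \<le> Poly_Mapping.lookup x i \<and> Poly_Mapping.lookup x i \<le> 1) \<and>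
        (\<Sum>i=1..n. Poly_Mapping.lookup x i) = real k}"

text \<open>
  The base polytope of the Schubert elementary split matroid \<open>\<Lambda>\<close> with subscripts
  \<open>k - r, k, n - h, n\<close>. The parameters here are \<open>r, k, h, n\<close>, in the order of the
  subscripts of \<open>u\<close>, to avoid truncated subtraction.
\<close>

definition schubert_polytope :: "nat \<Rightarrow> nat \<Rightarrow> nat \<Rightarrow> nat \<Rightarrow> (nat \<Rightarrow>\<^sub>0 real) set" where
  "schubert_polytope r k h n =
    {x \<in> hypersimplex k n. (\<Sum>i=1..h. Poly_Mapping.lookup x i) \<le> real r}"

definition u_poly :: "nat \<Rightarrow> nat \<Rightarrow> nat \<Rightarrow> nat \<Rightarrow> int poly" where
  "u_poly r k h n = face_poly (hypersimplex k n) - face_poly (schubert_polytope r k h n)"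

definition w_poly :: "nat \<Rightarrow> nat \<Rightarrow> nat \<Rightarrow> nat \<Rightarrow> int poly" where
  "w_poly \<alpha> \<beta> a b =
     face_poly (hypersimplex (\<alpha> + \<beta>) (a + b))
     - face_poly (hypersimplex \<alpha> a) * face_poly (hypersimplex \<beta> b)
     - u_poly \<alpha> (\<alpha> + \<beta>) a (a + b) - u_poly \<beta> (\<alpha> + \<beta>) b (a + b)"


subsection \<open>Numerical data of the matroid\<close>

definition lambda_count :: "'a set \<Rightarrow> 'a set set \<Rightarrow> nat \<Rightarrow> nat \<Rightarrow> nat" where
  "lambda_count E \<B> r h = card {F \<in> proper_cyclic_flats E \<B>. rk \<B> F = r \<and> card F = h}"

text \<open>Unordered pairs are two-element sets, so each is counted once although \<open>F1\<close> and \<open>F2\<close>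
  range over both labellings.\<close>

definition mu_count :: "'a set \<Rightarrow> 'a set set \<Rightarrow> nat \<Rightarrow> nat \<Rightarrow> nat \<Rightarrow> nat \<Rightarrow> nat" where
  "mu_count E \<B> \<alpha> \<beta> a b = card {{F1, F2} | F1 F2.
     F1 \<in> proper_cyclic_flats E \<B> \<and> F2 \<in> proper_cyclic_flats E \<B> \<and> F1 \<noteq> F2 \<and>
     rk \<B> F1 + rk \<B> F2 = rk \<B> (F1 \<inter> F2) + rk \<B> (F1 \<union> F2) \<and>
     a = card (F1 - F2) \<and> b = card (F2 - F1) \<and>
     int \<alpha> = int (rk \<B> F1) - int (rk \<B> (F1 \<inter> F2)) \<and>
     int \<beta> = int (rk \<B> F2) - int (rk \<B> (F1 \<inter> F2))}"

text \<open>
  The indices of the second sum. The quadruples with \<open>\<mu> = 0\<close>, whose terms are zero, are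
  left out because \<open>sum\<close> over an infinite set is \<open>0\<close>; the lemma below shows that
  finitely many indices remain.
\<close>

definition mu_support :: "'a set \<Rightarrow> 'a set set \<Rightarrow> (nat \<times> nat \<times> nat \<times> nat) set" where
  "mu_support E \<B> = {(\<alpha>, \<beta>, a, b). 0 < \<alpha> \<and> \<alpha> < a \<and> 0 < \<beta> \<and> \<beta> < b \<and>
     (a < b \<or> (a = b \<and> \<alpha> \<le> \<beta>)) \<and> mu_count E \<B> \<alpha> \<beta> a b \<noteq> 0}"

lemma finite_mu_support:
  assumes "finite E"
  shows "finite (mu_support E \<B>)"
proof (rule finite_subset)
  let ?N = "{..card E}"
  show "finite (?N \<times> ?N \<times> ?N \<times> ?N)" by simp
  show "mu_support E \<B> \<subseteq> ?N \<times> ?N \<times> ?N \<times> ?N"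
  proof
    fix p assume "p \<in> mu_support E \<B>"
    then obtain \<alpha> \<beta> a b where p: "p = (\<alpha>, \<beta>, a, b)" and lt: "\<alpha> < a" "\<beta> < b"
      and mu: "mu_count E \<B> \<alpha> \<beta> a b \<noteq> 0"
      unfolding mu_support_def by auto
    from mu obtain F1 F2 where
      F: "F1 \<in> proper_cyclic_flats E \<B>" "F2 \<in> proper_cyclic_flats E \<B>"
        "a = card (F1 - F2)" "b = card (F2 - F1)"
      unfolding mu_count_def card_eq_0_iff by blast
    then have "F1 \<subseteq> E" "F2 \<subseteq> E"
      unfolding proper_cyclic_flats_def cyclic_flat_def flat_def by auto
    then have "a \<le> card E" "b \<le> card E"
      using F assms by (auto intro!: card_mono)
    then show "p \<in> ?N \<times> ?N \<times> ?N \<times> ?N" using p lt by auto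
  qed
qed

end

theory Submission
  imports Defs
begin

text \<open>
  The hypersimplex is partitioned into relatively open cells, indexed by the set \<open>I\<close> of coordinates
  equal to \<open>1\<close> and the set \<open>S\<close> of fractional coordinates. The base polytope of the matroid is cut out
  of it by the caps \<open>x(F) \<le> rk F\<close> over the proper non-empty cyclic flats \<open>F\<close>, and its faces correspond
  to the occurring pairs of a cell and a set of tight caps; hence every polynomial in the theorem is
  a sum of contributions of single cells.

  Since \<open>|F \<inter> G| \<le> rk F + rk G - k\<close>, two caps can be reached at the same point only for a modular
  pair, and then only on the face where \<open>x = 1\<close> on \<open>F \<inter> G\<close> and \<open>x = 0\<close> outside \<open>F \<union> G\<close>. On this face
  the two caps have the same boundary but opposite sides, so it contributes the boundary hyperplane
  section, a product of two hypersimplices, instead of what two independent cuts would leave. This is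
  the correction \<open>w\<close>, and away from such faces the corrections \<open>u\<close> of the single cuts simply add up.
\<close>

subsection \<open>Faces of polyhedra as sets of tight constraints\<close>

text \<open>A base polytope is given by its vertices, while faces are counted from inequalities. The
  bridge is an integrality statement for capped hypersimplices, and it rests on the same overlap
  inequality as the count: two caps tight at one point are complementary on the fractional
  coordinates, so each block of these has an integral sum and can be perturbed. The sets
  \<open>H i\<close> of an elementary split presentation may contain redundant members; proper
  cyclic flats make the caps canonical, with their ranks as bounds. On one cell a cap takes either a
  single value or an open interval of values, so only four positions occur: below, above, level,
  across. Imposing one cap removes the term of a cell above it, and adds the term of the section to
  a cell that it crosses, because the open piece below the cap still has the dimension of the whole
  cell. Truncated subtraction in the exponents is intended: an empty block of fractional coordinates
  has dimension 0.\<close>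

lemma finite_uniform_radius:
  assumes "finite C" "\<And>c. c \<in> C \<Longrightarrow> \<exists>\<epsilon>>0. \<forall>t. \<bar>t\<bar> \<le> \<epsilon> \<longrightarrow> Q c (t::real)"
  shows "\<exists>\<epsilon>>0. \<forall>c\<in>C. \<forall>t. \<bar>t\<bar> \<le> \<epsilon> \<longrightarrow> Q c t"
  using assms
proof (induction C rule: finite_induct)
  case empty
  then show ?case by (auto intro: exI[of _ 1])
next
  case (insert c C)
  have "\<exists>\<epsilon>>0. \<forall>c\<in>C. \<forall>t. \<bar>t\<bar> \<le> \<epsilon> \<longrightarrow> Q c t" using insert by simp
  then obtain e1 where "e1 > 0" "\<forall>c\<in>C. \<forall>t. \<bar>t\<bar> \<le> e1 \<longrightarrow> Q c t" by blast
  moreover obtain e2 where "e2 > 0" "\<forall>t. \<bar>t\<bar> \<le> e2 \<longrightarrow> Q c t"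
    using insert.prems[of c] by blast
  ultimately show ?case by (intro exI[of _ "min e1 e2"]) auto
qed

lemma strict_affine_radius:
  fixes p q b :: real
  assumes "p < b"
  shows "\<exists>\<epsilon>>0. \<forall>t. \<bar>t\<bar> \<le> \<epsilon> \<longrightarrow> p + t * q < b"
proof (intro exI conjI allI impI)
  \<comment> \<open>The summand 1 keeps the denominator positive when \<open>q = 0\<close>; the
    factor 2 makes the bound strict.\<close>
  let ?e = "(b - p) / (2 * (\<bar>q\<bar> + 1))"
  show "?e > 0" using assms by simp
  fix t assume "\<bar>t\<bar> \<le> ?e"
  then have "\<bar>t\<bar> * (\<bar>q\<bar> + 1) \<le> (b - p) / 2"
    by (simp add: pos_le_divide_eq algebra_simps)
  moreover have "t * q \<le> \<bar>t\<bar> * (\<bar>q\<bar> + 1)"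
    using abs_mult[of t q] by (smt (verit) mult_left_mono)
  ultimately show "p + t * q < b" using assms by (simp add: field_simps)
qed

text \<open>Maps with the same fibres on \<open>A\<close> have images in bijection, through a
  representative of each fibre. Faces, which are sets of points, can thus be replaced by finite
  combinatorial labels.\<close>

lemma sum_image_cong_same_fibres:
  assumes "\<And>x y. x \<in> A \<Longrightarrow> y \<in> A \<Longrightarrow> F x = F y \<longleftrightarrow> s x = s y"
    and "\<And>x. x \<in> A \<Longrightarrow> g (F x) = h (s x)"
  shows "(\<Sum>z\<in>F ` A. g z) = (\<Sum>z\<in>s ` A. h z)"
proof -
  define i where "i = (\<lambda>\<sigma>. F (SOME x. x \<in> A \<and> s x = \<sigma>))"
  define j where "j = (\<lambda>\<phi>. s (SOME x. x \<in> A \<and> F x = \<phi>))"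
  have i: "i (s x) = F x" if "x \<in> A" for x
    using someI[of "\<lambda>y. y \<in> A \<and> s y = s x" x] that assms(1) by (auto simp: i_def)
  have j: "j (F x) = s x" if "x \<in> A" for x
    using someI[of "\<lambda>y. y \<in> A \<and> F y = F x" x] that assms(1) by (auto simp: j_def)
  show ?thesis
    by (rule sum.reindex_bij_witness[of _ i j]) (auto simp: i j assms(2))
qed

text \<open>\<open>dim\<close> is the cardinality of a basis, which is 0 for an infinite one, so
  monotonicity asks for an ambient space of finite dimension. As
  \<open>'a \<Rightarrow>\<^sub>0 real\<close> is not one in general, \<open>B\<close> supplies
  it.\<close>

lemma dim_mono_finite:
  fixes V W :: "'v::real_vector set"
  assumes "V \<subseteq> span W" "W \<subseteq> span B" "finite B"
  shows "dim V \<le> dim W"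
proof -
  obtain B' where B': "B' \<subseteq> W" "independent B'" "W \<subseteq> span B'" "card B' = dim W"
    by (rule basis_exists)
  have "finite B'"
    using independent_span_bound[OF assms(3) B'(2)] B'(1) assms(2) by blast
  moreover have "V \<subseteq> span B'"
    using assms(1) B'(3) span_mono span_span by (metis subset_trans)
  ultimately show ?thesis using dim_le_card B'(4) by metis
qed

lemma dim_eq_of_span_eq:
  fixes V W :: "'v::real_vector set"
  assumes "V \<subseteq> span W" "W \<subseteq> span V"
  shows "dim V = dim W"
proof -
  have "span V = span W" using assms by (simp only: span_eq)
  then show ?thesis by (rule span_eq_dim)
qed

context
  fixes A U P Bs :: "'v::real_vector set" and C :: "(('v \<Rightarrow> real) \<times> real) set"
  assumes sub: "subspace U" and fin: "U \<subseteq> span Bs" "finite Bs"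
    and aff: "\<And>x y. x \<in> A \<Longrightarrow> y \<in> A \<longleftrightarrow> y - x \<in> U"
    and C: "finite C" "\<And>f b. (f, b) \<in> C \<Longrightarrow> linear f"
    and P: "\<And>x. x \<in> P \<longleftrightarrow> x \<in> A \<and> (\<forall>(f, b)\<in>C. f x \<le> b)"
begin

text \<open>For \<open>x\<close> in \<open>P\<close>, the smallest face of \<open>P\<close> that
  contains \<open>x\<close>.\<close>

private definition face where
  "face x = {y \<in> P. \<forall>(f, b)\<in>C. f x = b \<longrightarrow> f y = b}"

text \<open>The directions of the affine hull of \<open>face x\<close>.\<close>

private definition dirs where
  "dirs x = {v \<in> U. \<forall>(f, b)\<in>C. f x = b \<longrightarrow> f v = 0}"

text \<open>A point is relatively interior to the face that it generates: constraints tight at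
  \<open>x\<close> do not change along \<open>v\<close>, and the finitely many slack ones leave room
  on both sides.\<close>

private lemma perturb:
  assumes "x \<in> P" "v \<in> dirs x"
  shows "\<exists>\<epsilon>>0. \<forall>t. \<bar>t\<bar> \<le> \<epsilon> \<longrightarrow> x + t *\<^sub>R v \<in> face x"
proof -
  have "\<exists>\<epsilon>>0. \<forall>c\<in>C. \<forall>t. \<bar>t\<bar> \<le> \<epsilon> \<longrightarrow>
      (fst c (x + t *\<^sub>R v) \<le> snd c \<and> (fst c x = snd c \<longrightarrow> fst c (x + t *\<^sub>R v) = snd c))"
  proof (rule finite_uniform_radius[OF C(1)])
    fix c assume c: "c \<in> C"
    obtain f b where fb: "c = (f, b)" by force
    have lin: "f (x + t *\<^sub>R v) = f x + t * f v" for t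
      using C(2) c fb by (simp add: linear_add linear_scale)
    show "\<exists>\<epsilon>>0. \<forall>t. \<bar>t\<bar> \<le> \<epsilon> \<longrightarrow>
      (fst c (x + t *\<^sub>R v) \<le> snd c \<and> (fst c x = snd c \<longrightarrow> fst c (x + t *\<^sub>R v) = snd c))"
    proof (cases "f x = b")
      case True
      then have "f v = 0" using assms(2) c fb by (auto simp: dirs_def)
      then show ?thesis using True lin fb by (auto intro: exI[of _ 1])
    next
      case False
      then have "f x < b" using assms(1) c fb P by force
      from strict_affine_radius[OF this, of "f v"] show ?thesis
        using False lin fb by (auto intro: less_imp_le)
    qed
  qed
  then obtain \<epsilon> where \<epsilon>: "\<epsilon> > 0" "\<And>c t. c \<in> C \<Longrightarrow> \<bar>t\<bar> \<le> \<epsilon> \<Longrightarrow>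
      fst c (x + t *\<^sub>R v) \<le> snd c \<and> (fst c x = snd c \<longrightarrow> fst c (x + t *\<^sub>R v) = snd c)"
    by blast
  have "x + t *\<^sub>R v \<in> A" for t
    using aff[of x "x + t *\<^sub>R v"] assms sub P by (auto simp: dirs_def subspace_scale)
  then have "x + t *\<^sub>R v \<in> face x" if "\<bar>t\<bar> \<le> \<epsilon>" for t
    using \<epsilon>(2)[OF _ that] unfolding face_def P by fastforce
  then show ?thesis using \<epsilon>(1) by blast
qed

private lemma diff_in_dirs:
  assumes "x \<in> P" "y \<in> face x" "z \<in> face x"
  shows "y - z \<in> dirs x"
proof -
  have "y - x \<in> U" "z - x \<in> U" using assms aff P by (auto simp: face_def)
  then have "y - z \<in> U" using subspace_diff[OF sub, of "y - x" "z - x"] by simp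
  moreover have "f (y - z) = 0" if "(f, b) \<in> C" "f x = b" for f b
  proof -
    have "f y = b" "f z = b" using assms(2,3) that by (auto simp: face_def)
    then show ?thesis using C(2)[OF that(1)] by (simp add: linear_diff)
  qed
  ultimately show ?thesis by (auto simp: dirs_def)
qed

private lemma affine_dim_face:
  assumes x: "x \<in> P"
  shows "affine_dim (face x) = dim (dirs x)"
  unfolding affine_dim_def
proof (rule dim_eq_of_span_eq)
  let ?D = "{y - z | y z. y \<in> face x \<and> z \<in> face x}"
  show "?D \<subseteq> span (dirs x)" using diff_in_dirs[OF x] by (auto intro: span_base)
  show "dirs x \<subseteq> span ?D"
  proof
    fix v assume v: "v \<in> dirs x"
    then obtain \<epsilon> where e: "\<epsilon> > 0" "x + \<epsilon> *\<^sub>R v \<in> face x"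
      using perturb[OF x v] by (metis abs_of_pos order_refl)
    have "x \<in> face x" using x by (auto simp: face_def)
    then have "(x + \<epsilon> *\<^sub>R v) - x \<in> ?D" using e by blast
    then have "\<epsilon> *\<^sub>R v \<in> span ?D" by (simp add: span_base)
    then have "(1/\<epsilon>) *\<^sub>R \<epsilon> *\<^sub>R v \<in> span ?D" by (rule span_scale)
    then show "v \<in> span ?D" using e by simp
  qed
qed

private lemma convex_face: "convex (face x)"
proof (rule convexI)
  fix y z u v assume yz: "y \<in> face x" "z \<in> face x" and uv: "0 \<le> u" "0 \<le> v" "u + v = (1::real)"
  let ?w = "u *\<^sub>R y + v *\<^sub>R z"
  have "z - y \<in> U" using yz aff P by (auto simp: face_def)
  moreover have u: "u = 1 - v" using uv by simp
  then have w: "?w - y = v *\<^sub>R (z - y)" unfolding u by (simp add: algebra_simps)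
  ultimately have "?w - y \<in> U" using sub by (simp add: subspace_scale)
  then have wA: "?w \<in> A" using aff[of y ?w] yz by (auto simp: P face_def)
  have lin: "f ?w = u * f y + v * f z" if "(f, b) \<in> C" for f b
    using C(2)[OF that] by (simp add: linear_add linear_scale)
  have "f ?w \<le> b" if "(f, b) \<in> C" for f b
  proof -
    have "f y \<le> b" "f z \<le> b" using yz that by (auto simp: face_def P)
    then have "u * f y + v * f z \<le> u * b + v * b" using uv by (intro add_mono mult_left_mono)
    then show ?thesis using uv lin[OF that] by (metis distrib_right mult_1)
  qed
  moreover have "f ?w = b" if "(f, b) \<in> C" "f x = b" for f b
  proof -
    have "f y = b" "f z = b" using yz that by (auto simp: face_def P)
    then show ?thesis using uv lin[OF that(1)] by (metis distrib_right mult_1)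
  qed
  ultimately show "?w \<in> face x" using wA by (auto simp: face_def P)
qed

text \<open>At a point inside a segment the slack of a constraint is a mean, with positive weights,
  of the nonnegative slacks at the ends; if it is 0, both are 0.\<close>

private lemma face_is_face:
  assumes x: "x \<in> P"
  shows "face x face_of P"
  unfolding face_of_def
proof (intro conjI ballI impI)
  show "face x \<subseteq> P" by (auto simp: face_def)
  show "convex (face x)" by (rule convex_face)
next
  fix y z w assume yz: "y \<in> P" "z \<in> P" and w: "w \<in> face x" and seg: "w \<in> open_segment y z"
  then obtain u where u: "0 < u" "u < 1" "w = (1 - u) *\<^sub>R y + u *\<^sub>R z"
    by (auto simp: in_segment)
  have "f y = b \<and> f z = b" if fb: "(f, b) \<in> C" "f x = b" for f b
  proof -
    have le: "f y \<le> b" "f z \<le> b" using yz fb by (auto simp: P)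
    have "b = f w" using w fb by (auto simp: face_def)
    also have "\<dots> = (1 - u) * f y + u * f z"
      using C(2)[OF fb(1)] u by (simp add: linear_add linear_scale)
    finally have "(1 - u) * (b - f y) + u * (b - f z) = 0" by (simp add: algebra_simps)
    moreover have "(1 - u) * (b - f y) \<ge> 0" "u * (b - f z) \<ge> 0" using le u by simp_all
    ultimately have "(1 - u) * (b - f y) = 0" "u * (b - f z) = 0" by linarith+
    then show ?thesis using u by simp
  qed
  then show "y \<in> face x" "z \<in> face x" using yz by (auto simp: face_def)
qed

text \<open>A face is generated by any of its points with the fewest tight constraints.\<close>

private lemma faces_eq: "{F. F face_of P \<and> F \<noteq> {}} = face ` P"
proof (intro equalityI subsetI)
  fix F assume "F \<in> face ` P"
  then show "F \<in> {F. F face_of P \<and> F \<noteq> {}}"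
    using face_is_face by (auto simp: face_def)
next
  fix F assume "F \<in> {F. F face_of P \<and> F \<noteq> {}}"
  then have F: "F face_of P" "F \<noteq> {}" by auto
  define T where "T = (\<lambda>x. {c \<in> C. fst c x = snd c})"
  obtain x where x: "x \<in> F" "\<And>y. y \<in> F \<Longrightarrow> card (T x) \<le> card (T y)"
    using F(2) ex_has_least_nat[of "\<lambda>x. x \<in> F" _ "\<lambda>x. card (T x)"] by blast
  have FP: "F \<subseteq> P" using F(1) face_of_imp_subset by blast
  then have xP: "x \<in> P" using x by auto
  have "F = face x"
  proof (intro equalityI subsetI)
    fix y assume y: "y \<in> F"
    \<comment> \<open>A constraint tight at the midpoint is tight at both ends. By minimality at
      \<open>x\<close> the midpoint has all the tight constraints of \<open>x\<close>, so
      \<open>y\<close> has them too.\<close>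
    let ?m = "(1/2) *\<^sub>R x + (1/2) *\<^sub>R y"
    have m: "?m \<in> F"
      using convexD[OF face_of_imp_convex[OF F(1)] x(1) y, of "1/2" "1/2"] by simp
    have "T ?m \<subseteq> T x \<inter> T y"
    proof
      fix c assume c: "c \<in> T ?m"
      obtain f b where fb: "c = (f, b)" by force
      have cC: "(f, b) \<in> C" using c fb by (auto simp: T_def)
      have "f ?m = (1/2) * f x + (1/2) * f y"
        using C(2)[OF cC] by (simp add: linear_add linear_scale)
      moreover have "f ?m = b" using c fb by (auto simp: T_def)
      moreover have "x \<in> P" "y \<in> P" using FP x(1) y by auto
      then have "f x \<le> b" "f y \<le> b" using cC by (auto simp: P)
      ultimately show "c \<in> T x \<inter> T y" using cC fb by (auto simp: T_def)
    qed
    moreover have "finite (T x)" using C(1) by (auto simp: T_def)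
    ultimately have "T ?m = T x"
      using x(2)[OF m] by (meson card_seteq le_inf_iff)
    then have "T x \<subseteq> T y" using \<open>T ?m \<subseteq> T x \<inter> T y\<close> by blast
    then show "y \<in> face x" using y FP by (auto simp: face_def T_def)
  next
    fix y assume y: "y \<in> face x"
    have "x \<in> face x" using xP by (auto simp: face_def)
    then have "x - y \<in> dirs x" using diff_in_dirs[OF xP _ y] by auto
    then obtain \<epsilon> where e: "\<epsilon> > 0" "x + \<epsilon> *\<^sub>R (x - y) \<in> face x"
      using perturb[OF xP] by (metis abs_of_pos order_refl)
    \<comment> \<open>\<open>z\<close> continues the segment from \<open>y\<close> beyond
      \<open>x\<close>; since \<open>x\<close> lies strictly between them, the face \<open>F\<close>
      must contain \<open>y\<close>.\<close>
    define z where "z = x + \<epsilon> *\<^sub>R (x - y)"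
    show "y \<in> F"
    proof (cases "x = y")
      case False
      have "x = (1 - 1/(1+\<epsilon>)) *\<^sub>R y + (1/(1+\<epsilon>)) *\<^sub>R z"
      proof -
        have "(1/(1+\<epsilon>)) *\<^sub>R z = (1/(1+\<epsilon>)) *\<^sub>R ((1+\<epsilon>) *\<^sub>R x) - (\<epsilon>/(1+\<epsilon>)) *\<^sub>R y"
          unfolding z_def by (simp add: algebra_simps)
        also have "(1/(1+\<epsilon>)) *\<^sub>R ((1+\<epsilon>) *\<^sub>R x) = x" using e by simp
        also have "\<epsilon>/(1+\<epsilon>) = 1 - 1/(1+\<epsilon>)" using e by (simp add: field_simps)
        finally show ?thesis by simp
      qed
      moreover have "y \<noteq> z"
      proof
        assume "y = z"
        then have "(1 + \<epsilon>) *\<^sub>R (x - y) = 0" unfolding z_def by (simp add: algebra_simps)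
        then show False using e False by simp
      qed
      ultimately have "x \<in> open_segment y z"
        unfolding in_segment using e by (intro conjI exI[of _ "1/(1+\<epsilon>)"]) auto
      moreover have "y \<in> P" "z \<in> P" using y e by (auto simp: face_def z_def)
      ultimately show ?thesis using F(1) x(1) by (meson face_ofD)
    qed (use x in auto)
  qed
  then show "F \<in> face ` P" using xP by blast
qed

private lemma finite_faces: "finite (face ` P)"
proof (rule finite_surj)
  show "finite (Pow C)" using C(1) by simp
  show "face ` P \<subseteq> (\<lambda>T. {y \<in> P. \<forall>(f, b)\<in>T. f y = b}) ` Pow C"
  proof
    fix F assume "F \<in> face ` P"
    then obtain x where "F = face x" by auto
    also have "\<dots> = (\<lambda>T. {y \<in> P. \<forall>(f, b)\<in>T. f y = b}) {c \<in> C. fst c x = snd c}"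
      by (auto simp: face_def)
    finally show "F \<in> (\<lambda>T. {y \<in> P. \<forall>(f, b)\<in>T. f y = b}) ` Pow C" by blast
  qed
qed

text \<open>Ensures that every face falls under one of the degrees summed in
  \<open>face_poly\<close>.\<close>

private lemma affine_dim_le:
  assumes "F \<subseteq> P"
  shows "affine_dim F \<le> affine_dim P"
  unfolding affine_dim_def
proof (rule dim_mono_finite[OF _ _ fin(2)])
  show "{x - y |x y. x \<in> F \<and> y \<in> F} \<subseteq> span {x - y |x y. x \<in> P \<and> y \<in> P}"
    using assms by (auto intro!: span_base)
  show "{x - y |x y. x \<in> P \<and> y \<in> P} \<subseteq> span Bs"
    using aff fin P by blast
qed

private lemma face_poly_eq_sum_faces: "face_poly P = (\<Sum>F\<in>face ` P. monom 1 (affine_dim F))"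
proof -
  have "face_poly P = (\<Sum>i\<le>affine_dim P. \<Sum>F\<in>{F \<in> face ` P. affine_dim F = i}. monom 1 (affine_dim F))"
    unfolding face_poly_def
  proof (rule sum.cong[OF refl])
    fix i
    have eq: "{F. F face_of P \<and> F \<noteq> {} \<and> affine_dim F = i} = {F \<in> face ` P. affine_dim F = i}"
      using faces_eq by blast
    have "monom (int (card {F \<in> face ` P. affine_dim F = i})) i =
        (\<Sum>F\<in>{F \<in> face ` P. affine_dim F = i}. monom 1 i)"
      by (simp add: of_nat_monom monom_altdef smult_monom[symmetric] mult_monom)
    also have "\<dots> = (\<Sum>F\<in>{F \<in> face ` P. affine_dim F = i}. monom 1 (affine_dim F))"
      by (intro sum.cong) auto
    finally show "monom (int (card {F. F face_of P \<and> F \<noteq> {} \<and> affine_dim F = i})) i = \<dots>"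
      unfolding eq .
  qed
  also have "\<dots> = (\<Sum>F\<in>face ` P. monom 1 (affine_dim F))"
    by (rule sum.group[OF finite_faces]) (auto simp: face_def intro!: affine_dim_le)
  finally show ?thesis .
qed

text \<open>Two points generate the same face exactly when they have the same tight constraints. The
  sum over faces may therefore run over the values of any label \<open>s\<close> with these fibres,
  provided the dimension can be read off the label.\<close>

lemma face_poly_polyhedron:
  assumes s: "\<And>x y. x \<in> P \<Longrightarrow> y \<in> P \<Longrightarrow> s x = s y \<longleftrightarrow> (\<forall>(f, b)\<in>C. f x = b \<longleftrightarrow> f y = b)"
    and d: "\<And>x. x \<in> P \<Longrightarrow> d (s x) = dim {v \<in> U. \<forall>(f, b)\<in>C. f x = b \<longrightarrow> f v = 0}"
  shows "face_poly P = (\<Sum>\<sigma>\<in>s ` P. monom 1 (d \<sigma>))"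
  unfolding face_poly_eq_sum_faces
proof (rule sum_image_cong_same_fibres)
  fix x y assume xy: "x \<in> P" "y \<in> P"
  have "face x = face y \<longleftrightarrow> (\<forall>(f, b)\<in>C. f x = b \<longleftrightarrow> f y = b)"
  proof
    assume eq: "face x = face y"
    have "x \<in> face x" "y \<in> face y" using xy by (auto simp: face_def)
    then have "x \<in> face y" "y \<in> face x" using eq by auto
    then show "\<forall>(f, b)\<in>C. f x = b \<longleftrightarrow> f y = b" by (auto simp: face_def)
  next
    assume "\<forall>(f, b)\<in>C. f x = b \<longleftrightarrow> f y = b"
    then show "face x = face y" by (auto simp: face_def)
  qed
  then show "face x = face y \<longleftrightarrow> s x = s y" using s[OF xy] by simp
next
  fix x assume "x \<in> P"
  then show "monom 1 (affine_dim (face x)) = monom 1 (d (s x))"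
    using d affine_dim_face by (simp add: dirs_def)
qed

end

section \<open>Dimensions of spaces with vanishing block sums\<close>

abbreviation coord :: "('a \<Rightarrow>\<^sub>0 real) \<Rightarrow> 'a \<Rightarrow> real" where
  "coord \<equiv> Poly_Mapping.lookup"

lemma lookup_scaleR [simp]:
  "coord (c *\<^sub>R v) i = c *\<^sub>R coord v i"
  by (simp add: scaleR_poly_mapping_def Abs_poly_mapping_inverse)

lemma linear_lookup: "linear (\<lambda>v :: 'a \<Rightarrow>\<^sub>0 real. coord v i)"
  by (rule linearI) (simp_all add: lookup_add)

lemma linear_sum_lookup: "linear (\<lambda>v :: 'a \<Rightarrow>\<^sub>0 real. \<Sum>i\<in>F. coord v i)"
  by (rule linearI) (simp_all add: lookup_add sum.distrib sum_distrib_left)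

text \<open>The vectors \<open>g x\<close> are differences of unit vectors, roots of type A. As
  \<open>\<rho> x\<close> lies outside \<open>T\<close>, the coordinate at \<open>y\<close> in
  \<open>T\<close> sees only \<open>g y\<close>, so the coordinates on \<open>T\<close> form a dual
  basis.\<close>

lemma dim_eq_card_roots:
  fixes W :: "('a \<Rightarrow>\<^sub>0 real) set" and \<rho> :: "'a \<Rightarrow> 'a"
  defines "g \<equiv> \<lambda>x. Poly_Mapping.single x 1 - Poly_Mapping.single (\<rho> x) (1::real)"
  assumes T: "finite T" "\<And>x. x \<in> T \<Longrightarrow> \<rho> x \<notin> T"
    and g: "\<And>x. x \<in> T \<Longrightarrow> g x \<in> W"
    and W: "\<And>v. v \<in> W \<Longrightarrow> v = (\<Sum>x\<in>T. coord v x *\<^sub>R g x)"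
  shows "dim W = card T"
proof -
  have lk: "coord (g x) y = (if x = y then 1 else 0)" if "x \<in> T" "y \<in> T" for x y
    using that T by (auto simp: g_def lookup_minus lookup_single when_def)
  have lks: "coord (\<Sum>x\<in>T. c x *\<^sub>R g x) y = c y" if "y \<in> T" for c y
  proof -
    have "coord (\<Sum>x\<in>T. c x *\<^sub>R g x) y = (\<Sum>x\<in>T. if x = y then c x else 0)"
      using that by (simp add: lookup_sum lk if_distrib cong: sum.cong if_cong)
    then show ?thesis using that T by simp
  qed
  have inj: "inj_on g T"
    using lk by (intro inj_onI) (metis zero_neq_one)
  show ?thesis
  proof (rule dim_unique)
    show "g ` T \<subseteq> W" using g by auto
    show "card (g ` T) = card T" using inj by (rule card_image)
    show "W \<subseteq> span (g ` T)"
    proof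
      fix v assume "v \<in> W"
      then have "v = (\<Sum>x\<in>T. coord v x *\<^sub>R g x)" by (rule W)
      moreover have "\<dots> \<in> span (g ` T)" by (intro span_sum span_scale span_base) auto
      ultimately show "v \<in> span (g ` T)" by simp
    qed
    show "independent (g ` T)"
    proof (rule independent_if_scalars_zero)
      show "finite (g ` T)" using T by simp
      fix c z assume eq: "(\<Sum>x\<in>g ` T. c x *\<^sub>R x) = 0" and "z \<in> g ` T"
      then obtain y where y: "y \<in> T" "z = g y" by auto
      have "(\<Sum>x\<in>T. c (g x) *\<^sub>R g x) = 0" using eq by (simp add: sum.reindex[OF inj])
      then show "c z = 0" using lks[OF y(1), of "\<lambda>x. c (g x)"] y by simp
    qed
  qed
qed

text \<open>The vectors with sum 0 on a block are spanned by the roots that join its elements to a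
  chosen one, which gives one less than the size of the block. Truncated subtraction is right for an
  empty block, whose equation is void.\<close>

lemma dim_two_blocks:
  assumes S: "finite S"
  shows "dim {v :: 'a \<Rightarrow>\<^sub>0 real. Poly_Mapping.keys v \<subseteq> S \<and>
      (\<Sum>e\<in>S \<inter> F. coord v e) = 0 \<and> (\<Sum>e\<in>S - F. coord v e) = 0} =
    (card (S \<inter> F) - 1) + (card (S - F) - 1)"
    (is "dim ?W = _")
proof -
  \<comment> \<open>The choice is arbitrary if the block is empty; then no element of
    \<open>T\<close> lies on that side and \<open>\<rho>\<close> never uses it there.\<close>
  define a where "a = (SOME a. a \<in> S \<inter> F)"
  define b where "b = (SOME b. b \<in> S - F)"
  define T where "T = (S \<inter> F - {a}) \<union> (S - F - {b})"
  define \<rho> where "\<rho> = (\<lambda>x. if x \<in> F then a else b)"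
  have a: "a \<in> S \<inter> F" if "S \<inter> F \<noteq> {}" using that unfolding a_def by (metis ex_in_conv someI)
  have b: "b \<in> S - F" if "S - F \<noteq> {}" using that unfolding b_def by (metis ex_in_conv someI)
  have cT: "card T = (card (S \<inter> F) - 1) + (card (S - F) - 1)"
  proof -
    have del: "card (A - {x}) = card A - 1" if "A \<noteq> {} \<Longrightarrow> x \<in> A" for A and x :: 'a
      using that by (cases "A = {}") auto
    have "card (S \<inter> F - {a}) = card (S \<inter> F) - 1" "card (S - F - {b}) = card (S - F) - 1"
      by (rule del, rule a, assumption, rule del, rule b)
    moreover have "card T = card (S \<inter> F - {a}) + card (S - F - {b})"
      unfolding T_def using S by (intro card_Un_disjoint) auto
    ultimately show ?thesis by simp
  qed
  have split: "(\<Sum>e\<in>S \<inter> F. h e) = h a + (\<Sum>e\<in>S \<inter> F - {a}. h e)" if "S \<inter> F \<noteq> {}" for h :: "'a \<Rightarrow> real"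
    using S a[OF that] by (intro sum.remove) auto
  have split': "(\<Sum>e\<in>S - F. h e) = h b + (\<Sum>e\<in>S - F - {b}. h e)" if "S - F \<noteq> {}" for h :: "'a \<Rightarrow> real"
    using S b[OF that] by (intro sum.remove) auto
  have "dim ?W = card T"
  proof (rule dim_eq_card_roots[where \<rho> = \<rho>])
    show "finite T" using S by (simp add: T_def)
    show "\<rho> x \<notin> T" if "x \<in> T" for x using that a b by (auto simp: T_def \<rho>_def)
    show "Poly_Mapping.single x 1 - Poly_Mapping.single (\<rho> x) 1 \<in> ?W" if x: "x \<in> T" for x
    proof -
      have \<rho>: "\<rho> x \<in> S" "\<rho> x \<in> F \<longleftrightarrow> x \<in> F" "x \<in> S"
        using x a b by (auto simp: T_def \<rho>_def)
      have sm: "(\<Sum>e\<in>A. coord (Poly_Mapping.single x 1 - Poly_Mapping.single (\<rho> x) (1::real)) e) = 0"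
        if "x \<in> A \<longleftrightarrow> \<rho> x \<in> A" "finite A" for A
        using that by (simp add: lookup_minus lookup_single sum_subtractf when_def)
      have "Poly_Mapping.keys (Poly_Mapping.single x 1 - Poly_Mapping.single (\<rho> x) (1::real)) \<subseteq> S"
        using \<rho> keys_diff[of "Poly_Mapping.single x 1" "Poly_Mapping.single (\<rho> x) (1::real)"] by auto
      then show ?thesis using sm[of "S \<inter> F"] sm[of "S - F"] \<rho> S by auto
    qed
    fix v assume v: "v \<in> ?W"
    show "v = (\<Sum>x\<in>T. coord v x *\<^sub>R
        (Poly_Mapping.single x 1 - Poly_Mapping.single (\<rho> x) 1))" (is "v = ?r")
    proof (rule poly_mapping_eqI)
      fix y
      have r: "coord ?r y = (\<Sum>x\<in>T. if x = y then coord v x else 0)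
          - (\<Sum>x\<in>T. if \<rho> x = y then coord v x else 0)"
        unfolding lookup_sum sum_subtractf[symmetric]
        by (intro sum.cong) (auto simp: lookup_minus lookup_single when_def)
      have fT: "finite T" using S by (simp add: T_def)
      \<comment> \<open>On \<open>T\<close> the coordinates agree by duality. At a chosen element
        the right-hand side gives minus the sum over the rest of its block, which is the coordinate
        of \<open>v\<close> because the block sums to 0.\<close>
      consider "y \<in> T" | "y \<in> S \<inter> F" "y = a" | "y \<in> S - F" "y = b" | "y \<notin> S"
        unfolding T_def by blast
      then show "coord v y = coord ?r y"
      proof cases
        case 1
        then have "\<rho> x \<noteq> y" if "x \<in> T" for x using that a b by (auto simp: T_def \<rho>_def)
        then show ?thesis unfolding r using 1 fT by simp
      next
        case 2
        have "(\<Sum>x\<in>T. if \<rho> x = y then coord v x else 0)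
            = (\<Sum>x\<in>S \<inter> F - {a}. coord v x)"
          using fT 2 b by (intro sum.mono_neutral_cong_right) (auto simp: T_def \<rho>_def)
        moreover have "y \<notin> T" using 2 by (auto simp: T_def)
        ultimately have "coord ?r y = - (\<Sum>x\<in>S \<inter> F - {a}. coord v x)"
          unfolding r using fT by simp
        moreover have "S \<inter> F \<noteq> {}" using 2 by auto
        ultimately show ?thesis using v split[of "coord v"] 2(2) by simp
      next
        case 3
        have "(\<Sum>x\<in>T. if \<rho> x = y then coord v x else 0)
            = (\<Sum>x\<in>S - F - {b}. coord v x)"
          using fT 3 a by (intro sum.mono_neutral_cong_right) (auto simp: T_def \<rho>_def)
        moreover have "y \<notin> T" using 3 by (auto simp: T_def)
        ultimately have "coord ?r y = - (\<Sum>x\<in>S - F - {b}. coord v x)"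
          unfolding r using fT by simp
        moreover have "S - F \<noteq> {}" using 3 by auto
        ultimately show ?thesis using v split'[of "coord v"] 3(2) by simp
      next
        case 4
        then have "\<rho> x \<noteq> y" "x \<noteq> y" if "x \<in> T" for x using that a b by (auto simp: T_def \<rho>_def)
        then have "coord ?r y = 0" unfolding r by simp
        moreover have "y \<notin> Poly_Mapping.keys v" using v 4 by auto
        ultimately show ?thesis by (simp add: in_keys_iff)
      qed
    qed
  qed
  then show ?thesis using cT by simp
qed

subsection \<open>Cells of hypersimplices\<close>

text \<open>Points are total functions with free values outside \<open>E\<close>. The same point can
  then belong to cells over several ground sets, which \<open>cell_union\<close> and
  \<open>cell_vals_contract\<close> exploit; \<open>face_poly_capped\<close> restores finite
  support.\<close>

definition cell :: "'a set \<Rightarrow> nat \<Rightarrow> 'a set \<Rightarrow> 'a set \<Rightarrow> ('a \<Rightarrow> real) set" where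
  "cell E k I S = {x. (\<forall>e\<in>I. x e = 1) \<and> (\<forall>e\<in>S. 0 < x e \<and> x e < 1) \<and>
     (\<forall>e\<in>E - I - S. x e = 0) \<and> sum x E = real k}"

definition cells :: "'a set \<Rightarrow> nat \<Rightarrow> ('a set \<times> 'a set) set" where
  "cells E k = {(I, S). I \<subseteq> E \<and> S \<subseteq> E - I \<and> cell E k I S \<noteq> {}}"

definition capped_hypersimplex ::
    "'a set \<Rightarrow> nat \<Rightarrow> 'a set set \<Rightarrow> ('a set \<Rightarrow> nat) \<Rightarrow> ('a \<Rightarrow>\<^sub>0 real) set" where
  "capped_hypersimplex E k \<F> r = {x. Poly_Mapping.keys x \<subseteq> E \<and>
     (\<forall>e\<in>E. 0 \<le> coord x e \<and> coord x e \<le> 1) \<and>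
     sum (coord x) E = real k \<and>
     (\<forall>F\<in>\<F>. sum (coord x) F \<le> real (r F))}"

definition tight_sets ::
    "'a set \<Rightarrow> nat \<Rightarrow> 'a set set \<Rightarrow> ('a set \<Rightarrow> nat) \<Rightarrow> 'a set \<Rightarrow> 'a set \<Rightarrow> 'a set set set" where
  "tight_sets E k \<F> r I S = {J. \<exists>x\<in>cell E k I S. (\<forall>F\<in>\<F>. sum x F \<le> real (r F)) \<and>
     J = {F \<in> \<F>. sum x F = real (r F)}}"

text \<open>The direction space of a face whose relative interior has fractional coordinates
  \<open>S\<close> and tight caps \<open>J\<close>: integral coordinates cannot move.\<close>

definition block_space :: "'a set \<Rightarrow> 'a set set \<Rightarrow> ('a \<Rightarrow>\<^sub>0 real) set" where
  "block_space S J = {v. Poly_Mapping.keys v \<subseteq> S \<and> sum (coord v) S = 0 \<and>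
     (\<forall>F\<in>J. sum (coord v) F = 0)}"

lemma cell_iff:
  assumes "x \<in> cell E k I S" "e \<in> E"
  shows "x e = 1 \<longleftrightarrow> e \<in> I" and "I \<inter> S = {} \<Longrightarrow> 0 < x e \<and> x e < 1 \<longleftrightarrow> e \<in> S"
proof -
  show "x e = 1 \<longleftrightarrow> e \<in> I"
    using assms by (cases "e \<in> I"; cases "e \<in> S") (auto simp: cell_def)
  show "0 < x e \<and> x e < 1 \<longleftrightarrow> e \<in> S" if "I \<inter> S = {}"
    using assms that by (cases "e \<in> I"; cases "e \<in> S") (auto simp: cell_def)
qed

lemma sum_lookup_keys:
  assumes "Poly_Mapping.keys v \<subseteq> S" "finite S" "finite F"
  shows "sum (coord v) F = sum (coord v) (S \<inter> F)"
  using assms by (intro sum.mono_neutral_right) (auto simp: in_keys_iff)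

lemma poly_mapping_eq_sum_single:
  fixes v :: "'a \<Rightarrow>\<^sub>0 real"
  assumes "Poly_Mapping.keys v \<subseteq> E" "finite E"
  shows "v = (\<Sum>e\<in>E. coord v e *\<^sub>R Poly_Mapping.single e 1)"
proof (rule poly_mapping_eqI)
  fix i
  have "coord (\<Sum>e\<in>E. coord v e *\<^sub>R Poly_Mapping.single e (1::real)) i
      = (\<Sum>e\<in>E. if e = i then coord v e else 0)"
    unfolding lookup_sum by (intro sum.cong) (auto simp: lookup_single when_def)
  also have "\<dots> = coord v i"
    using assms by (auto simp: in_keys_iff)
  finally show "coord v i =
    coord (\<Sum>e\<in>E. coord v e *\<^sub>R Poly_Mapping.single e (1::real)) i" ..
qed

text \<open>A coordinate confined to the unit interval is 0, 1 or fractional, so the first two sets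
  in \<open>s x\<close> record which of its bounds are tight, and \<open>s\<close> is a label as
  \<open>face_poly_polyhedron\<close> asks for.\<close>

lemma face_poly_capped_image:
  fixes E :: "'a set" and k :: nat and r :: "'a set \<Rightarrow> nat"
  assumes fin: "finite E" "finite \<F>" and sub: "\<And>F. F \<in> \<F> \<Longrightarrow> F \<subseteq> E"
  defines "P \<equiv> capped_hypersimplex E k \<F> r"
  defines "s \<equiv> \<lambda>x. (({e \<in> E. coord x e = 1},
      {e \<in> E. 0 < coord x e \<and> coord x e < 1}),
      {F \<in> \<F>. sum (coord x) F = real (r F)})"
  shows "face_poly P = (\<Sum>\<sigma>\<in>s ` P. monom 1 (dim (block_space (snd (fst \<sigma>)) (snd \<sigma>))))"
proof (rule face_poly_polyhedron)
  let ?U = "{v :: 'a \<Rightarrow>\<^sub>0 real. Poly_Mapping.keys v \<subseteq> E \<and> sum (coord v) E = 0}"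
  let ?A = "{v :: 'a \<Rightarrow>\<^sub>0 real. Poly_Mapping.keys v \<subseteq> E \<and> sum (coord v) E = real k}"
  let ?C = "(\<lambda>e. (\<lambda>x :: 'a \<Rightarrow>\<^sub>0 real. - coord x e, 0)) ` E
      \<union> (\<lambda>e. (\<lambda>x. coord x e, 1)) ` E
      \<union> (\<lambda>F. (\<lambda>x. sum (coord x) F, real (r F))) ` \<F>"
  have ball_C: "(\<forall>(f, b)\<in>?C. Q f b) \<longleftrightarrow> (\<forall>e\<in>E. Q (\<lambda>x. - coord x e) 0) \<and>
      (\<forall>e\<in>E. Q (\<lambda>x. coord x e) 1) \<and>
      (\<forall>F\<in>\<F>. Q (\<lambda>x. sum (coord x) F) (real (r F)))" for Q
    by (simp add: ball_Un conj_assoc)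
  have keys_iff: "Poly_Mapping.keys v \<subseteq> E \<longleftrightarrow> (\<forall>e. e \<notin> E \<longrightarrow> coord v e = 0)"
    for v :: "'a \<Rightarrow>\<^sub>0 real" by (auto simp: in_keys_iff)
  show "subspace ?U"
    unfolding keys_iff
    by (auto simp: subspace_def lookup_add sum.distrib sum_distrib_left[symmetric])
  show "?U \<subseteq> span ((\<lambda>e. Poly_Mapping.single e 1) ` E)"
  proof
    fix v assume "v \<in> ?U"
    then have "v = (\<Sum>e\<in>E. coord v e *\<^sub>R Poly_Mapping.single e 1)"
      using fin by (intro poly_mapping_eq_sum_single) auto
    moreover have "\<dots> \<in> span ((\<lambda>e. Poly_Mapping.single e 1) ` E)"
      by (intro span_sum span_scale span_base imageI)
    ultimately show "v \<in> span ((\<lambda>e. Poly_Mapping.single e 1) ` E)" by simp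
  qed
  show "finite ((\<lambda>e. Poly_Mapping.single e (1::real)) ` E)" using fin by simp
  show "y \<in> ?A \<longleftrightarrow> y - x \<in> ?U" if "x \<in> ?A" for x y
    using that unfolding keys_iff by (auto simp: lookup_minus sum_subtractf)
  show "finite ?C" using fin by simp
  have "linear (\<lambda>x :: 'a \<Rightarrow>\<^sub>0 real. - coord x e)" for e
    using linear_lookup by (rule linear_compose_neg)
  then show "linear f" if "(f, b) \<in> ?C" for f b
    using that linear_lookup linear_sum_lookup by auto
  show "x \<in> P \<longleftrightarrow> x \<in> ?A \<and> (\<forall>(f, b)\<in>?C. f x \<le> b)" for x
    unfolding ball_C by (auto simp: P_def capped_hypersimplex_def)
  show "s x = s y \<longleftrightarrow> (\<forall>(f, b)\<in>?C. f x = b \<longleftrightarrow> f y = b)" if "x \<in> P" "y \<in> P" for x y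
  proof -
    have el: "((a = 1 \<longleftrightarrow> b = 1) \<and> (0 < a \<and> a < 1 \<longleftrightarrow> 0 < b \<and> b < 1)) \<longleftrightarrow>
        ((- a = 0 \<longleftrightarrow> - b = 0) \<and> (a = 1 \<longleftrightarrow> b = 1))"
      if "0 \<le> a \<and> a \<le> 1" "0 \<le> b \<and> b \<le> 1" for a b :: real
      using that by auto
    have bounds: "0 \<le> coord z e \<and> coord z e \<le> 1"
      if "z \<in> P" "e \<in> E" for z e
      using that by (auto simp: P_def capped_hypersimplex_def)
    let ?T = "\<forall>F\<in>\<F>. sum (coord x) F = real (r F) \<longleftrightarrow> sum (coord y) F = real (r F)"
    have Collect_eq: "{z \<in> A. p z} = {z \<in> A. q z} \<longleftrightarrow> (\<forall>z\<in>A. p z \<longleftrightarrow> q z)" for A :: "'b set" and p q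
      by blast
    have "s x = s y \<longleftrightarrow>
        (\<forall>e\<in>E. (coord x e = 1 \<longleftrightarrow> coord y e = 1) \<and>
          (0 < coord x e \<and> coord x e < 1 \<longleftrightarrow>
            0 < coord y e \<and> coord y e < 1)) \<and> ?T"
      unfolding s_def prod.inject Collect_eq ball_conj_distrib by (rule refl)
    also have "\<dots> \<longleftrightarrow>
        (\<forall>e\<in>E. (- coord x e = 0 \<longleftrightarrow> - coord y e = 0) \<and>
          (coord x e = 1 \<longleftrightarrow> coord y e = 1)) \<and> ?T"
      by (intro arg_cong2[where f = "(\<and>)"] ball_cong refl el bounds that)
    also have "\<dots> \<longleftrightarrow> (\<forall>(f, b)\<in>?C. f x = b \<longleftrightarrow> f y = b)"
      unfolding ball_C ball_conj_distrib by (rule conj_assoc)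
    finally show ?thesis .
  qed
  show "dim (block_space (snd (fst (s x))) (snd (s x))) =
      dim {v \<in> ?U. \<forall>(f, b)\<in>?C. f x = b \<longrightarrow> f v = 0}" if x: "x \<in> P" for x
  proof (rule arg_cong[where f = dim], intro equalityI subsetI)
    let ?S = "{e \<in> E. 0 < coord x e \<and> coord x e < 1}"
    fix v assume "v \<in> block_space (snd (fst (s x))) (snd (s x))"
    then have v: "Poly_Mapping.keys v \<subseteq> ?S" "sum (coord v) ?S = 0"
      "\<And>F. F \<in> \<F> \<Longrightarrow> sum (coord x) F = real (r F) \<Longrightarrow> sum (coord v) F = 0"
      by (auto simp: block_space_def s_def)
    have "sum (coord v) E = sum (coord v) ?S"
      using v(1) fin by (intro sum.mono_neutral_right) (auto simp: in_keys_iff)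
    moreover have "coord v e = 0" if "e \<notin> ?S" for e
      using v(1) that by (auto simp: in_keys_iff)
    ultimately show "v \<in> {v \<in> ?U. \<forall>(f, b)\<in>?C. f x = b \<longrightarrow> f v = 0}"
      unfolding ball_C using v by auto
  next
    let ?S = "{e \<in> E. 0 < coord x e \<and> coord x e < 1}"
    fix v assume "v \<in> {v \<in> ?U. \<forall>(f, b)\<in>?C. f x = b \<longrightarrow> f v = 0}"
    then have v: "Poly_Mapping.keys v \<subseteq> E" "sum (coord v) E = 0"
      "\<And>e. e \<in> E \<Longrightarrow> coord x e = 0 \<or> coord x e = 1 \<Longrightarrow> coord v e = 0"
      "\<And>F. F \<in> \<F> \<Longrightarrow> sum (coord x) F = real (r F) \<Longrightarrow> sum (coord v) F = 0"
      unfolding ball_C by auto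
    have keys: "Poly_Mapping.keys v \<subseteq> ?S"
    proof
      fix e assume e: "e \<in> Poly_Mapping.keys v"
      then have eE: "e \<in> E" using v(1) by auto
      have "coord v e \<noteq> 0" using e by (simp add: in_keys_iff)
      then have "coord x e \<noteq> 0" "coord x e \<noteq> 1" using v(3) eE by auto
      moreover have "0 \<le> coord x e" "coord x e \<le> 1"
        using x eE by (auto simp: P_def capped_hypersimplex_def)
      ultimately show "e \<in> ?S" using eE by auto
    qed
    moreover have "sum (coord v) E = sum (coord v) ?S"
      using keys fin by (intro sum.mono_neutral_right) (auto simp: in_keys_iff)
    ultimately show "v \<in> block_space (snd (fst (s x))) (snd (s x))"
      using v by (auto simp: block_space_def s_def)
  qed
qed

lemma finite_cells: "finite E \<Longrightarrow> finite (cells E k)"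
  by (rule finite_subset[of _ "Pow E \<times> Pow E"]) (auto simp: cells_def)

lemma finite_tight_sets: "finite \<F> \<Longrightarrow> finite (tight_sets E k \<F> r I S)"
  by (rule finite_subset[of _ "Pow \<F>"]) (auto simp: tight_sets_def)

lemma face_poly_capped:
  assumes fin: "finite E" "finite \<F>" and sub: "\<And>F. F \<in> \<F> \<Longrightarrow> F \<subseteq> E"
  shows "face_poly (capped_hypersimplex E k \<F> r) =
    (\<Sum>(I, S)\<in>cells E k. \<Sum>J\<in>tight_sets E k \<F> r I S. monom 1 (dim (block_space S J)))"
proof -
  define s where "s = (\<lambda>x. (({e \<in> E. coord x e = (1::real)},
      {e \<in> E. 0 < coord x e \<and> coord x e < 1}),
      {F \<in> \<F>. sum (coord x) F = real (r F)}))"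
  have "s ` capped_hypersimplex E k \<F> r =
      (SIGMA c:cells E k. tight_sets E k \<F> r (fst c) (snd c))"
  proof (intro equalityI subsetI)
    fix \<sigma> assume "\<sigma> \<in> s ` capped_hypersimplex E k \<F> r"
    then obtain x where x: "x \<in> capped_hypersimplex E k \<F> r" "\<sigma> = s x" by auto
    have "coord x \<in> cell E k (fst (fst \<sigma>)) (snd (fst \<sigma>))"
      using x by (fastforce simp: cell_def s_def capped_hypersimplex_def)
    then show "\<sigma> \<in> (SIGMA c:cells E k. tight_sets E k \<F> r (fst c) (snd c))"
      using x by (auto simp: cells_def tight_sets_def s_def capped_hypersimplex_def)
  next
    fix \<sigma> assume \<sigma>: "\<sigma> \<in> (SIGMA c:cells E k. tight_sets E k \<F> r (fst c) (snd c))"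
    obtain I S J where IS: "\<sigma> = ((I, S), J)" by (metis prod.exhaust)
    obtain x where x: "x \<in> cell E k I S" "\<And>F. F \<in> \<F> \<Longrightarrow> sum x F \<le> real (r F)"
      "J = {F \<in> \<F>. sum x F = real (r F)}" and ISE: "I \<subseteq> E" "S \<subseteq> E - I"
      using \<sigma> by (auto simp: IS tight_sets_def cells_def)
    \<comment> \<open>Values of \<open>x\<close> outside \<open>E\<close> are unrestricted;
      \<open>v\<close> cuts them off, which changes no sum over a subset of
      \<open>E\<close>.\<close>
    define v where "v = (\<Sum>e\<in>E. Poly_Mapping.single e (x e))"
    have lk: "coord v i = (if i \<in> E then x i else 0)" for i
      using fin by (simp add: v_def lookup_sum lookup_single when_def)
    have sums: "sum (coord v) F = sum x F" if "F \<subseteq> E" for F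
      using that by (intro sum.cong) (auto simp: lk)
    have bounds: "0 \<le> x e \<and> x e \<le> 1" if "e \<in> E" for e
      using x(1) that by (cases "e \<in> I"; cases "e \<in> S") (auto simp: cell_def)
    have "Poly_Mapping.keys v \<subseteq> E" by (auto simp: in_keys_iff lk split: if_splits)
    moreover have "\<forall>e\<in>E. 0 \<le> coord v e \<and> coord v e \<le> 1"
      using bounds by (simp add: lk)
    moreover have "sum (coord v) E = real k"
      using x(1) by (simp add: sums cell_def)
    moreover have "\<forall>F\<in>\<F>. sum (coord v) F \<le> real (r F)"
      using x(2) sub by (simp add: sums)
    ultimately have "v \<in> capped_hypersimplex E k \<F> r" by (simp add: capped_hypersimplex_def)
    moreover have "s v = \<sigma>"
    proof -
      have "{e \<in> E. coord v e = 1} = I"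
        using cell_iff(1)[OF x(1)] ISE by (auto simp: lk)
      moreover have "{e \<in> E. 0 < coord v e \<and> coord v e < 1} = S"
        using cell_iff(2)[OF x(1)] ISE by (auto 4 3 simp: lk)
      moreover have "{F \<in> \<F>. sum (coord v) F = real (r F)} = J"
        using x(3) sub by (auto simp: sums)
      ultimately show ?thesis by (simp add: s_def IS)
    qed
    ultimately show "\<sigma> \<in> s ` capped_hypersimplex E k \<F> r" by blast
  qed
  then have "face_poly (capped_hypersimplex E k \<F> r) =
      (\<Sum>\<sigma>\<in>(SIGMA c:cells E k. tight_sets E k \<F> r (fst c) (snd c)).
        monom 1 (dim (block_space (snd (fst \<sigma>)) (snd \<sigma>))))"
    using face_poly_capped_image[OF fin sub, where k = k and r = r] by (simp add: s_def)
  also have "\<dots> = (\<Sum>c\<in>cells E k. \<Sum>J\<in>tight_sets E k \<F> r (fst c) (snd c).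
      monom 1 (dim (block_space (snd c) J)))"
    using fin by (subst sum.Sigma) (auto simp: finite_cells finite_tight_sets case_prod_unfold)
  finally show ?thesis by (simp add: case_prod_unfold)
qed

lemma dim_block_space_empty:
  assumes "finite S"
  shows "dim (block_space S {}) = card S - 1"
  \<comment> \<open>With \<open>UNIV\<close> for \<open>F\<close> the second block is empty and
    contributes 0.\<close>
  using dim_two_blocks[OF assms, of UNIV] by (simp add: block_space_def)

text \<open>The equation of a cap that meets \<open>S\<close> in the complement of \<open>F\<close>
  follows from the total and the equation of \<open>F\<close>, so all caps of \<open>J\<close>
  together lower the dimension no further than \<open>F\<close> alone.\<close>

lemma dim_block_space_insert:
  assumes S: "finite S" and F: "F \<in> J" "finite F"
    and J: "\<And>G. G \<in> J \<Longrightarrow> G \<noteq> F \<Longrightarrow> finite G \<and> S \<inter> G = S - F"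
  shows "dim (block_space S J) = (card (S \<inter> F) - 1) + (card (S - F) - 1)"
proof -
  have "block_space S J = {v. Poly_Mapping.keys v \<subseteq> S \<and>
      sum (coord v) (S \<inter> F) = 0 \<and> sum (coord v) (S - F) = 0}"
    (is "_ = ?W")
  proof (intro equalityI subsetI)
    have split: "sum (coord v) S =
        sum (coord v) (S \<inter> F) + sum (coord v) (S - F)"
      for v :: "'a \<Rightarrow>\<^sub>0 real"
      using S by (metis sum.Int_Diff)
    show "v \<in> ?W" if "v \<in> block_space S J" for v
    proof -
      have v: "Poly_Mapping.keys v \<subseteq> S" "sum (coord v) S = 0"
          "sum (coord v) F = 0"
        using that F by (auto simp: block_space_def)
      then show ?thesis using split[of v] sum_lookup_keys[OF v(1) S F(2)] by simp
    qed
    show "v \<in> block_space S J" if "v \<in> ?W" for v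
    proof -
      have v: "Poly_Mapping.keys v \<subseteq> S" using that by auto
      have "sum (coord v) G = 0" if "G \<in> J" for G
      proof (cases "G = F")
        case True
        then show ?thesis using sum_lookup_keys[OF v S F(2)] \<open>v \<in> ?W\<close> by simp
      next
        case False
        then show ?thesis using sum_lookup_keys[OF v S, of G] J[OF that] \<open>v \<in> ?W\<close> by simp
      qed
      then show ?thesis using \<open>v \<in> ?W\<close> split[of v] by (simp add: block_space_def)
    qed
  qed
  then show ?thesis using dim_two_blocks[OF S, of F] by simp
qed

definition cell_vals :: "'a set \<Rightarrow> nat \<Rightarrow> 'a set \<Rightarrow> 'a set \<Rightarrow> 'a set \<Rightarrow> real set" where
  "cell_vals E k I S F = (\<lambda>x. sum x F) ` cell E k I S"

text \<open>The contribution of a cell to the difference between the uncut hypersimplex and the one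
  with the single cap \<open>F\<close>: the open piece below the cap has the dimension of the cell,
  and on the section at the cap both blocks of \<open>S\<close> have a fixed sum.\<close>

definition cut_poly :: "'a set \<Rightarrow> nat \<Rightarrow> 'a set \<Rightarrow> nat \<Rightarrow> 'a set \<Rightarrow> 'a set \<Rightarrow> int poly" where
  "cut_poly E k F r I S = monom 1 (card S - 1)
     - (if \<exists>s\<in>cell_vals E k I S F. s < real r then monom 1 (card S - 1) else 0)
     - (if real r \<in> cell_vals E k I S F then monom 1 ((card (S \<inter> F) - 1) + (card (S - F) - 1)) else 0)"

text \<open>For the cells that count, \<open>S\<close> lies in the symmetric difference of the two members of \<open>p\<close>,
  so the exponent summed over \<open>p\<close> is the dimension of a section by the boundary of either cap.\<close>

definition pair_poly :: "'a set \<Rightarrow> nat \<Rightarrow> ('a set \<Rightarrow> nat) \<Rightarrow> 'a set set \<Rightarrow> 'a set \<Rightarrow> 'a set \<Rightarrow> int poly" where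
  "pair_poly E k r p I S = (if \<Inter>p \<subseteq> I \<and> I \<union> S \<subseteq> \<Union>p then
     monom 1 (card S - 1)
     - (if \<exists>F\<in>p. real (r F) \<in> cell_vals E k I S F then monom 1 (\<Sum>F\<in>p. card (S \<inter> F) - 1) else 0)
     - (\<Sum>F\<in>p. cut_poly E k F (r F) I S)
   else 0)"

text \<open>Nonemptiness is read through the values on an arbitrary \<open>F\<close>, so that lemmas
  which transfer values also transfer the set of cells.\<close>

lemma cells_iff_vals: "(I, S) \<in> cells E k \<longleftrightarrow> I \<subseteq> E \<and> S \<subseteq> E - I \<and> cell_vals E k I S F \<noteq> {}"
  by (simp add: cells_def cell_vals_def)

lemma cellsD:
  assumes "(I, S) \<in> cells E k"
  shows "I \<subseteq> E" "S \<subseteq> E" "I \<inter> S = {}" "cell E k I S \<noteq> {}"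
  using assms by (auto simp: cells_def)

lemma hypersimplex_eq: "hypersimplex k n = capped_hypersimplex {1..n} k {} r"
  by (simp add: hypersimplex_def capped_hypersimplex_def)

lemma schubert_polytope_eq:
  "schubert_polytope r k h n = capped_hypersimplex {1..n} k {{1..h}} (\<lambda>_. r)"
  by (auto simp: schubert_polytope_def hypersimplex_def capped_hypersimplex_def)

lemma face_poly_capped_empty:
  assumes "finite E"
  shows "face_poly (capped_hypersimplex E k {} r) = (\<Sum>(I, S)\<in>cells E k. monom 1 (card S - 1))"
proof -
  have "(\<Sum>J\<in>tight_sets E k {} r I S. monom 1 (dim (block_space S J))) = (monom 1 (card S - 1) :: int poly)"
    if "(I, S) \<in> cells E k" for I S
  proof -
    have "tight_sets E k {} r I S = {{}}"
      using cellsD(4)[OF that] by (auto simp: tight_sets_def)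
    moreover have "finite S" using assms cellsD(2)[OF that] by (rule rev_finite_subset)
    ultimately show ?thesis by (simp add: dim_block_space_empty)
  qed
  moreover have "face_poly (capped_hypersimplex E k {} r) =
      (\<Sum>(I, S)\<in>cells E k. \<Sum>J\<in>tight_sets E k {} r I S. monom 1 (dim (block_space S J)))"
    using assms by (intro face_poly_capped) auto
  ultimately show ?thesis by (auto intro: sum.cong)
qed

text \<open>Under one cap a cell leaves at most two faces, with tight sets \<open>{}\<close> and
  \<open>{F}\<close>.\<close>

lemma face_poly_capped_single:
  assumes "finite E" "F \<subseteq> E"
  shows "face_poly (capped_hypersimplex E k {F} r) =
    (\<Sum>(I, S)\<in>cells E k. monom 1 (card S - 1) - cut_poly E k F (r F) I S)"
proof -
  have "(\<Sum>J\<in>tight_sets E k {F} r I S. monom 1 (dim (block_space S J))) =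
      monom 1 (card S - 1) - cut_poly E k F (r F) I S"
    if "(I, S) \<in> cells E k" for I S
  proof -
    have fS: "finite S" "finite F"
      using assms cellsD(2)[OF that] finite_subset by auto
    have "tight_sets E k {F} r I S =
        (if \<exists>s\<in>cell_vals E k I S F. s < real (r F) then {{}} else {}) \<union>
        (if real (r F) \<in> cell_vals E k I S F then {{F}} else {})"
    proof (intro equalityI subsetI)
      fix J assume "J \<in> tight_sets E k {F} r I S"
      then obtain x where x: "x \<in> cell E k I S" "sum x F \<le> real (r F)"
        "J = {G \<in> {F}. sum x G = real (r G)}" by (auto simp: tight_sets_def)
      have mem: "sum x F \<in> cell_vals E k I S F" using x(1) by (simp add: cell_vals_def)
      show "J \<in> (if \<exists>s\<in>cell_vals E k I S F. s < real (r F) then {{}} else {}) \<union>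
        (if real (r F) \<in> cell_vals E k I S F then {{F}} else {})"
      proof (cases "sum x F = real (r F)")
        case True
        then have "J = {F}" using x(3) by auto
        then show ?thesis using mem True by simp
      next
        case False
        then have "J = {}" "sum x F < real (r F)" using x by auto
        then show ?thesis using mem by auto
      qed
    next
      fix J assume "J \<in> (if \<exists>s\<in>cell_vals E k I S F. s < real (r F) then {{}} else {}) \<union>
        (if real (r F) \<in> cell_vals E k I S F then {{F}} else {})"
      then consider x where "x \<in> cell E k I S" "sum x F < real (r F)" "J = {}"
        | x where "x \<in> cell E k I S" "sum x F = real (r F)" "J = {F}"
        unfolding cell_vals_def by (fastforce split: if_splits)
      then show "J \<in> tight_sets E k {F} r I S"
      proof cases
        case 1
        then show ?thesis unfolding tight_sets_def by (intro CollectI bexI[of _ x]) auto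
      next
        case 2
        then show ?thesis unfolding tight_sets_def by (intro CollectI bexI[of _ x]) auto
      qed
    qed
    moreover have "dim (block_space S {F}) = (card (S \<inter> F) - 1) + (card (S - F) - 1)"
      by (rule dim_block_space_insert) (use fS in auto)
    ultimately show ?thesis
      by (simp add: cut_poly_def dim_block_space_empty fS)
  qed
  moreover have "face_poly (capped_hypersimplex E k {F} r) =
      (\<Sum>(I, S)\<in>cells E k. \<Sum>J\<in>tight_sets E k {F} r I S. monom 1 (dim (block_space S J)))"
    using assms by (intro face_poly_capped) auto
  ultimately show ?thesis by (auto intro: sum.cong)
qed

section \<open>Relabelling the ground set\<close>

lemma cell_vals_image_subset:
  assumes f: "bij_betw f E E'" and sub: "I \<subseteq> E" "S \<subseteq> E" "F \<subseteq> E"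
  shows "cell_vals E' k (f ` I) (f ` S) (f ` F) \<subseteq> cell_vals E k I S F"
proof
  fix s assume "s \<in> cell_vals E' k (f ` I) (f ` S) (f ` F)"
  then obtain x where x: "x \<in> cell E' k (f ` I) (f ` S)" "s = sum x (f ` F)"
    by (auto simp: cell_vals_def)
  have inj: "inj_on f E" and im: "f ` E = E'" using f by (auto simp: bij_betw_def)
  have s: "sum x (f ` A) = sum (x \<circ> f) A" if "A \<subseteq> E" for A
    using inj that by (simp add: sum.reindex inj_on_subset)
  have "x (f e) = 0" if "e \<in> E - I - S" for e
  proof -
    have "f e \<in> E' - f ` I - f ` S"
      using that im inj sub by (auto dest: inj_onD)
    then show ?thesis using x(1) unfolding cell_def by blast
  qed
  then have "x \<circ> f \<in> cell E k I S"
    using x(1) s[of E] im by (auto simp: cell_def)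
  then show "s \<in> cell_vals E k I S F"
    using x(2) s[OF sub(3)] unfolding cell_vals_def by (metis imageI)
qed

lemma cell_vals_image:
  assumes f: "bij_betw f E E'" and sub: "I \<subseteq> E" "S \<subseteq> E" "F \<subseteq> E"
  shows "cell_vals E' k (f ` I) (f ` S) (f ` F) = cell_vals E k I S F"
proof
  show "cell_vals E' k (f ` I) (f ` S) (f ` F) \<subseteq> cell_vals E k I S F"
    using assms by (rule cell_vals_image_subset)
  let ?g = "the_inv_into E f"
  have inj: "inj_on f E" and im: "f ` E = E'" using f by (auto simp: bij_betw_def)
  have g: "?g ` f ` A = A" if "A \<subseteq> E" for A
    using that inj by (force simp: the_inv_into_f_f image_image)
  have "f ` I \<subseteq> E'" "f ` S \<subseteq> E'" "f ` F \<subseteq> E'" using sub im by auto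
  from cell_vals_image_subset[OF bij_betw_the_inv_into[OF f] this, of k]
  show "cell_vals E k I S F \<subseteq> cell_vals E' k (f ` I) (f ` S) (f ` F)"
    by (simp add: g sub)
qed

lemma sum_cells_image:
  assumes f: "bij_betw f E E'"
    and h: "\<And>I S. (I, S) \<in> cells E k \<Longrightarrow> h' (f ` I) (f ` S) = h I S"
  shows "(\<Sum>(I, S)\<in>cells E' k. h' I S) = (\<Sum>(I, S)\<in>cells E k. h I S)"
proof -
  let ?g = "the_inv_into E f"
  have g: "bij_betw ?g E' E" using f by (rule bij_betw_the_inv_into)
  have inj: "inj_on f E" and im: "f ` E = E'" using f by (auto simp: bij_betw_def)
  have gf: "?g ` f ` A = A" if "A \<subseteq> E" for A
    using that inj by (force simp: the_inv_into_f_f image_image)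
  have fg: "f ` ?g ` A = A" if "A \<subseteq> E'" for A
    using that inj im by (force simp: f_the_inv_into_f image_image)
  have cells: "(f' ` I, f' ` S) \<in> cells B k"
    if "(I, S) \<in> cells A k" "bij_betw f' A B" for I S f' and A :: "'x set" and B :: "'y set"
  proof -
    have sub: "I \<subseteq> A" "S \<subseteq> A" "I \<inter> S = {}" using cellsD[OF that(1)] by auto
    have "inj_on f' A" "f' ` A = B" using that(2) by (auto simp: bij_betw_def)
    then have "f' ` I \<subseteq> B" "f' ` S \<subseteq> B - f' ` I"
      using sub by (auto dest: inj_onD)
    then show ?thesis
      using that sub cell_vals_image[OF that(2) sub(1,2) order_refl, of k]
      unfolding cells_iff_vals[of _ _ A k A] cells_iff_vals[of _ _ B k "f' ` A"] by simp
  qed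
  show ?thesis
  proof (rule sum.reindex_bij_witness[where i = "\<lambda>(I, S). (f ` I, f ` S)" and j = "\<lambda>(I, S). (?g ` I, ?g ` S)"])
    fix c assume "c \<in> cells E' k"
    then obtain I S where c: "c = (I, S)" "(I, S) \<in> cells E' k" by (cases c) auto
    have sub: "I \<subseteq> E'" "S \<subseteq> E'" using cellsD[OF c(2)] by auto
    show "(case case c of (I, S) \<Rightarrow> (?g ` I, ?g ` S) of (I, S) \<Rightarrow> (f ` I, f ` S)) = c"
      using sub by (simp add: c fg)
    show mem: "(case c of (I, S) \<Rightarrow> (?g ` I, ?g ` S)) \<in> cells E k"
      using cells[OF c(2) g] by (simp add: c)
    then show "(case case c of (I, S) \<Rightarrow> (?g ` I, ?g ` S) of (I, S) \<Rightarrow> h I S) = (case c of (I, S) \<Rightarrow> h' I S)"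
      using h[of "?g ` I" "?g ` S"] sub by (simp add: c fg)
  next
    fix c assume "c \<in> cells E k"
    then obtain I S where c: "c = (I, S)" "(I, S) \<in> cells E k" by (cases c) auto
    have sub: "I \<subseteq> E" "S \<subseteq> E" using cellsD[OF c(2)] by auto
    show "(case case c of (I, S) \<Rightarrow> (f ` I, f ` S) of (I, S) \<Rightarrow> (?g ` I, ?g ` S)) = c"
      using sub by (simp add: c gf)
    show "(case c of (I, S) \<Rightarrow> (f ` I, f ` S)) \<in> cells E' k"
      using cells[OF c(2) f] by (simp add: c)
  qed
qed

text \<open>Schubert polytopes cap an initial segment of the coordinates, so a relabelling has to
  carry \<open>F\<close> onto such a segment.\<close>

lemma ex_bij_betw_nested:
  assumes "finite E" "F \<subseteq> E"
  shows "\<exists>f. bij_betw f E {1..card E} \<and> f ` F = {1..card F}"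
proof -
  have le: "card F \<le> card E" using assms by (simp add: card_mono)
  have "\<exists>g. bij_betw g F {1..card F}"
    using assms finite_subset by (intro finite_same_card_bij) auto
  then obtain g where g: "bij_betw g F {1..card F}" by blast
  have "\<exists>h. bij_betw h (E - F) {card F + 1..card E}"
    using assms le finite_subset[OF assms(2,1)]
    by (intro finite_same_card_bij) (auto simp: card_Diff_subset)
  then obtain h where h: "bij_betw h (E - F) {card F + 1..card E}" by blast
  let ?f = "\<lambda>x. if x \<in> F then g x else h x"
  have F: "bij_betw ?f F {1..card F}" using g by (subst bij_betw_cong[of _ _ g]) auto
  have H: "bij_betw ?f (E - F) {card F + 1..card E}" using h by (subst bij_betw_cong[of _ _ h]) auto
  have "{1..card F} \<inter> {card F + 1..card E} = {}" by auto
  note bij_betw_combine[OF F H this]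
  moreover have "F \<union> (E - F) = E" "{1..card F} \<union> {card F + 1..card E} = {1..card E}"
    using assms le by auto
  ultimately have "bij_betw ?f E {1..card E}" by simp
  then show ?thesis using bij_betw_imp_surj_on[OF F] by blast
qed

lemma face_poly_hypersimplex:
  assumes "finite E"
  shows "face_poly (hypersimplex k (card E)) = (\<Sum>(I, S)\<in>cells E k. monom 1 (card S - 1))"
proof -
  obtain f where f: "bij_betw f E {1..card E}"
    using ex_bij_betw_nested[OF assms order_refl] by blast
  have inj: "inj_on f E" using f by (simp add: bij_betw_def)
  have "card (f ` S) = card S" if "(I, S) \<in> cells E k" for I S
    using cellsD(2)[OF that] inj by (meson card_image inj_on_subset)
  then have "(\<Sum>(I, S)\<in>cells {1..card E} k. monom 1 (card S - 1)) =
      ((\<Sum>(I, S)\<in>cells E k. monom 1 (card S - 1)) :: int poly)"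
    by (intro sum_cells_image[OF f]) simp
  then show ?thesis
    unfolding hypersimplex_eq[of k "card E" "\<lambda>_. 0"] by (subst face_poly_capped_empty) auto
qed

text \<open>Relabelling turns the cap on the initial coordinates into the cap on \<open>F\<close>
  itself, so that all polynomials \<open>u_poly\<close> become sums over the same cells of
  \<open>E\<close>.\<close>

lemma u_poly_eq_sum_cut_poly:
  assumes "finite E" "F \<subseteq> E"
  shows "u_poly r k (card F) (card E) = (\<Sum>(I, S)\<in>cells E k. cut_poly E k F r I S)"
proof -
  let ?n = "card E" and ?h = "card F"
  obtain f where f: "bij_betw f E {1..?n}" "f ` F = {1..?h}"
    using ex_bij_betw_nested[OF assms] by blast
  have inj: "inj_on f E" using f by (simp add: bij_betw_def)
  have le: "?h \<le> ?n" using assms by (simp add: card_mono)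
  have "u_poly r k ?h ?n = (\<Sum>(I, S)\<in>cells {1..?n} k. cut_poly {1..?n} k {1..?h} r I S)"
  proof -
    have "face_poly (hypersimplex k ?n) = (\<Sum>(I, S)\<in>cells {1..?n} k. monom 1 (card S - 1))"
      unfolding hypersimplex_eq[of k ?n "\<lambda>_. 0"] by (rule face_poly_capped_empty) simp
    moreover have "face_poly (schubert_polytope r k ?h ?n) =
        (\<Sum>(I, S)\<in>cells {1..?n} k. monom 1 (card S - 1) - cut_poly {1..?n} k {1..?h} r I S)"
      unfolding schubert_polytope_eq by (rule face_poly_capped_single) (use le in auto)
    ultimately show ?thesis
      by (simp add: u_poly_def sum_subtractf[symmetric] case_prod_unfold)
  qed
  also have "\<dots> = (\<Sum>(I, S)\<in>cells E k. cut_poly E k F r I S)"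
  proof (rule sum_cells_image[OF f(1)])
    fix I S assume "(I, S) \<in> cells E k"
    then have sub: "I \<subseteq> E" "S \<subseteq> E" using cellsD by blast+
    have c: "card (f ` A) = card A" if "A \<subseteq> E" for A
      using that inj by (meson card_image inj_on_subset)
    have "f ` S \<inter> f ` F = f ` (S \<inter> F)" "f ` S - f ` F = f ` (S - F)"
      using inj sub assms by (auto dest: inj_onD)
    then have "card (f ` S \<inter> f ` F) = card (S \<inter> F)" "card (f ` S - f ` F) = card (S - F)"
      using sub by (auto intro!: c)
    then show "cut_poly {1..?n} k {1..?h} r (f ` I) (f ` S) = cut_poly E k F r I S"
      unfolding cut_poly_def f(2)[symmetric] cell_vals_image[OF f(1) sub assms(2)] c[OF sub(2)]
      by simp
  qed
  finally show ?thesis .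
qed

section \<open>Faces of a hypersimplex with fixed coordinates\<close>

text \<open>Fixing the coordinates in \<open>N\<close> at 1 and those outside
  \<open>N \<union> D\<close> at 0 leaves a hypersimplex on \<open>D\<close>; the fixed coordinates
  shift every sum over \<open>F\<close> by a constant.\<close>

lemma cell_vals_contract:
  assumes fin: "finite E" and sub: "N \<subseteq> E" "D \<subseteq> E" "N \<inter> D = {}" "F \<subseteq> E"
    and IS: "I \<subseteq> D" "S \<subseteq> D" "I \<inter> S = {}"
  shows "cell_vals E (k + card N) (I \<union> N) S F = (\<lambda>s. s + real (card (N \<inter> F))) ` cell_vals D k I S (F \<inter> D)"
proof -
  have split: "sum x G = sum x (G \<inter> D) + real (card (N \<inter> G))"
    if "\<forall>e\<in>N. x e = 1" "\<forall>e\<in>E - N - D. x e = 0" "G \<subseteq> E" for x G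
  proof -
    have fG: "finite G" using fin that(3) by (rule rev_finite_subset)
    have "sum x G = sum x ((G \<inter> D) \<union> (N \<inter> G))"
      using that fG by (intro sum.mono_neutral_right) auto
    also have "\<dots> = sum x (G \<inter> D) + sum x (N \<inter> G)"
      using fG sub(3) by (intro sum.union_disjoint) auto
    also have "sum x (N \<inter> G) = real (card (N \<inter> G))"
      using that(1) by simp
    finally show ?thesis .
  qed
  show ?thesis
  proof (intro equalityI subsetI)
    fix s assume "s \<in> cell_vals E (k + card N) (I \<union> N) S F"
    then obtain x where x: "x \<in> cell E (k + card N) (I \<union> N) S" "s = sum x F"
      by (auto simp: cell_vals_def)
    have one: "\<forall>e\<in>N. x e = 1" and zero: "\<forall>e\<in>E - N - D. x e = 0"
      using x(1) IS by (auto simp: cell_def)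
    have "sum x E = sum x D + real (card N)"
      using split[OF one zero order_refl] sub by (simp add: Int_absorb1 Int_absorb2)
    moreover have "\<forall>e\<in>D - I - S. x e = 0" using x(1) sub by (auto simp: cell_def)
    ultimately have "x \<in> cell D k I S" using x(1) by (simp add: cell_def)
    then show "s \<in> (\<lambda>s. s + real (card (N \<inter> F))) ` cell_vals D k I S (F \<inter> D)"
      using split[OF one zero sub(4)] x(2) by (auto simp: cell_vals_def)
  next
    fix s assume "s \<in> (\<lambda>s. s + real (card (N \<inter> F))) ` cell_vals D k I S (F \<inter> D)"
    then obtain x where x: "x \<in> cell D k I S" "s = sum x (F \<inter> D) + real (card (N \<inter> F))"
      by (auto simp: cell_vals_def)
    \<comment> \<open>Off \<open>D\<close> the given \<open>x\<close> is arbitrary, so it is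
      overwritten there by the fixed values.\<close>
    define y where "y = (\<lambda>e. if e \<in> N then 1 else if e \<in> D then x e else 0)"
    have one: "\<forall>e\<in>N. y e = 1" and zero: "\<forall>e\<in>E - N - D. y e = 0"
      by (auto simp: y_def)
    have yD: "sum y A = sum x A" if "A \<subseteq> D" for A
      using that sub by (intro sum.cong) (auto simp: y_def)
    have "sum y E = sum y D + real (card N)"
      using split[OF one zero order_refl] sub by (simp add: Int_absorb1 Int_absorb2)
    then have "sum y E = real (k + card N)" using yD[of D] x(1) by (simp add: cell_def)
    moreover have "\<forall>e\<in>I \<union> N. y e = 1" "\<forall>e\<in>S. 0 < y e \<and> y e < 1"
      "\<forall>e\<in>E - (I \<union> N) - S. y e = 0"
      using x(1) sub IS by (auto simp: cell_def y_def)
    ultimately have "y \<in> cell E (k + card N) (I \<union> N) S"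
      unfolding cell_def by simp
    moreover have "s = sum y F"
      using split[OF one zero sub(4)] yD[of "F \<inter> D"] x(2) by simp
    ultimately show "s \<in> cell_vals E (k + card N) (I \<union> N) S F" by (auto simp: cell_vals_def)
  qed
qed

lemma sum_cells_contract:
  assumes fin: "finite E" and sub: "N \<subseteq> E" "D \<subseteq> E" "N \<inter> D = {}"
    and h: "\<And>I S. (I, S) \<in> cells D k \<Longrightarrow> h (I \<union> N) S = g I S"
  shows "(\<Sum>(I, S)\<in>cells E (k + card N). if N \<subseteq> I \<and> I \<union> S \<subseteq> N \<union> D then h I S else 0) =
    (\<Sum>(I, S)\<in>cells D k. g I S)"
proof -
  have iff: "(I \<union> N, S) \<in> cells E (k + card N) \<longleftrightarrow> (I, S) \<in> cells D k"
    if "I \<subseteq> D" "S \<subseteq> D" "I \<inter> S = {}" for I S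
    using cell_vals_contract[OF fin sub order_refl that, of k] that sub
    unfolding cells_iff_vals[of _ _ E _ E] cells_iff_vals[of _ _ D _ "E \<inter> D"]
    by auto
  have "(\<Sum>(I, S)\<in>cells E (k + card N). if N \<subseteq> I \<and> I \<union> S \<subseteq> N \<union> D then h I S else 0) =
      (\<Sum>(I, S)\<in>{(I, S) \<in> cells E (k + card N). N \<subseteq> I \<and> I \<union> S \<subseteq> N \<union> D}. h I S)"
    using fin by (intro sum.mono_neutral_cong_right) (auto simp: finite_cells split: if_splits)
  also have "\<dots> = (\<Sum>(I, S)\<in>cells D k. g I S)"
  proof (rule sum.reindex_bij_witness[where i = "\<lambda>(I, S). (I \<union> N, S)" and j = "\<lambda>(I, S). (I - N, S)"])
    fix c assume "c \<in> {(I, S) \<in> cells E (k + card N). N \<subseteq> I \<and> I \<union> S \<subseteq> N \<union> D}"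
    then obtain I S where c: "c = (I, S)" "(I, S) \<in> cells E (k + card N)" "N \<subseteq> I" "I \<union> S \<subseteq> N \<union> D"
      by auto
    have IN: "I - N \<union> N = I" using c(3) by blast
    have "I - N \<subseteq> D" "S \<subseteq> D" "(I - N) \<inter> S = {}"
      using c cellsD[OF c(2)] by auto
    from iff[OF this] have mem: "(I - N, S) \<in> cells D k" using c IN by simp
    then show "(case c of (I, S) \<Rightarrow> (I - N, S)) \<in> cells D k" by (simp add: c)
    show "(case case c of (I, S) \<Rightarrow> (I - N, S) of (I, S) \<Rightarrow> (I \<union> N, S)) = c"
      using IN by (simp add: c)
    show "(case case c of (I, S) \<Rightarrow> (I - N, S) of (I, S) \<Rightarrow> g I S) = (case c of (I, S) \<Rightarrow> h I S)"
      using h[OF mem] IN by (simp add: c)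
  next
    fix c assume "c \<in> cells D k"
    then obtain I S where c: "c = (I, S)" "(I, S) \<in> cells D k" by (cases c) auto
    have IS: "I \<subseteq> D" "S \<subseteq> D" "I \<inter> S = {}" using cellsD[OF c(2)] by auto
    show "(case case c of (I, S) \<Rightarrow> (I \<union> N, S) of (I, S) \<Rightarrow> (I - N, S)) = c"
      using IS sub by (auto simp: c)
    show "(case c of (I, S) \<Rightarrow> (I \<union> N, S)) \<in> {(I, S) \<in> cells E (k + card N). N \<subseteq> I \<and> I \<union> S \<subseteq> N \<union> D}"
      using IS iff[OF IS] c by auto
  qed
  finally show ?thesis .
qed

section \<open>Products of two hypersimplices\<close>

text \<open>The total determines the sum over \<open>B\<close> once the sum over \<open>A\<close> is
  known. One \<open>x\<close> can serve both cells because a cell ignores values outside its ground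
  set.\<close>

lemma cell_union:
  assumes fin: "finite A" "finite B" and disj: "A \<inter> B = {}"
    and sub: "I1 \<subseteq> A" "S1 \<subseteq> A" "I2 \<subseteq> B" "S2 \<subseteq> B"
  shows "x \<in> cell (A \<union> B) (\<alpha> + \<beta>) (I1 \<union> I2) (S1 \<union> S2) \<and> sum x A = real \<alpha> \<longleftrightarrow>
    x \<in> cell A \<alpha> I1 S1 \<and> x \<in> cell B \<beta> I2 S2"
proof -
  have "sum x (A \<union> B) = sum x A + sum x B" using fin disj by (rule sum.union_disjoint)
  moreover have "(\<forall>e\<in>A \<union> B - (I1 \<union> I2) - (S1 \<union> S2). x e = 0) \<longleftrightarrow>
      (\<forall>e\<in>A - I1 - S1. x e = 0) \<and> (\<forall>e\<in>B - I2 - S2. x e = 0)"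
    using sub disj by blast
  ultimately show ?thesis by (auto simp: cell_def ball_Un)
qed

lemma cells_union:
  assumes fin: "finite A" "finite B" and disj: "A \<inter> B = {}"
    and sub: "I1 \<subseteq> A" "S1 \<subseteq> A" "I2 \<subseteq> B" "S2 \<subseteq> B"
  shows "(I1, S1) \<in> cells A \<alpha> \<and> (I2, S2) \<in> cells B \<beta> \<longleftrightarrow>
    (I1 \<union> I2, S1 \<union> S2) \<in> cells (A \<union> B) (\<alpha> + \<beta>) \<and>
    real \<alpha> \<in> cell_vals (A \<union> B) (\<alpha> + \<beta>) (I1 \<union> I2) (S1 \<union> S2) A"
proof
  assume L: "(I1, S1) \<in> cells A \<alpha> \<and> (I2, S2) \<in> cells B \<beta>"
  then obtain x y where x: "x \<in> cell A \<alpha> I1 S1" and y: "y \<in> cell B \<beta> I2 S2"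
    using cellsD(4) by blast
  define z where "z = (\<lambda>e. if e \<in> A then x e else y e)"
  have zA: "z e = x e" if "e \<in> A" for e using that by (simp add: z_def)
  have zB: "z e = y e" if "e \<in> B" for e using that disj by (auto simp: z_def)
  have "sum z A = sum x A" "sum z B = sum y B" using zA zB by (auto intro: sum.cong)
  then have "z \<in> cell A \<alpha> I1 S1" "z \<in> cell B \<beta> I2 S2"
    using x y zA zB sub by (auto simp: cell_def subset_iff)
  with cell_union[OF fin disj sub, of z \<alpha> \<beta>]
  have z: "z \<in> cell (A \<union> B) (\<alpha> + \<beta>) (I1 \<union> I2) (S1 \<union> S2)" "sum z A = real \<alpha>" by simp_all
  have "I1 \<inter> S1 = {}" "I2 \<inter> S2 = {}" using L cellsD(3) by blast+
  then have "I1 \<union> I2 \<subseteq> A \<union> B" "S1 \<union> S2 \<subseteq> A \<union> B - (I1 \<union> I2)"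
    using sub disj by auto
  then show "(I1 \<union> I2, S1 \<union> S2) \<in> cells (A \<union> B) (\<alpha> + \<beta>) \<and>
      real \<alpha> \<in> cell_vals (A \<union> B) (\<alpha> + \<beta>) (I1 \<union> I2) (S1 \<union> S2) A"
    unfolding cells_def cell_vals_def using z by (metis (mono_tags, lifting) case_prodI
        empty_iff image_eqI mem_Collect_eq)
next
  assume R: "(I1 \<union> I2, S1 \<union> S2) \<in> cells (A \<union> B) (\<alpha> + \<beta>) \<and>
    real \<alpha> \<in> cell_vals (A \<union> B) (\<alpha> + \<beta>) (I1 \<union> I2) (S1 \<union> S2) A"
  then obtain x where "x \<in> cell (A \<union> B) (\<alpha> + \<beta>) (I1 \<union> I2) (S1 \<union> S2)" "sum x A = real \<alpha>"
    unfolding cell_vals_def by (metis image_iff)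
  with cell_union[OF fin disj sub, of x \<alpha> \<beta>]
  have x: "x \<in> cell A \<alpha> I1 S1" "x \<in> cell B \<beta> I2 S2" by simp_all
  have "(I1 \<union> I2) \<inter> (S1 \<union> S2) = {}"
    by (rule cellsD(3)[OF conjunct1[OF R]])
  then have "S1 \<subseteq> A - I1" "S2 \<subseteq> B - I2" using sub by auto
  then show "(I1, S1) \<in> cells A \<alpha> \<and> (I2, S2) \<in> cells B \<beta>"
    using sub x by (auto simp: cells_def)
qed

text \<open>The section of the hypersimplex on \<open>A \<union> B\<close> where the sum over
  \<open>A\<close> is \<alpha> is the product of the two smaller hypersimplices. Its cells are pairs
  of their cells; dimensions add, so monomials multiply.\<close>

lemma hypersimplex_product:
  assumes fin: "finite A" "finite B" and disj: "A \<inter> B = {}"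
  shows "face_poly (hypersimplex \<alpha> (card A)) * face_poly (hypersimplex \<beta> (card B)) =
    (\<Sum>(I, S)\<in>cells (A \<union> B) (\<alpha> + \<beta>). if real \<alpha> \<in> cell_vals (A \<union> B) (\<alpha> + \<beta>) I S A
      then monom 1 ((card (S \<inter> A) - 1) + (card (S \<inter> B) - 1)) else 0)"
proof -
  let ?C = "cells (A \<union> B) (\<alpha> + \<beta>)"
  let ?g = "\<lambda>(I, S). monom 1 ((card (S \<inter> A) - 1) + (card (S \<inter> B) - 1)) :: int poly"
  let ?R = "{c \<in> ?C. real \<alpha> \<in> cell_vals (A \<union> B) (\<alpha> + \<beta>) (fst c) (snd c) A}"
  have "face_poly (hypersimplex \<alpha> (card A)) * face_poly (hypersimplex \<beta> (card B)) =
      (\<Sum>(c, d)\<in>cells A \<alpha> \<times> cells B \<beta>. monom 1 (card (snd c) - 1) * monom 1 (card (snd d) - 1))"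
    using fin by (simp add: face_poly_hypersimplex sum_product sum.cartesian_product case_prod_unfold)
  also have "\<dots> = (\<Sum>c\<in>?R. ?g c)"
  proof (rule sum.reindex_bij_witness[where
        i = "\<lambda>c. ((fst c \<inter> A, snd c \<inter> A), (fst c \<inter> B, snd c \<inter> B))" and
        j = "\<lambda>p. (fst (fst p) \<union> fst (snd p), snd (fst p) \<union> snd (snd p))"])
    fix p assume "p \<in> cells A \<alpha> \<times> cells B \<beta>"
    then obtain I1 S1 I2 S2 where p: "p = ((I1, S1), (I2, S2))"
        "(I1, S1) \<in> cells A \<alpha>" "(I2, S2) \<in> cells B \<beta>" by auto
    have sub: "I1 \<subseteq> A" "S1 \<subseteq> A" "I2 \<subseteq> B" "S2 \<subseteq> B" using cellsD p by blast+
    have int: "(I1 \<union> I2) \<inter> A = I1" "(S1 \<union> S2) \<inter> A = S1" "(I1 \<union> I2) \<inter> B = I2" "(S1 \<union> S2) \<inter> B = S2"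
      using sub disj by blast+
    let ?j = "(fst (fst p) \<union> fst (snd p), snd (fst p) \<union> snd (snd p))"
    have j: "?j = (I1 \<union> I2, S1 \<union> S2)" by (simp add: p(1))
    show "((fst ?j \<inter> A, snd ?j \<inter> A), (fst ?j \<inter> B, snd ?j \<inter> B)) = p"
      unfolding j fst_conv snd_conv int p(1) by simp
    show "?j \<in> ?R"
      unfolding j using p cells_union[OF fin disj sub, of \<alpha> \<beta>] by simp
    show "?g ?j = (case p of (c, d) \<Rightarrow> monom 1 (card (snd c) - 1) * monom 1 (card (snd d) - 1))"
      unfolding j by (simp add: int p(1) mult_monom)
  next
    fix c assume "c \<in> ?R"
    then obtain I S where c: "c = (I, S)" "(I, S) \<in> ?C"
      "real \<alpha> \<in> cell_vals (A \<union> B) (\<alpha> + \<beta>) I S A" by (cases c) auto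
    have "I \<subseteq> A \<union> B" "S \<subseteq> A \<union> B" using c(2) by (rule cellsD)+
    then have un: "I \<inter> A \<union> I \<inter> B = I" "S \<inter> A \<union> S \<inter> B = S"
      unfolding Int_Un_distrib[symmetric] by (simp_all only: Int_absorb2)
    let ?i = "((fst c \<inter> A, snd c \<inter> A), (fst c \<inter> B, snd c \<inter> B))"
    show "(fst (fst ?i) \<union> fst (snd ?i), snd (fst ?i) \<union> snd (snd ?i)) = c"
      using un by (simp add: c(1))
    show "?i \<in> cells A \<alpha> \<times> cells B \<beta>"
      using cells_union[OF fin disj Int_lower2 Int_lower2 Int_lower2 Int_lower2, of I S \<alpha> I S \<beta>]
      unfolding un c(1) using c by simp
  qed
  also have "\<dots> = (\<Sum>(I, S)\<in>?C. if real \<alpha> \<in> cell_vals (A \<union> B) (\<alpha> + \<beta>) I S A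
      then monom 1 ((card (S \<inter> A) - 1) + (card (S \<inter> B) - 1)) else 0)"
  proof -
    have "finite ?C" using fin by (simp add: finite_cells)
    from sum.inter_filter[OF this] show ?thesis unfolding case_prod_unfold .
  qed
  finally show ?thesis .
qed

lemma cell_vals_complement:
  assumes fin: "finite E" "F \<subseteq> E"
  shows "cell_vals E k I S (E - F) = (\<lambda>s. real k - s) ` cell_vals E k I S F"
proof -
  have "sum x (E - F) = real k - sum x F" if "x \<in> cell E k I S" for x
    using that sum.subset_diff[OF assms(2,1), of x] by (simp add: cell_def)
  then show ?thesis unfolding cell_vals_def image_image by (intro image_cong) auto
qed

text \<open>With \<open>F \<inter> G\<close> fixed at 1 and everything outside
  \<open>F \<union> G\<close> at 0, only \<open>D\<close> remains, and the caps become the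
  complementary blocks \<open>F - G\<close> and \<open>G - F\<close> with bounds \<alpha> and
  \<beta>. There the terms of \<open>w_poly\<close> are, cell by cell, those of
  \<open>pair_poly\<close>.\<close>

lemma w_poly_eq_sum_pair_poly:
  assumes fin: "finite E" and sub: "F \<subseteq> E" "G \<subseteq> E" "F \<noteq> G"
    and rk: "r F \<le> k" "r G \<le> k" "card (F \<inter> G) + k = r F + r G"
  shows "w_poly (k - r G) (k - r F) (card (F - G)) (card (G - F)) =
    (\<Sum>(I, S)\<in>cells E k. pair_poly E k r {F, G} I S)"
proof -
  define N where "N = F \<inter> G"
  define D where "D = (F - G) \<union> (G - F)"
  define \<alpha> where "\<alpha> = k - r G"
  define \<beta> where "\<beta> = k - r F"
  define m where "m = \<alpha> + \<beta>"
  \<comment> \<open>Modularity of the pair: \<open>m\<close> is the total left on \<open>D\<close>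
    after the coordinates in \<open>N\<close> have taken the value 1.\<close>
  have k: "k = m + card N" and rF: "r F = \<alpha> + card N" and rG: "r G = \<beta> + card N"
    using rk by (auto simp: \<alpha>_def \<beta>_def N_def m_def)
  have finFG: "finite (F - G)" "finite (G - F)"
    using rev_finite_subset[OF fin] sub by auto
  have cD: "card D = card (F - G) + card (G - F)"
    unfolding D_def using finFG by (intro card_Un_disjoint) auto
  have finD: "finite D" using finFG by (simp add: D_def)
  let ?X = "\<lambda>S. monom 1 (card S - 1) :: int poly"
  let ?g = "\<lambda>I S. ?X S
      - (if real \<alpha> \<in> cell_vals D m I S (F - G)
          then monom 1 ((card (S \<inter> (F - G)) - 1) + (card (S \<inter> (G - F)) - 1)) else 0)
      - cut_poly D m (F - G) \<alpha> I S - cut_poly D m (G - F) \<beta> I S"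
  let ?h = "\<lambda>I S. monom 1 (card S - 1)
     - (if \<exists>F\<in>{F, G}. real (r F) \<in> cell_vals E k I S F then monom 1 (\<Sum>F\<in>{F, G}. card (S \<inter> F) - 1) else 0)
     - (\<Sum>F\<in>{F, G}. cut_poly E k F (r F) I S)"
  have "w_poly \<alpha> \<beta> (card (F - G)) (card (G - F)) = (\<Sum>(I, S)\<in>cells D m. ?g I S)"
  proof -
    have "face_poly (hypersimplex m (card D)) = (\<Sum>(I, S)\<in>cells D m. ?X S)"
      using finD by (rule face_poly_hypersimplex)
    moreover have "face_poly (hypersimplex \<alpha> (card (F - G))) * face_poly (hypersimplex \<beta> (card (G - F))) =
      (\<Sum>(I, S)\<in>cells D m. if real \<alpha> \<in> cell_vals D m I S (F - G)
          then monom 1 ((card (S \<inter> (F - G)) - 1) + (card (S \<inter> (G - F)) - 1)) else 0)"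
      unfolding D_def m_def using finFG by (rule hypersimplex_product) auto
    moreover have "u_poly \<alpha> m (card (F - G)) (card D) =
        (\<Sum>(I, S)\<in>cells D m. cut_poly D m (F - G) \<alpha> I S)"
      "u_poly \<beta> m (card (G - F)) (card D) =
        (\<Sum>(I, S)\<in>cells D m. cut_poly D m (G - F) \<beta> I S)"
      using finD by (auto intro!: u_poly_eq_sum_cut_poly simp: D_def)
    ultimately show ?thesis
      by (simp add: w_poly_def m_def[symmetric] cD[symmetric] sum_subtractf[symmetric] case_prod_unfold)
  qed
  also have "\<dots> = (\<Sum>(I, S)\<in>cells E (m + card N).
      if N \<subseteq> I \<and> I \<union> S \<subseteq> N \<union> D then ?h I S else 0)"
  proof (rule sum_cells_contract[symmetric])
    show "finite E" "N \<subseteq> E" "D \<subseteq> E" "N \<inter> D = {}" using fin sub by (auto simp: N_def D_def)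
    fix I S assume c: "(I, S) \<in> cells D m"
    have IS: "I \<subseteq> D" "S \<subseteq> D" "I \<inter> S = {}" using cellsD[OF c] by auto
    have FD: "F \<inter> D = F - G" "G \<inter> D = G - F" "N \<inter> F = N" "N \<inter> G = N"
      by (auto simp: N_def D_def)
    have "N \<subseteq> E" "D \<subseteq> E" "N \<inter> D = {}" using sub by (auto simp: N_def D_def)
    note cv = cell_vals_contract[OF fin this _ IS, of _ m, folded k]
    have vF: "cell_vals E k (I \<union> N) S F = (\<lambda>s. s + real (card N)) ` cell_vals D m I S (F - G)"
      using cv[OF sub(1)] by (simp add: FD)
    have vG: "cell_vals E k (I \<union> N) S G = (\<lambda>s. s + real (card N)) ` cell_vals D m I S (G - F)"
      using cv[OF sub(2)] by (simp add: FD)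
    have SF: "S \<inter> F = S \<inter> (F - G)" "S - F = S - (F - G)" "S \<inter> G = S \<inter> (G - F)" "S - G = S - (G - F)"
      using IS by (auto simp: D_def)
    have cut: "cut_poly E k F (r F) (I \<union> N) S = cut_poly D m (F - G) \<alpha> I S"
      "cut_poly E k G (r G) (I \<union> N) S = cut_poly D m (G - F) \<beta> I S"
      unfolding cut_poly_def vF vG rF rG SF by auto
    have GF: "G - F = D - (F - G)" "F - G \<subseteq> D" by (auto simp: D_def)
    \<comment> \<open>Complementary blocks with total \<open>m\<close>: one cap is reached exactly
      where the other is, so the one condition of the product term serves for both.\<close>
    have "real \<beta> \<in> cell_vals D m I S (G - F) \<longleftrightarrow> real \<alpha> \<in> cell_vals D m I S (F - G)"
      unfolding GF(1) cell_vals_complement[OF finD GF(2)] m_def by force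
    then have "(\<exists>F\<in>{F, G}. real (r F) \<in> cell_vals E k (I \<union> N) S F) \<longleftrightarrow>
        real \<alpha> \<in> cell_vals D m I S (F - G)"
      by (auto simp: vF vG rF rG)
    then show "?h (I \<union> N) S = ?g I S"
      using sub(3) by (simp add: cut SF)
  qed
  also have "\<dots> = (\<Sum>(I, S)\<in>cells E k. pair_poly E k r {F, G} I S)"
  proof -
    have "\<Inter>{F, G} = N" "\<Union>{F, G} = N \<union> D" by (auto simp: N_def D_def)
    then show ?thesis unfolding k[symmetric] pair_poly_def by simp
  qed
  finally show ?thesis by (simp add: \<alpha>_def \<beta>_def)
qed

subsection \<open>Cutting a hypersimplex by several caps\<close>

lemma cell_convex:
  assumes x: "x \<in> cell E k I S" and y: "y \<in> cell E k I S" and t: "0 \<le> t" "t \<le> (1::real)"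
  shows "(\<lambda>e. (1 - t) * x e + t * y e) \<in> cell E k I S"
proof -
  have "0 < (1 - t) * a + t * b" if "0 < a" "0 < b" for a b :: real
    using that t by (cases "t = 0") (auto intro: add_nonneg_pos)
  note pos = this
  have "0 < (1 - t) * x e + t * y e \<and> (1 - t) * x e + t * y e < 1" if "e \<in> S" for e
    using pos[of "x e" "y e"] pos[of "1 - x e" "1 - y e"] x y that
    by (auto simp: cell_def algebra_simps)
  moreover have "(\<Sum>e\<in>E. (1 - t) * x e + t * y e) = real k"
  proof -
    have "(\<Sum>e\<in>E. (1 - t) * x e + t * y e) = (1 - t) * sum x E + t * sum y E"
      by (simp add: sum.distrib sum_distrib_left)
    then show ?thesis using x y by (simp add: cell_def algebra_simps)
  qed
  moreover have "\<forall>e\<in>I. (1 - t) * x e + t * y e = 1" "\<forall>e\<in>E - I - S. (1 - t) * x e + t * y e = 0"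
    using x y by (auto simp: cell_def)
  ultimately show ?thesis by (simp add: cell_def)
qed

text \<open>A cell is convex and the sum over \<open>F\<close> is affine, so its values form an
  interval.\<close>

lemma cell_vals_between:
  assumes "s \<in> cell_vals E k I S F" "u \<in> cell_vals E k I S F" "s \<le> c" "c \<le> u"
  shows "c \<in> cell_vals E k I S F"
proof (cases "s = u")
  case False
  obtain x y where x: "x \<in> cell E k I S" "s = sum x F" and y: "y \<in> cell E k I S" "u = sum y F"
    using assms by (auto simp: cell_vals_def)
  define t where "t = (c - s) / (u - s)"
  have t: "0 \<le> t" "t \<le> 1" "t * (u - s) = c - s" using assms False by (auto simp: t_def field_simps)
  have "(\<Sum>e\<in>F. (1 - t) * x e + t * y e) = (1 - t) * s + t * u"
    using x y by (simp add: sum.distrib sum_distrib_left)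
  also have "\<dots> = c" using t(3) by (simp add: algebra_simps)
  finally have "c = (\<Sum>e\<in>F. (1 - t) * x e + t * y e)" ..
  then show ?thesis
    using cell_convex[OF x(1) y(1) t(1,2)] unfolding cell_vals_def by (rule image_eqI)
qed (use assms in auto)

text \<open>Coordinates outside \<open>S\<close> are the same throughout the cell. If
  \<open>S\<close> lies inside \<open>F\<close>, the sum over the complement is constant, and so is
  the sum over \<open>F\<close> by the fixed total.\<close>

lemma cell_vals_const:
  assumes fin: "finite E" "F \<subseteq> E" and unsplit: "S \<inter> F = {} \<or> S \<subseteq> F"
    and xy: "x \<in> cell E k I S" "y \<in> cell E k I S"
  shows "sum x F = sum y F"
proof -
  have eq: "sum x A = sum y A" if "A \<subseteq> E" "S \<inter> A = {}" for A
  proof (rule sum.cong[OF refl])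
    fix e assume "e \<in> A"
    then have "e \<in> E" "e \<notin> S" using that by auto
    then show "x e = y e" using xy by (cases "e \<in> I") (simp_all add: cell_def)
  qed
  show ?thesis
  proof (cases "S \<inter> F = {}")
    case True
    then show ?thesis using eq fin by blast
  next
    case False
    then have "sum x (E - F) = sum y (E - F)" using unsplit by (intro eq) auto
    moreover have "sum x E = sum y E" using xy by (simp add: cell_def)
    ultimately show ?thesis
      using sum.subset_diff[OF fin(2,1), of x] sum.subset_diff[OF fin(2,1), of y] by simp
  qed
qed

lemma cell_transfer:
  assumes x: "x \<in> cell E k I S" and fin: "finite E" "S \<subseteq> E" "I \<inter> S = {}"
    and ab: "a \<in> S" "b \<in> S" "a \<noteq> b"
    and d: "0 < x a + d" "x a + d < 1" "0 < x b - d" "x b - d < 1"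
  shows "x(a := x a + d, b := x b - d) \<in> cell E k I S"
proof -
  let ?y = "x(a := x a + d, b := x b - d)"
  have "sum ?y E = (\<Sum>e\<in>E. x e + (if e = a then d else 0) - (if e = b then d else 0))"
    using ab by (intro sum.cong) auto
  also have "\<dots> = sum x E" using ab fin by (auto simp: sum.distrib sum_subtractf)
  finally have "sum ?y E = real k" using x by (simp add: cell_def)
  moreover have "\<forall>e\<in>I. ?y e = 1" "\<forall>e\<in>E - I - S. ?y e = 0"
    using x ab fin by (auto simp: cell_def)
  moreover have "\<forall>e\<in>S. 0 < ?y e \<and> ?y e < 1" using x d by (auto simp: cell_def)
  ultimately show ?thesis by (simp add: cell_def)
qed

text \<open>A small transfer between a fractional coordinate in \<open>F\<close> and one outside
  \<open>F\<close> keeps the total and moves the value either way.\<close>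

lemma cell_vals_open:
  assumes fin: "finite E" "F \<subseteq> E" "S \<subseteq> E" "I \<inter> S = {}" and ab: "a \<in> S \<inter> F" "b \<in> S - F"
    and s: "s \<in> cell_vals E k I S F"
  shows "(\<exists>u\<in>cell_vals E k I S F. u < s) \<and> (\<exists>u\<in>cell_vals E k I S F. s < u)"
proof -
  obtain x where x: "x \<in> cell E k I S" "s = sum x F" using s by (auto simp: cell_vals_def)
  have xs: "0 < x a" "x a < 1" "0 < x b" "x b < 1" using x(1) ab by (auto simp: cell_def)
  have step: "s + d \<in> cell_vals E k I S F" if "0 < x a + d" "x a + d < 1" "0 < x b - d" "x b - d < 1" for d
  proof -
    let ?y = "x(a := x a + d, b := x b - d)"
    have fF: "finite F" using fin by (meson rev_finite_subset)
    have "sum ?y F = (\<Sum>e\<in>F. x e + (if e = a then d else 0))"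
      using ab by (intro sum.cong) auto
    also have "\<dots> = s + d" using ab fF x(2) by (simp add: sum.distrib)
    finally have "s + d = sum ?y F" ..
    moreover have "?y \<in> cell E k I S"
      by (rule cell_transfer[OF x(1)]) (use fin ab that in auto)
    ultimately show ?thesis unfolding cell_vals_def by (rule image_eqI)
  qed
  \<comment> \<open>The least distance of the two coordinates from 0 and 1; half of it keeps both
    strictly inside.\<close>
  define m where "m = min (min (x a) (1 - x a)) (min (x b) (1 - x b))"
  have m: "0 < m" "m \<le> x a" "m \<le> 1 - x a" "m \<le> x b" "m \<le> 1 - x b"
    using xs by (auto simp: m_def)
  have "s + m / 2 \<in> cell_vals E k I S F" by (rule step) (use m in linarith)+
  moreover have "s + - (m / 2) \<in> cell_vals E k I S F" by (rule step) (use m in linarith)+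
  moreover have "s < s + m / 2" "s + - (m / 2) < s" using m(1) by simp_all
  ultimately show ?thesis by blast
qed

text \<open>The dichotomy behind the case analysis on a cell: a cap is constant there, or it takes
  no extreme value.\<close>

lemma cell_vals_types:
  assumes fin: "finite E" "F \<subseteq> E" and c: "(I, S) \<in> cells E k" and s: "s \<in> cell_vals E k I S F"
  shows "cell_vals E k I S F = {s} \<and> (S \<inter> F = {} \<or> S \<subseteq> F) \<or>
    (\<exists>u\<in>cell_vals E k I S F. u < s) \<and> (\<exists>u\<in>cell_vals E k I S F. s < u)"
proof (cases "S \<inter> F = {} \<or> S \<subseteq> F")
  case True
  obtain x where x: "x \<in> cell E k I S" "s = sum x F" using s by (auto simp: cell_vals_def)
  have "u = s" if u: "u \<in> cell_vals E k I S F" for u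
  proof -
    obtain y where y: "y \<in> cell E k I S" "u = sum y F" using u by (auto simp: cell_vals_def)
    then show ?thesis using cell_vals_const[OF fin True y(1) x(1)] x(2) by simp
  qed
  then have "cell_vals E k I S F = {s}" using s by blast
  then show ?thesis using True by simp
next
  case False
  then obtain a b where ab: "a \<in> S \<inter> F" "b \<in> S - F" by blast
  show ?thesis by (rule disjI2, rule cell_vals_open[OF fin cellsD(2,3)[OF c] ab s])
qed

section \<open>Families of caps with small overlaps\<close>

text \<open>The polyhedral argument uses the matroid only through these conditions. Proper cyclic
  flats with their ranks are the instance, and for them equality in \<open>overlap\<close> is
  modularity, by \<open>modular_iff\<close>.\<close>

locale capped_family =
  fixes E :: "'a set" and k :: nat and \<F> :: "'a set set" and r :: "'a set \<Rightarrow> nat"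
  assumes finite_ground: "finite E"
    and family_subset: "F \<in> \<F> \<Longrightarrow> F \<subseteq> E"
    and le_rank: "F \<in> \<F> \<Longrightarrow> r F \<le> k"
    and overlap: "F \<in> \<F> \<Longrightarrow> G \<in> \<F> \<Longrightarrow> F \<noteq> G \<Longrightarrow> card (F \<inter> G) + k \<le> r F + r G"
begin

lemma finite_family: "finite \<F>"
  using family_subset finite_ground by (intro finite_subset[of \<F> "Pow E"]) auto

lemma finite_member: "F \<in> \<F> \<Longrightarrow> finite F"
  using family_subset finite_ground by (meson rev_finite_subset)

definition modular_pairs :: "'a set set set" where
  "modular_pairs = {{F, G} | F G. F \<in> \<F> \<and> G \<in> \<F> \<and> F \<noteq> G \<and> card (F \<inter> G) + k = r F + r G}"

lemma finite_modular_pairs: "finite modular_pairs"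
  using finite_family by (intro finite_subset[of modular_pairs "Pow \<F>"]) (auto simp: modular_pairs_def)

lemma sum_lattice:
  assumes "F \<in> \<F>" "G \<in> \<F>"
  shows "sum x F + sum x G = sum x (F \<union> G) + sum (x :: 'a \<Rightarrow> real) (F \<inter> G)"
  by (rule sym, rule sum.union_inter) (use assms finite_member in auto)

text \<open>The chain \<open>r F + r G\<close> \<le> \<open>sum x F + sum x G\<close> =
  \<open>sum x (F \<union> G) + sum x (F \<inter> G)\<close> \<le>
  \<open>k + card (F \<inter> G)\<close> \<le> \<open>r F + r G\<close> closes up, so every step is
  an equality; the coordinate bounds are then attained one by one.\<close>

lemma both_reached:
  assumes F: "F \<in> \<F>" and G: "G \<in> \<F>" and "F \<noteq> G"
    and bounds: "\<And>e. e \<in> E \<Longrightarrow> 0 \<le> x e \<and> x e \<le> 1" and total: "sum x E = real k"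
    and ge: "sum x F \<ge> real (r F)" "sum x G \<ge> real (r G)"
  shows "card (F \<inter> G) + k = r F + r G" "sum x F = real (r F)" "sum x G = real (r G)"
    "\<And>e. e \<in> F \<inter> G \<Longrightarrow> x e = 1" "\<And>e. e \<in> E - (F \<union> G) \<Longrightarrow> x e = 0"
proof -
  have sub: "F \<union> G \<subseteq> E" "F \<inter> G \<subseteq> E" using family_subset F G by blast+
  have "sum x (F \<union> G) \<le> sum x E" using sub bounds finite_ground by (intro sum_mono2) auto
  moreover have "sum x (F \<inter> G) \<le> (\<Sum>e\<in>F \<inter> G. 1)" using sub bounds by (intro sum_mono) auto
  moreover have "real (card (F \<inter> G) + k) \<le> real (r F + r G)"
    using overlap[OF F G \<open>F \<noteq> G\<close>] by (intro of_nat_mono)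
  ultimately have eqs: "sum x F = real (r F)" "sum x G = real (r G)" "sum x (F \<union> G) = real k"
      "sum x (F \<inter> G) = real (card (F \<inter> G))" "real (card (F \<inter> G) + k) = real (r F + r G)"
    using sum_lattice[OF F G, of x] ge total by simp_all
  show "card (F \<inter> G) + k = r F + r G" using eqs(5) by (simp only: of_nat_eq_iff)
  show "sum x F = real (r F)" "sum x G = real (r G)" by fact+
  have "(\<Sum>e\<in>F \<inter> G. 1 - x e) = 0" using eqs(4) by (simp add: sum_subtractf)
  moreover have "finite (F \<inter> G)" using F finite_member by simp
  moreover have "0 \<le> 1 - x e" if "e \<in> F \<inter> G" for e using that bounds sub by auto
  ultimately have "1 - x e = 0" if "e \<in> F \<inter> G" for e
    using that by (intro sum_nonneg_0[of "F \<inter> G" "\<lambda>e. 1 - x e"])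
  then show "x e = 1" if "e \<in> F \<inter> G" for e using that by simp
  have "sum x (E - (F \<union> G)) = 0"
    using sum.subset_diff[OF sub(1) finite_ground, of x] eqs(3) total by simp
  moreover have "finite (E - (F \<union> G))" using finite_ground by simp
  moreover have "0 \<le> x e" if "e \<in> E - (F \<union> G)" for e using that bounds by auto
  ultimately show "x e = 0" if "e \<in> E - (F \<union> G)" for e
    using that by (intro sum_nonneg_0[of "E - (F \<union> G)" x])
qed

section \<open>The face count on a single cell\<close>

context
  fixes I S :: "'a set"
  assumes cell: "(I, S) \<in> cells E k"
begin

private abbreviation C where "C \<equiv> cell E k I S"
private abbreviation tights where "tights \<equiv> tight_sets E k \<F> r I S"
private abbreviation cut where "cut F \<equiv> cut_poly E k F (r F) I S"
private abbreviation pair where "pair p \<equiv> pair_poly E k r p I S"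
private abbreviation V where "V F \<equiv> cell_vals E k I S F"
private abbreviation lt where "lt F \<equiv> \<exists>s\<in>V F. s < real (r F)"
private abbreviation gt where "gt F \<equiv> \<exists>s\<in>V F. real (r F) < s"
private abbreviation X :: "int poly" where "X \<equiv> monom 1 (card S - 1)"
private abbreviation Y :: "'a set \<Rightarrow> int poly" where
  "Y F \<equiv> monom 1 ((card (S \<inter> F) - 1) + (card (S - F) - 1))"
text \<open>The cell lies on the face where coordinates are 1 on \<open>F \<inter> G\<close> and 0
  outside \<open>F \<union> G\<close>.\<close>

private abbreviation related where "related F G \<equiv> F \<inter> G \<subseteq> I \<and> I \<union> S \<subseteq> F \<union> G"

private lemma finite_S: "finite S"
  using cellsD(2)[OF cell] finite_ground by (rule finite_subset)

private lemma cell_bounds: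
  assumes "x \<in> C" "e \<in> E"
  shows "0 \<le> x e \<and> x e \<le> 1"
  using assms by (cases "e \<in> I"; cases "e \<in> S") (auto simp: cell_def)

text \<open>The sets where a point is 1 and where it is nonzero are \<open>I\<close> and
  \<open>I \<union> S\<close> for every point of the cell, so what \<open>both_reached\<close> gives
  at one point locates the whole cell.\<close>

private lemma meet:
  assumes "F \<in> \<F>" "G \<in> \<F>" "F \<noteq> G" and x: "x \<in> C"
    and ge: "sum x F \<ge> real (r F)" "sum x G \<ge> real (r G)"
  shows "card (F \<inter> G) + k = r F + r G" "related F G" "sum x F = real (r F)" "sum x G = real (r G)"
proof -
  have total: "sum x E = real k" using x by (simp add: cell_def)
  note b = both_reached[OF assms(1-3) cell_bounds[OF x] total ge]
  show "card (F \<inter> G) + k = r F + r G" "sum x F = real (r F)" "sum x G = real (r G)" using b by auto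
  have one: "e \<in> I" if "e \<in> E" "x e = 1" for e
    using cell_iff(1)[OF x that(1)] that(2) by simp
  have nonzero: "x e \<noteq> 0" if "e \<in> I \<union> S" for e
    using that x by (auto simp: cell_def)
  show "related F G"
  proof
    show "F \<inter> G \<subseteq> I" using b(4) one family_subset[OF assms(1)] by blast
    show "I \<union> S \<subseteq> F \<union> G" using b(5) nonzero cellsD(1,2)[OF cell] by blast
  qed
qed

text \<open>On such a cell the union carries the total \<open>k\<close> and the intersection its
  full size; the signed distances of a point from the two caps are therefore opposite.\<close>

private lemma related_sum:
  assumes "F \<in> \<F>" "G \<in> \<F>" "card (F \<inter> G) + k = r F + r G" "related F G" and x: "x \<in> C"
  shows "sum x F + sum x G = real (r F) + real (r G)"
proof -
  have "sum x (F \<union> G) = sum x E"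
    using assms family_subset finite_ground by (intro sum.mono_neutral_left) (auto simp: cell_def)
  moreover have "sum x (F \<inter> G) = real (card (F \<inter> G))"
    using assms by (subst sum.cong[of _ "F \<inter> G" x "\<lambda>_. 1"]) (auto simp: cell_def)
  ultimately have "sum x F + sum x G = real (card (F \<inter> G) + k)"
    using sum_lattice[OF assms(1,2), of x] x by (simp add: cell_def)
  then show ?thesis using assms(3) by simp
qed

private lemma related_blocks:
  assumes "related F G"
  shows "S \<inter> G = S - F" "S - G = S \<inter> F"
  using assms cellsD(3)[OF cell] by blast+

private lemma V_nonempty: "V F \<noteq> {}"
  using cell by (simp add: cells_iff_vals[where F = F])

private lemma types:
  assumes F: "F \<in> \<F>"
  obtains (below) "lt F" "\<not> gt F" "real (r F) \<notin> V F"
  | (above) "gt F" "\<not> lt F" "real (r F) \<notin> V F"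
  | (level) "V F = {real (r F)}" "Y F = X"
  | (across) "lt F" "gt F" "real (r F) \<in> V F"
proof (cases "real (r F) \<in> V F")
  case True
  have "V F = {real (r F)} \<and> (S \<inter> F = {} \<or> S \<subseteq> F) \<or> lt F \<and> gt F"
    by (rule cell_vals_types[OF finite_ground family_subset[OF F] cell True])
  \<comment> \<open>One of the two blocks is empty, and truncated subtraction lets it contribute
    0.\<close>
  moreover have "Y F = X" if "S \<inter> F = {} \<or> S \<subseteq> F"
  proof -
    from that have "S \<inter> F = {} \<and> S - F = S \<or> S \<inter> F = S \<and> S - F = {}" by blast
    then show ?thesis by (elim disjE conjE) (simp_all only: card.empty, simp_all)
  qed
  ultimately show ?thesis using that True by blast
next
  case False
  obtain s where s: "s \<in> V F" using V_nonempty by blast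
  have "\<not> (lt F \<and> gt F)"
    using cell_vals_between[of _ E k I S F _ "real (r F)"] False by (meson less_imp_le)
  moreover have "lt F \<or> gt F" using s False by (metis linorder_neqE)
  ultimately show ?thesis using that False by blast
qed

text \<open>A cap nowhere exceeded changes nothing, in the level case because the section is the
  whole cell. A cap exceeded everywhere removes the cell. A crossed cell keeps a piece of full
  dimension and gains the section, whence the negative sign.\<close>

private lemma cut_poly_cases:
  assumes "F \<in> \<F>"
  shows "cut F = (if gt F then if lt F then - Y F else X else 0)"
  using assms by (cases rule: types) (auto simp: cut_poly_def)

private lemma related_types:
  assumes F: "F \<in> \<F>" and G: "G \<in> \<F>" and m: "card (F \<inter> G) + k = r F + r G" and rel: "related F G"
  shows "lt F \<longleftrightarrow> gt G" "gt F \<longleftrightarrow> lt G" "real (r F) \<in> V F \<longleftrightarrow> real (r G) \<in> V G"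
proof -
  have r: "sum x F - real (r F) = real (r G) - sum x G" if "x \<in> C" for x
    using related_sum[OF F G m rel that] by simp
  have "(\<exists>x\<in>C. sum x F < real (r F)) \<longleftrightarrow> (\<exists>x\<in>C. real (r G) < sum x G)"
    using r by (intro bex_cong refl) (smt (verit))
  then show "lt F \<longleftrightarrow> gt G" by (simp add: cell_vals_def)
  have "(\<exists>x\<in>C. real (r F) < sum x F) \<longleftrightarrow> (\<exists>x\<in>C. sum x G < real (r G))"
    using r by (intro bex_cong refl) (smt (verit))
  then show "gt F \<longleftrightarrow> lt G" by (simp add: cell_vals_def)
  have "(\<exists>x\<in>C. real (r F) = sum x F) \<longleftrightarrow> (\<exists>x\<in>C. real (r G) = sum x G)"
    using r by (intro bex_cong refl) (smt (verit))
  then show "real (r F) \<in> V F \<longleftrightarrow> real (r G) \<in> V G" by (simp add: cell_vals_def image_iff)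
qed

text \<open>Across a cell, two independent cuts would leave \<open>X + Y F + Y F\<close>, while two
  opposite caps leave only their common section \<open>Y F\<close>; the excess is
  \<open>X + Y F\<close>. In the other positions the terms cancel.\<close>

private lemma pair_poly_cases:
  assumes F: "F \<in> \<F>" and G: "G \<in> \<F>" and ne: "F \<noteq> G" and m: "card (F \<inter> G) + k = r F + r G"
  shows "pair {F, G} = (if related F G \<and> lt F \<and> gt F then X + Y F else 0)"
proof (cases "related F G")
  case False
  then show ?thesis by (auto simp: pair_poly_def)
next
  case True
  note t = related_types[OF F G m True]
  have Y: "Y G = Y F" "monom 1 (\<Sum>F\<in>{F, G}. card (S \<inter> F) - 1) = Y F"
    using ne by (simp_all add: related_blocks[OF True] add.commute)
  have "pair {F, G} = X - (if real (r F) \<in> V F then Y F else 0)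
      - (cut F + cut G)"
    unfolding pair_poly_def Y(2) using True t(3) ne by auto
  also have "\<dots> = (if lt F \<and> gt F then X + Y F else 0)"
  proof -
    have "(real (r F) \<in> V F \<longleftrightarrow> (lt F \<longleftrightarrow> gt F)) \<and> (lt F \<or> gt F \<or> Y F = X)"
      using F by (cases rule: types) auto
    then show ?thesis
      unfolding cut_poly_cases[OF F] cut_poly_cases[OF G] t(1,2)[symmetric] Y(1) by auto
  qed
  finally show ?thesis using True by simp
qed

private lemma dim_related:
  assumes F: "F \<in> J" and J: "J \<subseteq> \<F>" and rel: "\<And>G. G \<in> J \<Longrightarrow> G \<noteq> F \<Longrightarrow> related F G"
  shows "monom 1 (dim (block_space S J)) = Y F"
proof (subst dim_block_space_insert[OF finite_S F])
  show "finite F" using F J finite_member by blast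
  show "finite G \<and> S \<inter> G = S - F" if "G \<in> J" "G \<noteq> F" for G
    using rel[OF that] related_blocks(1) J that finite_member by blast
qed simp

text \<open>No point of the cell survives, and \<open>cut F\<close> alone accounts for this: another
  cap reached at some point would, by \<open>meet\<close>, force equality for \<open>F\<close>
  there.\<close>

private lemma cell_identity_above:
  assumes F: "F \<in> \<F>" "gt F" "\<not> lt F"
  shows "(\<Sum>J\<in>tights. monom 1 (dim (block_space S J))) =
    X - (\<Sum>F\<in>\<F>. cut F) - (\<Sum>p\<in>modular_pairs. pair p)"
proof -
  have gtF: "sum x F > real (r F)" if x: "x \<in> C" for x
  proof -
    have "real (r F) \<notin> V F" using F(1) F(2,3) by (cases rule: types) auto
    then show ?thesis
      using F(3) x unfolding cell_vals_def by (metis imageI linorder_neqE)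
  qed
  have others: "\<not> gt G \<and> lt G" if G: "G \<in> \<F>" "G \<noteq> F" for G
  proof -
    have "sum x G < real (r G)" if x: "x \<in> C" for x
    proof (rule ccontr)
      assume "\<not> sum x G < real (r G)"
      then have "sum x F = real (r F)"
        using meet(3)[OF F(1) G(1) _ x] G(2) gtF[OF x] by auto
      then show False using gtF[OF x] by simp
    qed
    then have "s < real (r G)" if "s \<in> V G" for s using that by (auto simp: cell_vals_def)
    then show ?thesis using V_nonempty[of G] by (metis ex_in_conv less_asym)
  qed
  have "(\<Sum>F\<in>\<F>. cut F) =
      cut F + (\<Sum>G\<in>\<F> - {F}. cut G)"
    using finite_family F(1) by (rule sum.remove)
  also have "(\<Sum>G\<in>\<F> - {F}. cut G) = 0"
    using others cut_poly_cases by (intro sum.neutral) auto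
  also have "cut F = X" using cut_poly_cases[OF F(1)] F by auto
  finally have "(\<Sum>F\<in>\<F>. cut F) = X" by simp
  moreover have "(\<Sum>p\<in>modular_pairs. pair p) = 0"
  proof (rule sum.neutral, rule ballI)
    fix p assume "p \<in> modular_pairs"
    then obtain A B where p: "p = {A, B}" "A \<in> \<F>" "B \<in> \<F>" "A \<noteq> B" "card (A \<inter> B) + k = r A + r B"
      by (auto simp: modular_pairs_def)
    have "\<not> (lt A \<and> gt A)" using others[OF p(2)] F by (cases "A = F") auto
    then show "pair p = 0" unfolding p(1) pair_poly_cases[OF p(2-5)] by auto
  qed
  moreover have "tights = {}" using F(1) gtF by (force simp: tight_sets_def)
  ultimately show ?thesis by simp
qed

text \<open>The balance is \<open>X + Y F + Y F - (X + Y F) = Y F\<close>, the term of the common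
  section. What remains to be seen is that every other cap stays strictly slack on the whole
  cell.\<close>

private lemma cell_identity_across_pair:
  assumes F: "F \<in> \<F>" and G: "G \<in> \<F>" and ne: "F \<noteq> G" and m: "card (F \<inter> G) + k = r F + r G"
    and rel: "related F G" and F': "lt F" "gt F"
  shows "(\<Sum>J\<in>tights. monom 1 (dim (block_space S J))) =
    X - (\<Sum>F\<in>\<F>. cut F) - (\<Sum>p\<in>modular_pairs. pair p)"
proof -
  note t = related_types[OF F G m rel]
  have G': "lt G" "gt G" using t F' by auto
  have others: "sum x H < real (r H)" if H: "H \<in> \<F>" "H \<noteq> F" "H \<noteq> G" and x: "x \<in> C" for H x
  proof (rule ccontr)
    assume "\<not> sum x H < real (r H)"
    then have ge: "sum x H \<ge> real (r H)" by simp
    \<comment> \<open>A third cap \<open>H\<close> reached together with \<open>A\<close> is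
      opposite to \<open>A\<close>, just as \<open>B\<close> is. Hence \<open>H\<close> moves with
      \<open>B\<close> and is exceeded wherever \<open>B\<close> is, which \<open>meet\<close>
      forbids.\<close>
    have across: False
      if A: "A \<in> \<F>" and B: "B \<in> \<F>" and neq: "H \<noteq> A" "H \<noteq> B"
        and rAB: "\<And>z. z \<in> C \<Longrightarrow> sum z A + sum z B = real (r A) + real (r B)"
        and gB: "gt B" and geA: "sum x A \<ge> real (r A)" for A B
    proof -
      have mm: "card (A \<inter> H) + k = r A + r H" "related A H"
        using meet(1,2)[OF A H(1) neq(1)[symmetric] x geA ge] by auto
      obtain z where z: "z \<in> C" "sum z B > real (r B)"
        using gB by (auto simp: cell_vals_def)
      have "sum z H > real (r H)"
        using related_sum[OF A H(1) mm z(1)] rAB[OF z(1)] z(2) by simp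
      then have "sum z B = real (r B)"
        using meet(3)[OF B H(1) neq(2)[symmetric] z(1)] z(2) by simp
      then show False using z(2) by simp
    qed
    have FG: "sum z F + sum z G = real (r F) + real (r G)" if "z \<in> C" for z
      using related_sum[OF F G m rel that] .
    show False
    proof (cases "sum x F \<ge> real (r F)")
      case True
      then show False using across[OF F G H(2,3) FG G'(2)] by simp
    next
      case False
      then have "sum x G \<ge> real (r G)" using FG[OF x] by simp
      then show False using across[OF G F H(3,2) _ F'(2)] FG by (simp add: add.commute)
    qed
  qed
  have below: "\<not> gt H" if H: "H \<in> \<F>" "H \<noteq> F" "H \<noteq> G" for H
    using others[OF H] by (force simp: cell_vals_def)
  have Y: "Y G = Y F" by (simp add: related_blocks[OF rel] add.commute)
  have "(\<Sum>F\<in>\<F>. cut F) = (\<Sum>H\<in>{F, G}. cut H)"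
    using finite_family F G below cut_poly_cases by (intro sum.mono_neutral_right) auto
  also have "\<dots> = - Y F - Y F"
    using ne F' G' cut_poly_cases[OF F] cut_poly_cases[OF G] Y by simp
  finally have cuts: "(\<Sum>F\<in>\<F>. cut F) = - Y F - Y F" .
  have "(\<Sum>p\<in>modular_pairs. pair p) = (\<Sum>p\<in>{{F, G}}. pair p)"
  proof (rule sum.mono_neutral_right[OF finite_modular_pairs])
    show "{{F, G}} \<subseteq> modular_pairs" using F G ne m by (auto simp: modular_pairs_def)
    show "\<forall>p\<in>modular_pairs - {{F, G}}. pair p = 0"
    proof
      fix p assume p: "p \<in> modular_pairs - {{F, G}}"
      then obtain A B where AB: "p = {A, B}" "A \<in> \<F>" "B \<in> \<F>" "A \<noteq> B" "card (A \<inter> B) + k = r A + r B"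
        by (auto simp: modular_pairs_def)
      have "\<not> (related A B \<and> lt A \<and> gt A)"
      proof
        assume R: "related A B \<and> lt A \<and> gt A"
        then have "gt A" "gt B" using related_types[OF AB(2,3,5)] by auto
        then have "A \<in> {F, G}" "B \<in> {F, G}" using below AB by blast+
        then have "p = {F, G}" using AB by auto
        then show False using p by simp
      qed
      then show "pair p = 0"
        unfolding AB(1) pair_poly_cases[OF AB(2-5)] by (rule if_not_P)
    qed
  qed
  also have "\<dots> = X + Y F" using pair_poly_cases[OF F G ne m] rel F' by simp
  finally have pairs: "(\<Sum>p\<in>modular_pairs. pair p) = X + Y F" .
  have "tights = {{F, G}}"
  proof (intro equalityI subsetI)
    fix J assume "J \<in> tights"
    then obtain x where x: "x \<in> C" "\<And>F. F \<in> \<F> \<Longrightarrow> sum x F \<le> real (r F)"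
      "J = {F \<in> \<F>. sum x F = real (r F)}" by (auto simp: tight_sets_def)
    \<comment> \<open>Both caps are obeyed and their distances are opposite, so both are
      tight.\<close>
    have "sum x F = real (r F)" "sum x G = real (r G)"
      using related_sum[OF F G m rel x(1)] x(2)[OF F] x(2)[OF G] by linarith+
    moreover have "H = F \<or> H = G" if "H \<in> J" for H
      using that x(3) others[of H x] x(1) by force
    ultimately show "J \<in> {{F, G}}" using F G x(3) by auto
  next
    fix J assume J: "J \<in> {{F, G}}"
    have "real (r F) \<in> V F" using F F' by (cases rule: types) auto
    then obtain x where x: "x \<in> C" "sum x F = real (r F)"
      unfolding cell_vals_def by (metis imageE)
    have xG: "sum x G = real (r G)" using related_sum[OF F G m rel x(1)] x(2) by simp
    have le: "sum x H \<le> real (r H)" if "H \<in> \<F>" for H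
      using others[OF that _ _ x(1)] x(2) xG by (metis less_imp_le order_refl)
    have "J = {H \<in> \<F>. sum x H = real (r H)}"
      using J F G x(2) xG others[OF _ _ _ x(1)] by (auto simp: less_le)
    then show "J \<in> tights" unfolding tight_sets_def using x(1) le by blast
  qed
  then have "(\<Sum>J\<in>tights. monom 1 (dim (block_space S J))) = Y F"
    using dim_related[of F "{F, G}"] F G rel by simp
  then show ?thesis using cuts pairs by simp
qed

text \<open>No pair term arises and each crossed cap adds its section. These sections are pairwise
  disjoint, so tight sets have at most one member, unless a level cap makes the whole cell a single
  face.\<close>

private lemma cell_identity_other:
  assumes noabove: "\<And>F. F \<in> \<F> \<Longrightarrow> gt F \<Longrightarrow> lt F"
    and nopair: "\<And>F G. F \<in> \<F> \<Longrightarrow> G \<in> \<F> \<Longrightarrow> F \<noteq> G \<Longrightarrow> card (F \<inter> G) + k = r F + r G \<Longrightarrow>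
      related F G \<Longrightarrow> lt F \<Longrightarrow> \<not> gt F"
  shows "(\<Sum>J\<in>tights. monom 1 (dim (block_space S J))) =
    X - (\<Sum>F\<in>\<F>. cut F) - (\<Sum>p\<in>modular_pairs. pair p)"
proof -
  have pairs: "(\<Sum>p\<in>modular_pairs. pair p) = 0"
  proof (rule sum.neutral, rule ballI)
    fix p assume "p \<in> modular_pairs"
    then obtain A B where p: "p = {A, B}" "A \<in> \<F>" "B \<in> \<F>" "A \<noteq> B" "card (A \<inter> B) + k = r A + r B"
      by (auto simp: modular_pairs_def)
    have "\<not> (related A B \<and> lt A \<and> gt A)" using nopair[OF p(2-5)] by blast
    then show "pair p = 0"
      unfolding p(1) pair_poly_cases[OF p(2-5)] by (rule if_not_P)
  qed
  define T where "T = {F \<in> \<F>. gt F}"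
  have finT: "finite T" using finite_family by (simp add: T_def)
  have "(\<Sum>F\<in>\<F>. cut F) = (\<Sum>F\<in>T. - Y F)"
    using noabove finite_family cut_poly_cases
    by (intro sum.mono_neutral_cong_right) (auto simp: T_def)
  then have cuts: "(\<Sum>F\<in>\<F>. cut F) = - (\<Sum>F\<in>T. Y F)"
    by (simp add: sum_negf)
  obtain x0 where x0: "x0 \<in> C" using cellsD(4)[OF cell] by blast
  have "(\<Sum>J\<in>tights. monom 1 (dim (block_space S J))) = X + (\<Sum>F\<in>T. Y F)"
  proof (cases "\<exists>F\<in>\<F>. V F = {real (r F)}")
    case True
    then obtain F where F: "F \<in> \<F>" "V F = {real (r F)}" by blast
    have xF: "sum x F = real (r F)" if "x \<in> C" for x
      using F(2) that by (auto simp: cell_vals_def)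
    \<comment> \<open>A cap reached anywhere together with the level cap \<open>F\<close> is
      opposite to it, hence level as well.\<close>
    have dich: "(\<forall>x\<in>C. sum x G < real (r G)) \<or>
        (\<forall>x\<in>C. sum x G = real (r G)) \<and> (G = F \<or> related F G)" if G: "G \<in> \<F>" for G
    proof (cases "G = F \<or> (\<forall>x\<in>C. sum x G < real (r G))")
      case True
      then show ?thesis using xF by blast
    next
      case False
      then obtain x where x: "x \<in> C" "sum x G \<ge> real (r G)" by (meson not_le)
      have mm: "card (F \<inter> G) + k = r F + r G" "related F G"
        using meet(1,2)[OF F(1) G _ x(1)] False x xF[OF x(1)] by auto
      have "sum y G = real (r G)" if "y \<in> C" for y
        using related_sum[OF F(1) G mm that] xF[OF that] by simp
      then show ?thesis using mm by blast
    qed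
    define J where "J = {G \<in> \<F>. sum x0 G = real (r G)}"
    have "tights = {J}"
    proof -
      have "{G \<in> \<F>. sum x G = real (r G)} = J" if "x \<in> C" for x
      proof -
        have "sum x G = real (r G) \<longleftrightarrow> sum x0 G = real (r G)" if "G \<in> \<F>" for G
          using dich[OF that] x0 \<open>x \<in> C\<close> by (metis less_irrefl)
        then show ?thesis by (auto simp: J_def)
      qed
      moreover have "\<forall>G\<in>\<F>. sum x0 G \<le> real (r G)" using dich x0 by (metis less_imp_le order_refl)
      ultimately show ?thesis using x0 by (auto simp: tight_sets_def)
    qed
    moreover have "monom 1 (dim (block_space S J)) = Y F"
    proof (rule dim_related)
      show "F \<in> J" "J \<subseteq> \<F>" using F(1) xF[OF x0] by (auto simp: J_def)
      show "related F G" if "G \<in> J" "G \<noteq> F" for G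
        using dich[of G] that x0 by (auto simp: J_def)
    qed
    moreover have "Y F = X" using F(1) by (cases rule: types) (use F(2) in auto)
    moreover have "T = {}"
    proof -
      have "\<not> gt G" if "G \<in> \<F>" for G
        using dich[OF that] by (auto simp: cell_vals_def)
      then show ?thesis by (auto simp: T_def)
    qed
    ultimately show ?thesis by simp
  next
    case nolevel: False
    have nl: "V F \<noteq> {real (r F)}" if "F \<in> \<F>" for F using that nolevel by blast
    have lt: "lt F" if "F \<in> \<F>" for F
      using that noabove[OF that] nl[OF that] by (cases rule: types) blast+
    have eqT: "F \<in> T" if "F \<in> \<F>" "x \<in> C" "sum x F \<ge> real (r F)" for F x
    proof -
      have "sum x F \<in> V F" using that(2) by (simp add: cell_vals_def)
      then have "gt F \<or> real (r F) \<in> V F" using that(3) by (metis less_eq_real_def)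
      note gteq = this
      have "gt F" using that(1) nl[OF that(1)] gteq by (cases rule: types) blast+
      then show ?thesis using that(1) by (simp add: T_def)
    qed
    \<comment> \<open>Two caps reached at one point would form a related pair that crosses the cell,
      which \<open>nopair\<close> excludes.\<close>
    have alone: "sum x G < real (r G)"
      if "F \<in> \<F>" "G \<in> \<F>" "F \<noteq> G" "x \<in> C" "sum x F \<ge> real (r F)" for F G x
    proof (rule ccontr)
      assume "\<not> sum x G < real (r G)"
      then have ge: "sum x G \<ge> real (r G)" by simp
      have "\<not> gt F"
        using nopair[OF that(1-3) meet(1,2)[OF that(1-5) ge] lt[OF that(1)]] .
      then show False using eqT[OF that(1,4,5)] by (simp add: T_def)
    qed
    have "tights = insert {} ((\<lambda>F. {F}) ` T)"
    proof (intro equalityI subsetI)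
      fix J assume "J \<in> tights"
      then obtain x where x: "x \<in> C" "J = {F \<in> \<F>. sum x F = real (r F)}"
        by (auto simp: tight_sets_def)
      show "J \<in> insert {} ((\<lambda>F. {F}) ` T)"
      proof (cases "J = {}")
        case False
        then obtain F where F: "F \<in> \<F>" "sum x F = real (r F)" using x(2) by blast
        have "H = F" if "H \<in> J" for H
        proof (rule ccontr)
          assume "H \<noteq> F"
          moreover have H: "H \<in> \<F>" "sum x H = real (r H)" using that x(2) by auto
          ultimately show False using alone[OF F(1) H(1) _ x(1)] F(2) by simp
        qed
        moreover have "F \<in> J" using F x(2) by simp
        ultimately have "J = {F}" by blast
        then show ?thesis using eqT[OF F(1) x(1)] F(2) by simp
      qed simp
    next
      fix J assume J: "J \<in> insert {} ((\<lambda>F. {F}) ` T)"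
      have sing: "\<exists>x\<in>C. sum x F = real (r F) \<and> (\<forall>G\<in>\<F> - {F}. sum x G < real (r G))"
        if "F \<in> T" for F
      proof -
        have F: "F \<in> \<F>" "gt F" using that by (auto simp: T_def)
        have "real (r F) \<in> V F" using F(1) lt[OF F(1)] F(2) by (cases rule: types) auto
        then obtain x where x: "x \<in> C" "sum x F = real (r F)"
          unfolding cell_vals_def by (metis imageE)
        then show ?thesis using alone[OF F(1) _ _ x(1)] by (intro bexI[of _ x]) auto
      qed
      show "J \<in> tights"
      proof (cases "J = {}")
        case False
        then obtain F where F: "F \<in> T" "J = {F}" using J by blast
        have FF: "F \<in> \<F>" using F by (simp add: T_def)
        from sing[OF F(1)] obtain x where x: "x \<in> C" "sum x F = real (r F)"
          "\<forall>G\<in>\<F> - {F}. sum x G < real (r G)" by blast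
        have tri: "sum x G \<le> real (r G) \<and> (sum x G = real (r G) \<longleftrightarrow> G = F)" if "G \<in> \<F>" for G
          using x(2,3) that by (cases "G = F") force+
        have "\<forall>G\<in>\<F>. sum x G \<le> real (r G)" using tri by blast
        moreover have "J = {G \<in> \<F>. sum x G = real (r G)}" using tri F(2) FF by auto
        ultimately show ?thesis unfolding tight_sets_def using x(1) by blast
      next
        case True
        have "\<exists>z\<in>C. \<forall>G\<in>\<F>. sum z G < real (r G)"
        proof (cases "T = {}")
          case True
          have "sum x0 G < real (r G)" if "G \<in> \<F>" for G
          proof (rule ccontr)
            assume "\<not> sum x0 G < real (r G)"
            then have "G \<in> T" using eqT[OF that x0] by simp
            then show False using True by simp
          qed
          then show ?thesis using x0 by blast
        next
          case False
          then obtain F where F: "F \<in> T" by blast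
          have FF: "F \<in> \<F>" using F by (simp add: T_def)
          from sing[OF F] obtain x where x: "x \<in> C" "sum x F = real (r F)"
            "\<forall>G\<in>\<F> - {F}. sum x G < real (r G)" by blast
          \<comment> \<open>From a point \<open>x\<close> on the section of \<open>F\<close>, a
            short step towards \<open>y\<close> goes below \<open>F\<close>; the other caps are
            strict at \<open>x\<close> and stay so.\<close>
          obtain y where y: "y \<in> C" "sum y F < real (r F)"
            using lt[OF FF] by (auto simp: cell_vals_def)
          have "\<exists>\<epsilon>>0. \<forall>G\<in>\<F> - {F}. \<forall>t. \<bar>t\<bar> \<le> \<epsilon> \<longrightarrow> sum x G + t * (sum y G - sum x G) < real (r G)"
            using finite_family x(3) by (intro finite_uniform_radius strict_affine_radius) auto
          then obtain \<epsilon> where e: "\<epsilon> > 0"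
            "\<And>G t. G \<in> \<F> - {F} \<Longrightarrow> \<bar>t\<bar> \<le> \<epsilon> \<Longrightarrow> sum x G + t * (sum y G - sum x G) < real (r G)"
            by blast
          define t where "t = min \<epsilon> 1"
          have t: "0 < t" "t \<le> 1" "\<bar>t\<bar> \<le> \<epsilon>" using e by (auto simp: t_def)
          let ?z = "\<lambda>e. (1 - t) * x e + t * y e"
          have z: "sum ?z G = sum x G + t * (sum y G - sum x G)" for G
            by (simp add: sum.distrib sum_distrib_left[symmetric]) (simp add: algebra_simps)
          have "sum ?z G < real (r G)" if "G \<in> \<F>" for G
          proof (cases "G = F")
            case True
            have "t * (sum y F - sum x F) < 0" using t(1) x(2) y(2) by (simp add: mult_pos_neg)
            then show ?thesis using z[of F] x(2) True by simp
          next
            case False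
            then show ?thesis using e(2)[of G t] t that z[of G] by simp
          qed
          moreover have "?z \<in> C" using cell_convex[OF x(1) y(1)] t by simp
          ultimately show ?thesis by blast
        qed
        then obtain z where z: "z \<in> C" "\<forall>G\<in>\<F>. sum z G < real (r G)" by blast
        have "J = {G \<in> \<F>. sum z G = real (r G)}" using z(2) True by (auto simp: less_le)
        moreover have "\<forall>G\<in>\<F>. sum z G \<le> real (r G)" using z(2) by (simp add: less_imp_le)
        ultimately show ?thesis unfolding tight_sets_def using z(1) by blast
      qed
    qed
    then have "(\<Sum>J\<in>tights. monom 1 (dim (block_space S J))) =
        monom 1 (dim (block_space S {})) + (\<Sum>J\<in>(\<lambda>F. {F}) ` T. monom 1 (dim (block_space S J)))"
      using finT by (simp only:) (subst sum.insert; auto)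
    also have "(\<Sum>J\<in>(\<lambda>F. {F}) ` T. monom 1 (dim (block_space S J))) =
        (\<Sum>F\<in>T. monom 1 (dim (block_space S {F})))"
      by (subst sum.reindex) (auto simp: inj_on_def)
    also have "\<dots> = (\<Sum>F\<in>T. Y F)"
      by (intro sum.cong refl dim_related) (auto simp: T_def)
    finally show ?thesis using dim_block_space_empty[OF finite_S] by simp
  qed
  then show ?thesis using cuts pairs by simp
qed

lemma cell_identity:
  "(\<Sum>J\<in>tights. monom 1 (dim (block_space S J))) =
    X - (\<Sum>F\<in>\<F>. cut F) - (\<Sum>p\<in>modular_pairs. pair p)"
proof (cases "\<exists>F\<in>\<F>. gt F \<and> \<not> lt F")
  case True
  then show ?thesis using cell_identity_above by blast
next
  case noabove: False
  show ?thesis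
  proof (cases "\<exists>F\<in>\<F>. \<exists>G\<in>\<F>. F \<noteq> G \<and> card (F \<inter> G) + k = r F + r G \<and> related F G \<and> lt F \<and> gt F")
    case True
    then show ?thesis using cell_identity_across_pair by blast
  next
    case False
    show ?thesis
    proof (rule cell_identity_other)
      show "lt F" if "F \<in> \<F>" "gt F" for F using that noabove by blast
      show "\<not> gt F" if "F \<in> \<F>" "G \<in> \<F>" "F \<noteq> G" "card (F \<inter> G) + k = r F + r G"
        "related F G" "lt F" for F G
        using that False by (metis (no_types, lifting))
    qed
  qed
qed

end

lemma face_poly_capped_hypersimplex:
  "face_poly (capped_hypersimplex E k \<F> r) = face_poly (hypersimplex k (card E))
    - (\<Sum>F\<in>\<F>. u_poly (r F) k (card F) (card E))
    - (\<Sum>p\<in>modular_pairs. \<Sum>(I, S)\<in>cells E k. pair_poly E k r p I S)"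
proof -
  have "face_poly (capped_hypersimplex E k \<F> r) =
      (\<Sum>(I, S)\<in>cells E k. \<Sum>J\<in>tight_sets E k \<F> r I S. monom 1 (dim (block_space S J)))"
    using finite_ground finite_family family_subset by (rule face_poly_capped)
  also have "\<dots> = (\<Sum>(I, S)\<in>cells E k. monom 1 (card S - 1)
      - (\<Sum>F\<in>\<F>. cut_poly E k F (r F) I S) - (\<Sum>p\<in>modular_pairs. pair_poly E k r p I S))"
    using cell_identity by (intro sum.cong refl) auto
  also have "\<dots> = (\<Sum>(I, S)\<in>cells E k. monom 1 (card S - 1))
      - (\<Sum>F\<in>\<F>. \<Sum>(I, S)\<in>cells E k. cut_poly E k F (r F) I S)
      - (\<Sum>p\<in>modular_pairs. \<Sum>(I, S)\<in>cells E k. pair_poly E k r p I S)"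
    unfolding case_prod_unfold sum_subtractf
    by (subst sum.swap[of _ "cells E k" \<F>], subst sum.swap[of _ "cells E k" modular_pairs]) (rule refl)
  also have "(\<Sum>F\<in>\<F>. \<Sum>(I, S)\<in>cells E k. cut_poly E k F (r F) I S) =
      (\<Sum>F\<in>\<F>. u_poly (r F) k (card F) (card E))"
    by (intro sum.cong refl u_poly_eq_sum_cut_poly[symmetric] finite_ground family_subset)
  finally show ?thesis using face_poly_hypersimplex[OF finite_ground, of k] by simp
qed

end

section \<open>Integrality of capped hypersimplices\<close>

lemma convex_capped_hypersimplex: "convex (capped_hypersimplex E k \<F> r)"
proof (rule convexI)
  fix x y :: "'a \<Rightarrow>\<^sub>0 real" and u v :: real
  assume x: "x \<in> capped_hypersimplex E k \<F> r" and y: "y \<in> capped_hypersimplex E k \<F> r"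
    and uv: "0 \<le> u" "0 \<le> v" "u + v = 1"
  let ?z = "u *\<^sub>R x + v *\<^sub>R y"
  have z: "coord ?z e = u * coord x e + v * coord y e" for e
    by (simp add: lookup_add)
  have sums: "sum (coord ?z) A =
      u * sum (coord x) A + v * sum (coord y) A" for A
    by (simp add: z sum.distrib sum_distrib_left)
  have comb: "u * p + v * q \<le> c" if "p \<le> c" "q \<le> c" for p q c
  proof -
    have "u * p + v * q \<le> u * c + v * c" using that uv by (intro add_mono mult_left_mono)
    then show ?thesis using uv by (metis distrib_right mult_1)
  qed
  have "Poly_Mapping.keys ?z \<subseteq> E"
  proof
    fix e assume "e \<in> Poly_Mapping.keys ?z"
    then have "coord x e \<noteq> 0 \<or> coord y e \<noteq> 0"
      by (auto simp: in_keys_iff z)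
    then show "e \<in> E" using x y by (auto simp: in_keys_iff capped_hypersimplex_def)
  qed
  moreover have "\<forall>e\<in>E. 0 \<le> coord ?z e \<and> coord ?z e \<le> 1"
    using x y uv unfolding z by (auto simp: capped_hypersimplex_def intro!: comb)
  moreover have "sum (coord ?z) E = real k"
    using x y uv unfolding sums by (simp add: capped_hypersimplex_def distrib_right[symmetric])
  moreover have "\<forall>F\<in>\<F>. sum (coord ?z) F \<le> real (r F)"
    using x y unfolding sums by (auto simp: capped_hypersimplex_def intro!: comb)
  ultimately show "?z \<in> capped_hypersimplex E k \<F> r"
    by (simp only: capped_hypersimplex_def mem_Collect_eq)
qed

lemma sum_lookup_indicator_vec:
  assumes "finite X" "finite A"
  shows "sum (coord (indicator_vec X)) A = real (card (X \<inter> A))"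
proof -
  have "sum (coord (indicator_vec X)) A = (\<Sum>e\<in>A. if e \<in> X then 1 else 0)"
    using assms by (simp add: lookup_indicator_vec)
  also have "\<dots> = real (card (A \<inter> X))"
    using assms by (simp add: sum.inter_restrict[symmetric])
  finally show ?thesis by (simp add: Int_commute)
qed

lemma two_fractional:
  fixes x :: "'a \<Rightarrow> real"
  assumes A: "finite A" "sum x A \<in> \<int>" and a: "a \<in> A" "0 < x a" "x a < 1"
    and int: "\<And>e. e \<in> A \<Longrightarrow> \<not> (0 < x e \<and> x e < 1) \<Longrightarrow> x e \<in> \<int>"
  shows "\<exists>b\<in>A. b \<noteq> a \<and> 0 < x b \<and> x b < 1"
proof (rule ccontr)
  assume none: "\<not> ?thesis"
  have "x e \<in> \<int>" if "e \<in> A - {a}" for e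
    using int[of e] none that by blast
  then have "sum x (A - {a}) \<in> \<int>" by (rule Ints_sum)
  moreover have "x a = sum x A - sum x (A - {a})" using A(1) a(1) by (simp add: sum_diff1)
  ultimately have "x a \<in> \<int>" using A(2) by simp
  then obtain m where "x a = of_int m" by (auto elim: Ints_cases)
  then show False using a(2,3) by simp
qed

context capped_family
begin

definition fractional :: "('a \<Rightarrow>\<^sub>0 real) \<Rightarrow> 'a set" where
  "fractional x = {e \<in> E. 0 < coord x e \<and> coord x e < (1::real)}"
definition slack :: "('a \<Rightarrow>\<^sub>0 real) \<Rightarrow> 'a set set" where
  "slack x = {F \<in> \<F>. sum (coord x) F < real (r F)}"

lemma finite_fractional: "finite (fractional x)"
  using finite_ground by (simp add: fractional_def)

lemma finite_slack: "finite (slack x)"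
  using finite_family by (simp add: slack_def)

text \<open>Weight moves from \<open>b\<close> to \<open>a\<close> until \<open>a\<close> reaches 1,
  \<open>b\<close> reaches 0 or a slack cap becomes tight. Tight caps contain both elements or
  neither, so they stay tight, and integral coordinates stay fixed; hence the combined count
  drops.\<close>

lemma push:
  assumes x: "x \<in> capped_hypersimplex E k \<F> r"
    and a: "a \<in> fractional x" and b: "b \<in> fractional x" and ab: "a \<noteq> b"
    and tight: "\<And>F. F \<in> \<F> - slack x \<Longrightarrow> a \<in> F \<longleftrightarrow> b \<in> F"
  shows "\<exists>t>0. x + t *\<^sub>R (Poly_Mapping.single a 1 - Poly_Mapping.single b 1) \<in> capped_hypersimplex E k \<F> r \<and>
    card (fractional (x + t *\<^sub>R (Poly_Mapping.single a 1 - Poly_Mapping.single b 1))) +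
    card (slack (x + t *\<^sub>R (Poly_Mapping.single a 1 - Poly_Mapping.single b 1))) <
    card (fractional x) + card (slack x)"
proof -
  let ?x = "coord x"
  \<comment> \<open>The lengths at which something is hit; among the caps only those with
    \<open>a\<close> inside and \<open>b\<close> outside grow.\<close>
  define T where "T = {1 - ?x a, ?x b} \<union> (\<lambda>F. real (r F) - sum ?x F) ` {F \<in> slack x. a \<in> F \<and> b \<notin> F}"
  define t where "t = Min T"
  define y where "y = x + t *\<^sub>R (Poly_Mapping.single a 1 - Poly_Mapping.single b (1::real))"
  have finT: "finite T" using finite_slack by (simp add: T_def)
  have tT: "t \<in> T" unfolding t_def using finT by (intro Min_in) (auto simp: T_def)
  have tle: "t \<le> c" if "c \<in> T" for c unfolding t_def using finT that by (rule Min_le)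
  have t0: "0 < t" using tT a b by (auto simp: T_def fractional_def slack_def)
  have ta: "t \<le> 1 - ?x a" "t \<le> ?x b" by (auto intro!: tle simp: T_def)
  have aE: "a \<in> E" "b \<in> E" and fa: "0 < ?x a" "?x a < 1" "0 < ?x b" "?x b < 1"
    using a b by (auto simp: fractional_def)
  have ly: "coord y e = ?x e + (if e = a then t else 0) - (if e = b then t else 0)" for e
    by (simp add: y_def lookup_add lookup_minus lookup_single when_def)
  have sy: "sum (coord y) A =
      sum ?x A + (if a \<in> A then t else 0) - (if b \<in> A then t else 0)" if "finite A" for A
    using that by (simp add: ly sum.distrib sum_subtractf)
  have Fy: "sum (coord y) F \<le> real (r F)" "F \<notin> slack x \<Longrightarrow> F \<notin> slack y"
    if F: "F \<in> \<F>" for F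
  proof -
    have le: "sum ?x F \<le> real (r F)" using x F by (simp add: capped_hypersimplex_def)
    show "sum (coord y) F \<le> real (r F)"
    proof (cases "a \<in> F \<and> b \<notin> F")
      case True
      then have "F \<in> slack x" using tight F by blast
      then have "t \<le> real (r F) - sum ?x F" using True by (intro tle) (simp add: T_def)
      then show ?thesis using True by (simp add: sy finite_member F)
    next
      case False
      then show ?thesis using le t0 by (simp add: sy finite_member F)
    qed
    show "F \<notin> slack y" if "F \<notin> slack x"
      using tight[of F] that F by (simp add: slack_def sy finite_member)
  qed
  have by01: "0 \<le> coord y e \<and> coord y e \<le> 1" if "e \<in> E" for e
  proof -
    have "0 \<le> ?x e \<and> ?x e \<le> 1" using x that by (simp add: capped_hypersimplex_def)
    then show ?thesis using ta t0 fa ab by (simp add: ly)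
  qed
  have "Poly_Mapping.keys y \<subseteq> E"
  proof
    fix e assume "e \<in> Poly_Mapping.keys y"
    then have "?x e \<noteq> 0 \<or> e = a \<or> e = b" by (auto simp: in_keys_iff ly split: if_splits)
    then show "e \<in> E" using x aE by (auto simp: capped_hypersimplex_def in_keys_iff)
  qed
  moreover have "sum (coord y) E = real k"
    using x aE by (simp add: sy finite_ground capped_hypersimplex_def)
  ultimately have yP: "y \<in> capped_hypersimplex E k \<F> r"
    using by01 Fy(1) by (simp add: capped_hypersimplex_def)
  have fsub: "fractional y \<subseteq> fractional x"
  proof
    fix e assume e: "e \<in> fractional y"
    then show "e \<in> fractional x"
      using a b by (cases "e = a"; cases "e = b") (auto simp: fractional_def ly)
  qed
  have ssub: "slack y \<subseteq> slack x"
    using Fy(2) by (auto simp: slack_def)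
  have "fractional y \<subset> fractional x \<or> slack y \<subset> slack x"
  proof -
    consider "t = 1 - ?x a" | "t = ?x b" | F where "F \<in> slack x" "a \<in> F" "b \<notin> F" "t = real (r F) - sum ?x F"
      using tT by (auto simp: T_def)
    then show ?thesis
    proof cases
      case 1
      then have "a \<notin> fractional y" using ab by (simp add: fractional_def ly)
      then show ?thesis using fsub a by blast
    next
      case 2
      then have "b \<notin> fractional y" using ab by (simp add: fractional_def ly)
      then show ?thesis using fsub b by blast
    next
      case 3
      have "F \<in> \<F>" using 3(1) by (simp add: slack_def)
      then have "F \<notin> slack y" using 3 by (simp add: slack_def sy finite_member)
      then show ?thesis using ssub 3(1) by blast
    qed
  qed
  then have "card (fractional y) + card (slack y) < card (fractional x) + card (slack x)"
  proof
    assume "fractional y \<subset> fractional x"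
    then have "card (fractional y) < card (fractional x)" using finite_fractional by (rule psubset_card_mono[rotated])
    moreover have "card (slack y) \<le> card (slack x)" using finite_slack ssub by (rule card_mono)
    ultimately show ?thesis by simp
  next
    assume "slack y \<subset> slack x"
    then have "card (slack y) < card (slack x)" using finite_slack by (rule psubset_card_mono[rotated])
    moreover have "card (fractional y) \<le> card (fractional x)" using finite_fractional fsub by (rule card_mono)
    ultimately show ?thesis by simp
  qed
  then show ?thesis using yP t0 unfolding y_def by blast
qed

text \<open>By \<open>both_reached\<close> any two caps tight at \<open>x\<close> are complementary
  on the fractional coordinates, so the tight caps divide these into at most two blocks with
  integral sum. A block with one fractional coordinate contains a second.\<close>

lemma pushable_pair:
  assumes x: "x \<in> capped_hypersimplex E k \<F> r" and ne: "fractional x \<noteq> {}"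
  shows "\<exists>a b. a \<in> fractional x \<and> b \<in> fractional x \<and> a \<noteq> b \<and> (\<forall>F\<in>\<F> - slack x. a \<in> F \<longleftrightarrow> b \<in> F)"
proof -
  let ?x = "coord x"
  have bounds: "0 \<le> ?x e \<and> ?x e \<le> 1" if "e \<in> E" for e
    using x that by (simp add: capped_hypersimplex_def)
  have total: "sum ?x E = real k" using x by (simp add: capped_hypersimplex_def)
  have tight: "sum ?x F = real (r F)" if "F \<in> \<F> - slack x" for F
    using x that by (force simp: capped_hypersimplex_def slack_def)
  \<comment> \<open>\<open>A\<close> is \<open>E\<close> if no cap is tight, and otherwise a tight
    cap or its complement, whichever has a fractional coordinate.\<close>
  have "\<exists>A\<subseteq>E. sum ?x A \<in> \<int> \<and> fractional x \<inter> A \<noteq> {} \<and>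
      (\<forall>G\<in>\<F> - slack x. fractional x \<inter> A \<subseteq> G \<or> fractional x \<inter> A \<inter> G = {})"
  proof (cases "\<F> - slack x = {}")
    case True
    then show ?thesis using ne total by (intro exI[of _ E]) (auto simp: fractional_def)
  next
    case False
    then obtain F where F: "F \<in> \<F> - slack x" by blast
    have FE: "F \<subseteq> E" using F family_subset by blast
    have others: "fractional x \<inter> G = fractional x - F" if G: "G \<in> \<F> - slack x" "G \<noteq> F" for G
    proof -
      have FG: "F \<in> \<F>" "G \<in> \<F>" "F \<noteq> G" "sum ?x F \<ge> real (r F)" "sum ?x G \<ge> real (r G)"
        using F G tight[OF F] tight[OF G(1)] by auto
      note reached = both_reached(4,5)[OF FG(1-3) bounds total FG(4,5)]
      show ?thesis
      proof (intro equalityI subsetI)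
        fix e assume e: "e \<in> fractional x \<inter> G"
        then have "?x e \<noteq> 1" by (auto simp: fractional_def)
        then show "e \<in> fractional x - F" using reached(1)[of e] e by auto
      next
        fix e assume e: "e \<in> fractional x - F"
        then have "?x e \<noteq> 0" "e \<in> E" by (auto simp: fractional_def)
        then show "e \<in> fractional x \<inter> G" using reached(2)[of e] e by auto
      qed
    qed
    show ?thesis
    proof (cases "fractional x \<inter> F = {}")
      case False
      have "fractional x \<inter> F \<subseteq> G \<or> fractional x \<inter> F \<inter> G = {}" if "G \<in> \<F> - slack x" for G
        using others[OF that] by blast
      then show ?thesis using False FE tight[OF F] by (intro exI[of _ F]) auto
    next
      case True
      have "sum ?x (E - F) = real k - real (r F)"
        using sum.subset_diff[OF FE finite_ground, of ?x] tight[OF F] total by simp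
      moreover have "fractional x \<inter> (E - F) \<subseteq> G \<or> fractional x \<inter> (E - F) \<inter> G = {}" if "G \<in> \<F> - slack x" for G
        using others[OF that] by blast
      moreover have "fractional x \<inter> (E - F) \<noteq> {}" using True ne by (auto simp: fractional_def)
      ultimately show ?thesis by (intro exI[of _ "E - F"]) auto
    qed
  qed
  then obtain A where A: "A \<subseteq> E" "sum ?x A \<in> \<int>" "fractional x \<inter> A \<noteq> {}"
    "\<And>G. G \<in> \<F> - slack x \<Longrightarrow> fractional x \<inter> A \<subseteq> G \<or> fractional x \<inter> A \<inter> G = {}" by blast
  obtain a where a: "a \<in> A" "a \<in> fractional x" using A(3) by blast
  have "\<exists>b\<in>A. b \<noteq> a \<and> 0 < ?x b \<and> ?x b < 1"
  proof (rule two_fractional)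
    show "finite A" using A(1) finite_ground by (rule finite_subset)
    show "sum ?x A \<in> \<int>" "a \<in> A" "0 < ?x a" "?x a < 1" using A a by (auto simp: fractional_def)
    fix e assume "e \<in> A" "\<not> (0 < ?x e \<and> ?x e < 1)"
    then have "?x e = 0 \<or> ?x e = 1" using bounds[of e] A(1) by force
    then show "?x e \<in> \<int>" by auto
  qed
  then obtain b where b: "b \<in> A" "b \<noteq> a" "b \<in> fractional x" using A(1) by (auto simp: fractional_def)
  have "a \<in> F \<longleftrightarrow> b \<in> F" if "F \<in> \<F> - slack x" for F
    using A(4)[OF that] a b by blast
  then show ?thesis using a b by blast
qed

definition capped_sets :: "'a set set" where
  "capped_sets = {X. X \<subseteq> E \<and> card X = k \<and> (\<forall>F\<in>\<F>. card (X \<inter> F) \<le> r F)}"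

text \<open>A point with a fractional coordinate lies strictly between two pushed points, one for
  each direction of the same pair, and both have a smaller count. A point without one is an
  indicator vector.\<close>

lemma capped_in_hull:
  assumes "x \<in> capped_hypersimplex E k \<F> r"
  shows "x \<in> convex hull (indicator_vec ` capped_sets)"
    (is "_ \<in> ?H")
  using assms
proof (induction "card (fractional x) + card (slack x)" arbitrary: x rule: less_induct)
  case less
  let ?x = "coord x"
  show ?case
  proof (cases "fractional x = {}")
    case True
    define X where "X = {e \<in> E. ?x e = 1}"
    have finX: "finite X" using finite_ground by (simp add: X_def)
    have zero_one: "?x e = (if e \<in> X then 1 else 0)" for e
    proof (cases "e \<in> E")
      case e: True
      have "0 \<le> ?x e \<and> ?x e \<le> 1" using less.prems e by (simp add: capped_hypersimplex_def)
      moreover have "\<not> (0 < ?x e \<and> ?x e < 1)" using True e by (auto simp: fractional_def)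
      ultimately show ?thesis using e by (auto simp: X_def)
    next
      case False
      then have "e \<notin> Poly_Mapping.keys x" using less.prems by (auto simp: capped_hypersimplex_def)
      then show ?thesis using False by (simp add: X_def in_keys_iff)
    qed
    have x: "x = indicator_vec X"
      by (rule poly_mapping_eqI) (simp add: lookup_indicator_vec[OF finX] zero_one)
    have card: "sum ?x A = real (card (X \<inter> A))" if "finite A" for A
      using sum_lookup_indicator_vec[OF finX that] by (simp add: x)
    have "X \<subseteq> E" by (auto simp: X_def)
    moreover have "card X = k"
      using card[OF finite_ground] less.prems \<open>X \<subseteq> E\<close>
      by (simp add: capped_hypersimplex_def Int_absorb2)
    moreover have "card (X \<inter> F) \<le> r F" if "F \<in> \<F>" for F
    proof -
      have "sum ?x F \<le> real (r F)" using less.prems that by (simp add: capped_hypersimplex_def)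
      then show ?thesis unfolding card[OF finite_member[OF that]] by simp
    qed
    ultimately have "X \<in> capped_sets" by (simp add: capped_sets_def)
    then show ?thesis unfolding x by (intro hull_inc imageI)
  next
    case False
    obtain a b where ab: "a \<in> fractional x" "b \<in> fractional x" "a \<noteq> b" "\<And>F. F \<in> \<F> - slack x \<Longrightarrow> a \<in> F \<longleftrightarrow> b \<in> F"
      using pushable_pair[OF less.prems False] by blast
    define d :: "'a \<Rightarrow>\<^sub>0 real" where "d = Poly_Mapping.single a 1 - Poly_Mapping.single b 1"
    obtain t where t: "t > 0" "x + t *\<^sub>R d \<in> capped_hypersimplex E k \<F> r"
      "card (fractional (x + t *\<^sub>R d)) + card (slack (x + t *\<^sub>R d)) < card (fractional x) + card (slack x)"
      using push[OF less.prems ab(1,2,3) ab(4)] unfolding d_def by blast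
    have d': "Poly_Mapping.single b 1 - Poly_Mapping.single a 1 = - d" by (simp add: d_def)
    obtain s where s: "s > 0" "x + s *\<^sub>R (- d) \<in> capped_hypersimplex E k \<F> r"
      "card (fractional (x + s *\<^sub>R (- d))) + card (slack (x + s *\<^sub>R (- d))) < card (fractional x) + card (slack x)"
      using push[OF less.prems ab(2,1) ab(3)[symmetric] ab(4)[symmetric]] unfolding d' by blast
    let ?y = "x + t *\<^sub>R d" and ?z = "x + s *\<^sub>R (- d)"
    have "?y \<in> ?H" "?z \<in> ?H" using less.hyps t s by blast+
    \<comment> \<open>Each end is weighted by the length of the opposite push.\<close>
    moreover have "x = (s / (s + t)) *\<^sub>R ?y + (t / (s + t)) *\<^sub>R ?z"
    proof -
      have "(s / (s + t)) *\<^sub>R ?y + (t / (s + t)) *\<^sub>R ?z =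
          (s / (s + t) + t / (s + t)) *\<^sub>R x + (s / (s + t) * t - t / (s + t) * s) *\<^sub>R d"
        by (simp add: algebra_simps)
      also have "s / (s + t) + t / (s + t) = 1" using s t by (simp add: add_divide_distrib[symmetric])
      also have "s / (s + t) * t - t / (s + t) * s = 0" by simp
      finally show ?thesis by simp
    qed
    moreover have "s / (s + t) + t / (s + t) = 1" using s t by (simp add: add_divide_distrib[symmetric])
    ultimately show ?thesis
      using convexD[OF convex_convex_hull, of ?y _ ?z "s / (s + t)" "t / (s + t)"] s(1) t(1) by simp
  qed
qed

lemma capped_hypersimplex_eq_hull:
  "capped_hypersimplex E k \<F> r =
    convex hull (indicator_vec ` capped_sets)"
proof (intro equalityI subsetI)
  fix x assume "x \<in> capped_hypersimplex E k \<F> r"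
  then show "x \<in> convex hull (indicator_vec ` capped_sets)"
    by (rule capped_in_hull)
next
  have "indicator_vec X \<in> capped_hypersimplex E k \<F> r"
    if X: "X \<subseteq> E" "card X = k" "\<forall>F\<in>\<F>. card (X \<inter> F) \<le> r F" for X
  proof -
    have finX: "finite X" using X(1) finite_ground by (rule finite_subset)
    have "Poly_Mapping.keys (indicator_vec X) \<subseteq> E"
      using X(1) by (auto simp: in_keys_iff lookup_indicator_vec[OF finX] split: if_splits)
    moreover have "sum (coord (indicator_vec X)) E = real k"
      unfolding sum_lookup_indicator_vec[OF finX finite_ground] using X by (simp add: Int_absorb2)
    moreover have "sum (coord (indicator_vec X)) F \<le> real (r F)" if "F \<in> \<F>" for F
      unfolding sum_lookup_indicator_vec[OF finX finite_member[OF that]] using X that by simp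
    ultimately show ?thesis
      by (simp add: capped_hypersimplex_def lookup_indicator_vec[OF finX])
  qed
  then have "convex hull (indicator_vec ` capped_sets)
      \<subseteq> capped_hypersimplex E k \<F> r"
    by (intro hull_minimal convex_capped_hypersimplex) (auto simp: capped_sets_def)
  then show "x \<in> capped_hypersimplex E k \<F> r"
    if "x \<in> convex hull (indicator_vec ` capped_sets)" for x
    using that by blast
qed

end

subsection \<open>Matroids\<close>

context matroid
begin

lemma finite_bases: "finite \<B>"
  using finite_ground bases_subset by (intro finite_subset[of \<B> "Pow E"]) auto

lemma finite_base: "B \<in> \<B> \<Longrightarrow> finite B"
  using finite_ground bases_subset by (meson rev_finite_subset)

lemma bases_card_eq:
  assumes "A \<in> \<B>" "B \<in> \<B>"
  shows "card A = card B"
  using assms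
proof (induction "card (A - B)" arbitrary: A rule: less_induct)
  case less
  show ?case
  proof (cases "A - B = {}")
    case True
    have "B - A = {}"
    proof (rule ccontr)
      assume "B - A \<noteq> {}"
      then obtain x where "x \<in> B - A" by blast
      then show False using exchange[OF less.prems(2,1)] True by blast
    qed
    then show ?thesis using True by (metis Diff_eq_empty_iff subset_antisym)
  next
    case False
    then obtain x where x: "x \<in> A - B" by blast
    then obtain y where y: "y \<in> B - A" "insert y (A - {x}) \<in> \<B>"
      using exchange[OF less.prems x] by blast
    have finA: "finite A" using finite_base less.prems by blast
    have "insert y (A - {x}) - B = (A - B) - {x}" using x y by auto
    then have "card (insert y (A - {x}) - B) < card (A - B)"
      using x finA by (simp add: card_Diff1_less del: card_Diff_insert)
    then have "card (insert y (A - {x})) = card B"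
      using less.hyps y(2) less.prems by blast
    moreover have "card (insert y (A - {x})) = card A"
    proof -
      have "card (insert y (A - {x})) = Suc (card (A - {x}))" using y finA by simp
      also have "\<dots> = card A" using finA x by (intro card_Suc_Diff1) auto
      finally show ?thesis .
    qed
    ultimately show ?thesis by simp
  qed
qed

lemma indep_finite: "indep \<B> I \<Longrightarrow> finite I"
  unfolding indep_def using finite_base finite_subset by blast

lemma indep_subset_ground: "indep \<B> I \<Longrightarrow> I \<subseteq> E"
  unfolding indep_def using bases_subset by blast

lemma indep_mono: "indep \<B> I \<Longrightarrow> J \<subseteq> I \<Longrightarrow> indep \<B> J"
  unfolding indep_def by blast

lemma indep_empty: "indep \<B> {}"
  unfolding indep_def using bases_nonempty by blast

text \<open>Let \<open>A\<close> be a base over \<open>I\<close>, and \<open>B\<close> a base over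
  \<open>J\<close> with the fewest elements outside \<open>J \<union> A\<close>; exchange gives
  \<open>B \<subseteq> J \<union> A\<close>. If \<open>I\<close> had no extension into
  \<open>J\<close>, exchange would also give \<open>A - B \<subseteq> I - J\<close>, while
  \<open>J - I \<subseteq> B - A\<close>, against \<open>card I < card J\<close>.\<close>

lemma indep_augment:
  assumes I: "indep \<B> I" and J: "indep \<B> J" and less: "card I < card J"
  shows "\<exists>e\<in>J - I. indep \<B> (insert e I)"
proof (rule ccontr)
  assume none: "\<not> ?thesis"
  obtain A where A: "A \<in> \<B>" "I \<subseteq> A" using I by (auto simp: indep_def)
  obtain B where B: "B \<in> \<B>" "J \<subseteq> B"
    and min: "\<And>B'. B' \<in> \<B> \<Longrightarrow> J \<subseteq> B' \<Longrightarrow> card (B - (J \<union> A)) \<le> card (B' - (J \<union> A))"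
  proof -
    obtain B0 where "B0 \<in> \<B> \<and> J \<subseteq> B0" using J by (auto simp: indep_def)
    from ex_has_least_nat[of "\<lambda>B. B \<in> \<B> \<and> J \<subseteq> B", OF this, of "\<lambda>B. card (B - (J \<union> A))"] show ?thesis
      using that by blast
  qed
  have fin: "finite A" "finite B" using A B finite_base by blast+
  have AJ: "A \<inter> (J - I) = {}"
  proof (rule ccontr)
    assume "A \<inter> (J - I) \<noteq> {}"
    then obtain e where "e \<in> A" "e \<in> J - I" by blast
    then show False using none A by (auto simp: indep_def)
  qed
  have BJA: "B \<subseteq> J \<union> A"
  proof (rule ccontr)
    assume "\<not> B \<subseteq> J \<union> A"
    then obtain x where x: "x \<in> B" "x \<notin> J" "x \<notin> A" by blast
    then obtain y where y: "y \<in> A - B" "insert y (B - {x}) \<in> \<B>"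
      using exchange[OF B(1) A(1)] by blast
    have "insert y (B - {x}) - (J \<union> A) = (B - (J \<union> A)) - {x}" using y by auto
    then have "card (insert y (B - {x}) - (J \<union> A)) < card (B - (J \<union> A))"
      using x fin by (simp add: card_Diff1_less del: card_Diff_insert)
    moreover have "J \<subseteq> insert y (B - {x})" using B x by blast
    ultimately show False using min[OF y(2)] by simp
  qed
  have "A - B \<subseteq> I"
  proof
    fix x assume x: "x \<in> A - B"
    show "x \<in> I"
    proof (rule ccontr)
      assume "x \<notin> I"
      obtain y where y: "y \<in> B - A" "insert y (A - {x}) \<in> \<B>"
        using exchange[OF A(1) B(1) x] by blast
      have "insert y I \<subseteq> insert y (A - {x})" using A(2) \<open>x \<notin> I\<close> by blast
      then have "indep \<B> (insert y I)" using y(2) by (auto simp: indep_def)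
      moreover have "y \<in> J - I" using y(1) BJA A(2) by blast
      ultimately show False using none by blast
    qed
  qed
  then have "A - B \<subseteq> I - J" using B(2) by blast
  moreover have "finite (I - J)" using indep_finite[OF I] by simp
  ultimately have "card (A - B) \<le> card (I - J)" by (intro card_mono)
  moreover have "J - I \<subseteq> B - A" using AJ B(2) by blast
  then have "card (J - I) \<le> card (B - A)" using fin by (intro card_mono) auto
  moreover have "card (A - B) = card (B - A)"
    using bases_card_eq[OF A(1) B(1)] card_Diff_subset_Int[of A B] card_Diff_subset_Int[of B A] fin
    by (simp add: Int_commute)
  moreover have "card (I - J) < card (J - I)"
    using less indep_finite[OF I] indep_finite[OF J]
    by (metis card_less_sym_Diff)
  ultimately show False by simp
qed

lemma rk_ge_card_indep:
  assumes "indep \<B> I" "I \<subseteq> X"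
  shows "card I \<le> rk \<B> X"
proof -
  obtain B where B: "B \<in> \<B>" "I \<subseteq> B" using assms by (auto simp: indep_def)
  have "card I \<le> card (X \<inter> B)"
    using assms B finite_base[OF B(1)] by (intro card_mono) auto
  also have "\<dots> \<le> rk \<B> X"
    unfolding rk_def using finite_bases B(1) by (intro Max_ge) auto
  finally show ?thesis .
qed

lemma rk_attained:
  obtains I where "indep \<B> I" "I \<subseteq> X" "card I = rk \<B> X"
proof -
  have "rk \<B> X \<in> (\<lambda>B. card (X \<inter> B)) ` \<B>"
    unfolding rk_def using finite_bases bases_nonempty by (intro Max_in) auto
  then obtain B where "B \<in> \<B>" "rk \<B> X = card (X \<inter> B)" by blast
  then show ?thesis using that[of "X \<inter> B"] by (auto simp: indep_def)
qed

lemma rk_mono: "X \<subseteq> Y \<Longrightarrow> rk \<B> X \<le> rk \<B> Y"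
  by (metis rk_attained rk_ge_card_indep subset_trans)

lemma rk_le_card: "finite X \<Longrightarrow> rk \<B> X \<le> card X"
  by (metis rk_attained card_mono)

lemma rk_ground: "B \<in> \<B> \<Longrightarrow> rk \<B> E = card B"
proof -
  assume B: "B \<in> \<B>"
  obtain I where I: "indep \<B> I" "card I = rk \<B> E" by (rule rk_attained)
  then obtain B' where B': "B' \<in> \<B>" "I \<subseteq> B'" by (auto simp: indep_def)
  have "card I \<le> card B'" using B' finite_base by (intro card_mono) auto
  then have "rk \<B> E \<le> card B" using I bases_card_eq[OF B'(1) B] by simp
  moreover have "card B \<le> rk \<B> E"
    using B bases_subset by (intro rk_ge_card_indep) (auto simp: indep_def)
  ultimately show ?thesis by simp
qed

lemma rk_le_rk_ground: "rk \<B> X \<le> rk \<B> E"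
proof -
  obtain I where "indep \<B> I" "card I = rk \<B> X" by (rule rk_attained)
  then show ?thesis using rk_ge_card_indep indep_subset_ground by metis
qed

lemma indep_extend:
  assumes I: "indep \<B> I" "I \<subseteq> X"
  obtains J where "indep \<B> J" "I \<subseteq> J" "J \<subseteq> X" "card J = rk \<B> X"
proof -
  have "\<exists>J. indep \<B> J \<and> I \<subseteq> J \<and> J \<subseteq> X \<and> card J = rk \<B> X"
    using I
  proof (induction "rk \<B> X - card I" arbitrary: I rule: less_induct)
    case less
    show ?case
    proof (cases "card I = rk \<B> X")
      case True
      then show ?thesis using less.prems by blast
    next
      case False
      then have lt: "card I < rk \<B> X" using rk_ge_card_indep[OF less.prems] by simp
      obtain K where K: "indep \<B> K" "K \<subseteq> X" "card K = rk \<B> X" by (rule rk_attained)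
      obtain e where e: "e \<in> K - I" "indep \<B> (insert e I)"
        using indep_augment[OF less.prems(1) K(1)] lt K(3) by auto
      have "card (insert e I) = Suc (card I)"
        using e(1) indep_finite[OF less.prems(1)] by simp
      then have "rk \<B> X - card (insert e I) < rk \<B> X - card I" using lt by simp
      then have "\<exists>J. indep \<B> J \<and> insert e I \<subseteq> J \<and> J \<subseteq> X \<and> card J = rk \<B> X"
        by (rule less.hyps) (use e K(2) less.prems in auto)
      then show ?thesis by blast
    qed
  qed
  then show ?thesis using that by blast
qed

lemma base_iff: "B \<in> \<B> \<longleftrightarrow> indep \<B> B \<and> card B = rk \<B> E"
proof
  assume "B \<in> \<B>"
  then show "indep \<B> B \<and> card B = rk \<B> E" using rk_ground by (auto simp: indep_def)
next
  assume B: "indep \<B> B \<and> card B = rk \<B> E"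
  then obtain A where A: "A \<in> \<B>" "B \<subseteq> A" by (auto simp: indep_def)
  have "B = A" using A B rk_ground[OF A(1)] finite_base[OF A(1)] by (intro card_subset_eq) auto
  then show "B \<in> \<B>" using A by simp
qed

lemma dependent_contains_circuit:
  assumes X: "X \<subseteq> E" "\<not> indep \<B> X"
  obtains C where "circuit E \<B> C" "C \<subseteq> X"
proof -
  have "\<exists>C. (C \<subseteq> X \<and> \<not> indep \<B> C) \<and> (\<forall>D. D \<subseteq> X \<and> \<not> indep \<B> D \<longrightarrow> card C \<le> card D)"
    using X ex_has_least_nat[of "\<lambda>C. C \<subseteq> X \<and> \<not> indep \<B> C" X card] by blast
  then obtain C where C: "C \<subseteq> X" "\<not> indep \<B> C"
    and min: "\<And>D. D \<subseteq> X \<Longrightarrow> \<not> indep \<B> D \<Longrightarrow> card C \<le> card D"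
    by blast
  have finC: "finite C" using C(1) X(1) finite_ground by (meson rev_finite_subset)
  have "indep \<B> D" if "D \<subset> C" for D
  proof (rule ccontr)
    assume "\<not> indep \<B> D"
    then have "card C \<le> card D" using min that C(1) by blast
    then show False using psubset_card_mono[OF finC that] by simp
  qed
  then have "circuit E \<B> C" using C X by (auto simp: circuit_def)
  then show ?thesis using that C by blast
qed

lemma circuit_nonempty: "circuit E \<B> C \<Longrightarrow> C \<noteq> {}"
  using indep_empty by (auto simp: circuit_def)

text \<open>The flat is the closure of the circuit. Each of its elements outside \<open>C\<close>
  closes a circuit with the independent set \<open>C - {x}\<close>, so the closure is again a union
  of circuits.\<close>

lemma cyclic_flat_of_circuit:
  assumes C: "circuit E \<B> C"
  obtains F where "cyclic_flat E \<B> F" "C \<subseteq> F" "Suc (rk \<B> F) = card C"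
proof -
  obtain x where x: "x \<in> C" using circuit_nonempty[OF C] by blast
  define I where "I = C - {x}"
  define F where "F = {e \<in> E. e \<in> I \<or> \<not> indep \<B> (insert e I)}"
  have I: "indep \<B> I" using C x by (auto simp: circuit_def I_def)
  have CE: "C \<subseteq> E" and dep: "\<not> indep \<B> C" using C by (auto simp: circuit_def)
  have xI: "insert x I = C" using x by (auto simp: I_def)
  have CF: "C \<subseteq> F" using CE dep xI by (auto simp: F_def I_def)
  have IF: "I \<subseteq> F" using CF by (auto simp: I_def)
  have finC: "finite C" using CE finite_ground by (rule finite_subset)
  have "rk \<B> F = card I"
  proof -
    obtain J where J: "indep \<B> J" "I \<subseteq> J" "J \<subseteq> F" "card J = rk \<B> F"
      using indep_extend[OF I IF] by blast
    have "J \<subseteq> I"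
    proof
      fix e assume e: "e \<in> J"
      have "indep \<B> (insert e I)" using J(1) by (rule indep_mono) (use J(2) e in blast)
      then show "e \<in> I" using e J(3) by (auto simp: F_def)
    qed
    then show ?thesis using J by (metis subset_antisym)
  qed
  moreover have "Suc (card I) = card C" using x finC by (simp add: I_def card_Suc_Diff1 del: card_Diff_insert)
  moreover have "flat E \<B> F"
    unfolding flat_def
  proof (intro conjI ballI)
    show "F \<subseteq> E" by (auto simp: F_def)
    fix e assume e: "e \<in> E - F"
    then have ind: "indep \<B> (insert e I)" "e \<notin> I" by (auto simp: F_def)
    have "card (insert e I) \<le> rk \<B> (insert e F)"
      using ind(1) by (rule rk_ge_card_indep) (use IF in blast)
    then show "rk \<B> F < rk \<B> (insert e F)"
      using \<open>rk \<B> F = card I\<close> ind(2) indep_finite[OF I] by simp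
  qed
  moreover have "\<exists>\<C>. (\<forall>C\<in>\<C>. circuit E \<B> C) \<and> F = \<Union>\<C>"
  proof -
    have "\<exists>D. circuit E \<B> D \<and> e \<in> D \<and> D \<subseteq> F" if e: "e \<in> F" for e
    proof (cases "e \<in> C")
      case True
      then show ?thesis using C CF by blast
    next
      case False
      then have "e \<notin> I" by (auto simp: I_def)
      then have d: "insert e I \<subseteq> E" "\<not> indep \<B> (insert e I)"
        using e IF by (auto simp: F_def)
      then obtain D where D: "circuit E \<B> D" "D \<subseteq> insert e I"
        using dependent_contains_circuit by blast
      have "e \<in> D"
      proof (rule ccontr)
        assume "e \<notin> D"
        then have "D \<subseteq> I" using D(2) by blast
        then show False using indep_mono[OF I] D(1) by (auto simp: circuit_def)
      qed
      then show ?thesis using D IF e by blast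
    qed
    then have "F = \<Union>{D. circuit E \<B> D \<and> D \<subseteq> F}" by blast
    then show ?thesis by (intro exI[of _ "{D. circuit E \<B> D \<and> D \<subseteq> F}"]) simp
  qed
  ultimately show ?thesis using that CF by (auto simp: cyclic_flat_def)
qed

text \<open>A dependent \<open>X\<close> of full size contains a circuit \<open>C\<close>, and the
  closure of \<open>C\<close>, of rank one less than \<open>card C\<close>, is overfull. It is a
  proper flat, since \<open>card C\<close> is at most \<open>rk \<B> E\<close>.\<close>

lemma bases_by_cyclic_flats:
  "\<B> = {X. X \<subseteq> E \<and> card X = rk \<B> E \<and> (\<forall>F\<in>proper_cyclic_flats E \<B>. card (X \<inter> F) \<le> rk \<B> F)}"
proof (intro equalityI subsetI)
  fix B assume B: "B \<in> \<B>"
  have "card (B \<inter> F) \<le> rk \<B> F" for F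
    using B by (intro rk_ge_card_indep) (auto simp: indep_def)
  then show "B \<in> {X. X \<subseteq> E \<and> card X = rk \<B> E \<and> (\<forall>F\<in>proper_cyclic_flats E \<B>. card (X \<inter> F) \<le> rk \<B> F)}"
    using B bases_subset rk_ground by auto
next
  fix X assume "X \<in> {X. X \<subseteq> E \<and> card X = rk \<B> E \<and> (\<forall>F\<in>proper_cyclic_flats E \<B>. card (X \<inter> F) \<le> rk \<B> F)}"
  then have X: "X \<subseteq> E" "card X = rk \<B> E"
    and cap: "\<And>F. F \<in> proper_cyclic_flats E \<B> \<Longrightarrow> card (X \<inter> F) \<le> rk \<B> F" by auto
  have "indep \<B> X"
  proof (rule ccontr)
    assume "\<not> indep \<B> X"
    then obtain C where C: "circuit E \<B> C" "C \<subseteq> X" using dependent_contains_circuit X(1) by blast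
    obtain F where F: "cyclic_flat E \<B> F" "C \<subseteq> F" "Suc (rk \<B> F) = card C"
      using cyclic_flat_of_circuit[OF C(1)] by blast
    have finX: "finite X" using X(1) finite_ground by (rule finite_subset)
    have "card C \<le> card (X \<inter> F)" using C(2) F(2) finX by (intro card_mono) auto
    moreover have "F \<noteq> E"
    proof
      assume "F = E"
      then have "card X < card C" using F(3) X(2) by simp
      then show False using card_mono[OF finX C(2)] by simp
    qed
    moreover have "F \<noteq> {}" using F(2) circuit_nonempty[OF C(1)] by blast
    ultimately show False using cap[of F] F by (simp add: proper_cyclic_flats_def)
  qed
  then show "X \<in> \<B>" using X base_iff by blast
qed

lemma rk_proper_flat:
  assumes "flat E \<B> F" "F \<noteq> E"
  shows "rk \<B> F < rk \<B> E"
proof -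
  obtain e where e: "e \<in> E - F" using assms by (auto simp: flat_def)
  then have "rk \<B> F < rk \<B> (insert e F)" using assms by (auto simp: flat_def)
  also have "\<dots> \<le> rk \<B> E" by (rule rk_le_rk_ground)
  finally show ?thesis .
qed

lemma Suc_rk_circuit:
  assumes C: "circuit E \<B> C"
  shows "Suc (rk \<B> C) = card C"
proof -
  obtain x where x: "x \<in> C" using circuit_nonempty[OF C] by blast
  have finC: "finite C" using C finite_ground by (auto simp: circuit_def intro: finite_subset)
  have "indep \<B> (C - {x})" using C x by (auto simp: circuit_def)
  then have "card (C - {x}) \<le> rk \<B> C" by (rule rk_ge_card_indep) blast
  moreover have "rk \<B> C \<noteq> card C"
  proof
    assume eq: "rk \<B> C = card C"
    obtain I where I: "indep \<B> I" "I \<subseteq> C" "card I = rk \<B> C" by (rule rk_attained)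
    then have "I = C" using eq finC by (intro card_subset_eq) auto
    then show False using I C by (auto simp: circuit_def)
  qed
  moreover have "rk \<B> C \<le> card C" using finC by (rule rk_le_card)
  moreover have "card (C - {x}) = card C - 1" using x finC by simp
  ultimately show ?thesis by linarith
qed

end

subsection \<open>Elementary split matroids\<close>

locale elementary_split_matroid = matroid +
  fixes q :: nat and H :: "nat \<Rightarrow> 'a set" and s :: "nat \<Rightarrow> nat"
  assumes H_subset: "i \<in> {1..q} \<Longrightarrow> H i \<subseteq> E"
    and H_overlap: "i \<in> {1..q} \<Longrightarrow> j \<in> {1..q} \<Longrightarrow> i \<noteq> j \<Longrightarrow> card (H i \<inter> H j) + rk \<B> E \<le> s i + s j"
    and H_cocard: "i \<in> {1..q} \<Longrightarrow> rk \<B> E \<le> card (E - H i) + s i"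
    and bases_eq: "\<B> = {X. X \<subseteq> E \<and> card X = rk \<B> E \<and> (\<forall>i\<in>{1..q}. card (X \<inter> H i) \<le> s i)}"
begin

lemma extend_feasible:
  assumes X: "X \<subseteq> E" "card X < rk \<B> E" "\<And>i. i \<in> {1..q} \<Longrightarrow> card (X \<inter> H i) \<le> s i"
    and e: "e \<in> E - X" and i: "\<And>i. i \<in> {1..q} \<Longrightarrow> card (X \<inter> H i) = s i \<Longrightarrow> e \<notin> H i"
    and j: "j \<in> {1..q}"
  shows "card (insert e X \<inter> H j) \<le> s j"
proof (cases "e \<in> H j")
  case True
  then have "card (X \<inter> H j) < s j" using i[OF j] X(3)[OF j] by fastforce
  moreover have "finite X" using X(1) finite_ground by (rule finite_subset)
  ultimately show ?thesis using True e by simp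
next
  case False
  then show ?thesis using X(3)[OF j] by simp
qed

text \<open>Two tight caps would give \<open>s i + s j\<close> \<le>
  \<open>card X + card (H i \<inter> H j)\<close>, and \<open>H_overlap\<close> turns this into
  \<open>rk \<B> E\<close> \<le> \<open>card X\<close>.\<close>

lemma tight_unique:
  assumes X: "X \<subseteq> E" "card X < rk \<B> E" and i: "i \<in> {1..q}" "card (X \<inter> H i) = s i"
    and j: "j \<in> {1..q}" "card (X \<inter> H j) = s j"
  shows "i = j"
proof (rule ccontr)
  assume ne: "i \<noteq> j"
  have finX: "finite X" using X(1) finite_ground by (rule finite_subset)
  have "card (X \<inter> H i) + card (X \<inter> H j) = card ((X \<inter> H i) \<union> (X \<inter> H j)) + card ((X \<inter> H i) \<inter> (X \<inter> H j))"
    using finX by (intro card_Un_Int) auto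
  also have "card ((X \<inter> H i) \<union> (X \<inter> H j)) \<le> card X" using finX by (intro card_mono) auto
  also have "card ((X \<inter> H i) \<inter> (X \<inter> H j)) \<le> card (H i \<inter> H j)"
    using H_subset[OF i(1)] finite_ground by (intro card_mono) (auto intro: finite_subset)
  finally have "s i + s j \<le> card X + card (H i \<inter> H j)" using i(2) j(2) by simp
  then show False using H_overlap[OF i(1) j(1) ne] X(2) by simp
qed

text \<open>A feasible set below full size has at most one tight cap, and \<open>H_cocard\<close>
  provides a new element outside that cap; so the set grows to a base.\<close>

lemma indep_iff:
  assumes X: "X \<subseteq> E"
  shows "indep \<B> X \<longleftrightarrow> card X \<le> rk \<B> E \<and> (\<forall>i\<in>{1..q}. card (X \<inter> H i) \<le> s i)"
proof
  assume "indep \<B> X"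
  then obtain B where B: "B \<in> \<B>" "X \<subseteq> B" by (auto simp: indep_def)
  have finB: "finite B" using finite_base[OF B(1)] .
  have "card (X \<inter> H i) \<le> card (B \<inter> H i)" for i using B(2) finB by (intro card_mono) auto
  moreover have "card (B \<inter> H i) \<le> s i" if "i \<in> {1..q}" for i
  proof -
    have "B \<in> {X. X \<subseteq> E \<and> card X = rk \<B> E \<and> (\<forall>i\<in>{1..q}. card (X \<inter> H i) \<le> s i)}"
      using B(1) bases_eq by blast
    then show ?thesis using that by blast
  qed
  moreover have "card X \<le> rk \<B> E" using card_mono[OF finB B(2)] rk_ground[OF B(1)] by simp
  ultimately show "card X \<le> rk \<B> E \<and> (\<forall>i\<in>{1..q}. card (X \<inter> H i) \<le> s i)"
    using le_trans by blast
next
  assume "card X \<le> rk \<B> E \<and> (\<forall>i\<in>{1..q}. card (X \<inter> H i) \<le> s i)"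
  then show "indep \<B> X" using X
  proof (induction "rk \<B> E - card X" arbitrary: X rule: less_induct)
    case less
    have finX: "finite X" using less.prems(2) finite_ground by (rule finite_subset)
    show ?case
    proof (cases "card X = rk \<B> E")
      case True
      then have "X \<in> \<B>" by (subst bases_eq) (use less.prems in blast)
      then show ?thesis by (auto simp: indep_def)
    next
      case False
      then have lt: "card X < rk \<B> E" using less.prems by simp
      have "\<exists>e\<in>E - X. \<forall>i\<in>{1..q}. card (X \<inter> H i) = s i \<longrightarrow> e \<notin> H i"
      proof (cases "\<exists>i\<in>{1..q}. card (X \<inter> H i) = s i")
        case True
        then obtain i where i: "i \<in> {1..q}" "card (X \<inter> H i) = s i" by blast
        \<comment> \<open>Otherwise \<open>card X\<close> would be at least
          \<open>s i + card (E - H i)\<close>, hence full.\<close>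
        have "\<not> E - H i \<subseteq> X - H i"
        proof
          assume "E - H i \<subseteq> X - H i"
          then have "card (E - H i) \<le> card (X - H i)" using finX by (intro card_mono) auto
          moreover have "card X = card (X \<inter> H i) + card (X - H i)"
            using finX by (metis card_Int_Diff)
          ultimately show False using H_cocard[OF i(1)] lt i(2) by simp
        qed
        then obtain e where "e \<in> E - X" "e \<notin> H i" by blast
        then show ?thesis using tight_unique[OF less.prems(2) lt i] by blast
      next
        case False
        obtain B where B: "B \<in> \<B>" using bases_nonempty by blast
        have "\<not> E \<subseteq> X"
        proof
          assume "E \<subseteq> X"
          then have "card B \<le> card X" using bases_subset[OF B] finX by (intro card_mono) auto
          then show False using rk_ground[OF B] lt by simp
        qed
        then show ?thesis using False by blast
      qed
      then obtain e where e: "e \<in> E - X" "\<And>i. i \<in> {1..q} \<Longrightarrow> card (X \<inter> H i) = s i \<Longrightarrow> e \<notin> H i"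
        by blast
      have c: "card (insert e X) = Suc (card X)" using e(1) finX by simp
      have "indep \<B> (insert e X)"
      proof (rule less.hyps)
        show "rk \<B> E - card (insert e X) < rk \<B> E - card X" using c lt by simp
        have "card (insert e X \<inter> H i) \<le> s i" if "i \<in> {1..q}" for i
          by (rule extend_feasible[OF less.prems(2) lt _ e that]) (use less.prems(1) in blast)+
        then show "card (insert e X) \<le> rk \<B> E \<and> (\<forall>i\<in>{1..q}. card (insert e X \<inter> H i) \<le> s i)"
          using c lt by simp
        show "insert e X \<subseteq> E" using e less.prems by blast
      qed
      then show ?thesis using indep_mono by blast
    qed
  qed
qed

text \<open>By \<open>tight_unique\<close> a single cap can block a new element, and
  \<open>e\<close> avoids it.\<close>

lemma indep_insert:
  assumes Y: "indep \<B> Y" "card Y < rk \<B> E" and i: "i \<in> {1..q}" "card (Y \<inter> H i) = s i"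
    and e: "e \<in> E - Y" "e \<notin> H i"
  shows "indep \<B> (insert e Y)"
proof -
  have YE: "Y \<subseteq> E" using indep_subset_ground[OF Y(1)] .
  have feas: "card (Y \<inter> H j) \<le> s j" if "j \<in> {1..q}" for j
    using Y(1) indep_iff[OF YE] that by blast
  have "e \<notin> H j" if "j \<in> {1..q}" "card (Y \<inter> H j) = s j" for j
    using tight_unique[OF YE Y(2) i that] e(2) by blast
  then have "card (insert e Y \<inter> H j) \<le> s j" if "j \<in> {1..q}" for j
    using extend_feasible[OF YE Y(2) feas e(1) _ that] by blast
  moreover have "card (insert e Y) = Suc (card Y)" using e(1) indep_finite[OF Y(1)] by simp
  ultimately show ?thesis using indep_iff[of "insert e Y"] YE e(1) Y(2) by auto
qed

text \<open>Too small to break the rank bound, the circuit breaks a cap. Its part inside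
  \<open>H i\<close> is already dependent, so minimality puts all of it there and allows an excess
  of only 1.\<close>

lemma small_circuit:
  assumes C: "circuit E \<B> C" and "card C \<le> rk \<B> E"
  obtains i where "i \<in> {1..q}" "C \<subseteq> H i" "card C = Suc (s i)"
proof -
  have CE: "C \<subseteq> E" and dep: "\<not> indep \<B> C" using C by (auto simp: circuit_def)
  have finC: "finite C" using CE finite_ground by (rule finite_subset)
  obtain i where i: "i \<in> {1..q}" "s i < card (C \<inter> H i)"
    using dep indep_iff[OF CE] assms(2) by (meson not_le)
  have "\<not> indep \<B> (C \<inter> H i)"
    using indep_iff[of "C \<inter> H i"] CE i by (metis Int_assoc Int_absorb inf.coboundedI1 not_le)
  then have CH: "C \<inter> H i = C" using C by (auto simp: circuit_def)
  obtain x where x: "x \<in> C" using circuit_nonempty[OF C] by blast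
  have "indep \<B> (C - {x})" using C x by (auto simp: circuit_def)
  moreover have "C - {x} \<subseteq> E" using CE by blast
  ultimately have "card ((C - {x}) \<inter> H i) \<le> s i" using indep_iff i(1) by blast
  moreover have "(C - {x}) \<inter> H i = C - {x}" using CH by blast
  ultimately have "card C \<le> Suc (s i)" using x finC by simp
  then show ?thesis using that[of i] i CH by auto
qed

text \<open>A proper cyclic flat contains some \<open>H i\<close>, and any further element of it would be a
  coloop of the restriction to that flat, so there is none.\<close>

lemma proper_cyclic_flat_is_cap:
  assumes F: "F \<in> proper_cyclic_flats E \<B>"
  obtains i where "i \<in> {1..q}" "F = H i" "rk \<B> F = s i" "s i < card F"
proof -
  have flat: "flat E \<B> F" and ne: "F \<noteq> {}" "F \<noteq> E"
    and cyc: "\<exists>\<C>. (\<forall>C\<in>\<C>. circuit E \<B> C) \<and> F = \<Union>\<C>"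
    using F by (auto simp: proper_cyclic_flats_def cyclic_flat_def)
  have FE: "F \<subseteq> E" using flat by (simp add: flat_def)
  have finF: "finite F" using FE finite_ground by (rule finite_subset)
  have rkF: "rk \<B> F < rk \<B> E" using flat ne(2) by (rule rk_proper_flat)
  have circ: "\<exists>C. circuit E \<B> C \<and> e \<in> C \<and> C \<subseteq> F" if "e \<in> F" for e
    using cyc that by blast
  have small: "card C \<le> rk \<B> E" if "circuit E \<B> C" "C \<subseteq> F" for C
    using Suc_rk_circuit[OF that(1)] rk_mono[OF that(2)] rkF by simp
  obtain e0 where "e0 \<in> F" using ne(1) by blast
  then obtain C where C: "circuit E \<B> C" "C \<subseteq> F" using circ by blast
  obtain i where i: "i \<in> {1..q}" "C \<subseteq> H i" "card C = Suc (s i)"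
    using small_circuit[OF C(1) small[OF C]] by blast
  obtain x where x: "x \<in> C" using circuit_nonempty[OF C(1)] by blast
  have finC: "finite C" using C(2) finF by (rule finite_subset)
  define I where "I = C - {x}"
  have I: "indep \<B> I" "card I = s i" "I \<subseteq> F" "I \<subseteq> H i"
    using C x i finC by (auto simp: I_def circuit_def)
  \<comment> \<open>A maximal independent subset of \<open>F\<close> that fills \<open>H i\<close>
    to capacity: further elements of \<open>H i\<close> are blocked, further elements off
    \<open>H i\<close> are free.\<close>
  obtain Y where Y: "indep \<B> Y" "I \<subseteq> Y" "Y \<subseteq> F" "card Y = rk \<B> F"
    using indep_extend[OF I(1,3)] by blast
  have YE: "Y \<subseteq> E" using Y(3) FE by blast
  have finY: "finite Y" using indep_finite[OF Y(1)] .
  have caps: "card (Z \<inter> H i) \<le> s i" if "indep \<B> Z" for Z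
    using that indep_iff indep_subset_ground i(1) by blast
  have "card I \<le> card (Y \<inter> H i)" using Y(2) I(4) finY by (intro card_mono) auto
  then have tight: "card (Y \<inter> H i) = s i" using caps[OF Y(1)] I(2) by simp
  \<comment> \<open>As \<open>Y\<close> is full in \<open>H i\<close>, an element of
    \<open>H i\<close> cannot raise the rank of \<open>F\<close>, and \<open>F\<close> is a
    flat.\<close>
  have HF: "H i \<subseteq> F"
  proof
    fix e assume e: "e \<in> H i"
    show "e \<in> F"
    proof (rule ccontr)
      assume "e \<notin> F"
      then have "rk \<B> F < rk \<B> (insert e F)" using flat e H_subset[OF i(1)] by (auto simp: flat_def)
      moreover obtain K where K: "indep \<B> K" "Y \<subseteq> K" "K \<subseteq> insert e F" "card K = rk \<B> (insert e F)"
        using indep_extend[OF Y(1), of "insert e F"] Y(3) by blast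
      ultimately have "\<not> K \<subseteq> F" using rk_ge_card_indep[OF K(1), of F] by auto
      then have "insert e Y \<subseteq> K" using K(2,3) by blast
      then have "card (insert e Y \<inter> H i) \<le> s i" using caps indep_mono[OF K(1)] by blast
      moreover have "e \<notin> Y" using Y(3) \<open>e \<notin> F\<close> by blast
      ultimately show False using e tight finY by simp
    qed
  qed
  have FHY: "F - H i \<subseteq> Y"
  proof
    fix e assume e: "e \<in> F - H i"
    show "e \<in> Y"
    proof (rule ccontr)
      assume "e \<notin> Y"
      have "indep \<B> (insert e Y)"
        by (rule indep_insert[OF Y(1) _ i(1) tight]) (use Y(4) rkF e \<open>e \<notin> Y\<close> FE in auto)
      then have "card (insert e Y) \<le> rk \<B> F" using e Y(3) by (intro rk_ge_card_indep) auto
      then show False using \<open>e \<notin> Y\<close> finY Y(4) by simp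
    qed
  qed
  have FH: "F \<subseteq> H i"
  proof
    fix e assume e: "e \<in> F"
    show "e \<in> H i"
    proof (rule ccontr)
      assume eH: "e \<notin> H i"
      obtain D where D: "circuit E \<B> D" "e \<in> D" "D \<subseteq> F" using circ[OF e] by blast
      have "indep \<B> (D - {e})" using D by (auto simp: circuit_def)
      moreover have "D - {e} \<subseteq> F" using D(3) by blast
      \<comment> \<open>A maximal independent subset of \<open>F\<close> without \<open>e\<close>.
        Off \<open>H i\<close> it is smaller than \<open>Y\<close>, and inside \<open>H i\<close> it
        cannot make up for this because \<open>Y\<close> is already full there.\<close>
      ultimately obtain Z where Z: "indep \<B> Z" "D - {e} \<subseteq> Z" "Z \<subseteq> F" "card Z = rk \<B> F"
        using indep_extend by blast
      have finZ: "finite Z" using indep_finite[OF Z(1)] .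
      have "e \<notin> Z"
      proof
        assume "e \<in> Z"
        then have "D \<subseteq> Z" using Z(2) by blast
        then show False using indep_mono[OF Z(1)] D(1) by (auto simp: circuit_def)
      qed
      then have "Z - H i \<subset> Y - H i" using FHY Z(3) e eH by blast
      then have "card (Z - H i) < card (Y - H i)" using finY by (intro psubset_card_mono) auto
      moreover have "card Z = card (Z \<inter> H i) + card (Z - H i)" using finZ by (metis card_Int_Diff)
      moreover have "card Y = card (Y \<inter> H i) + card (Y - H i)" using finY by (metis card_Int_Diff)
      ultimately show False using caps[OF Z(1)] tight Z(4) Y(4) by simp
    qed
  qed
  have eq: "F = H i" using FH HF by blast
  have "Y \<inter> H i = Y" using Y(3) eq by blast
  then have "rk \<B> F = s i" using Y(4) tight by simp
  moreover have "s i < card F"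
    using card_mono[OF finF C(2)] i(3) by simp
  ultimately show ?thesis using that i(1) eq by blast
qed

lemma proper_cyclic_flats_overlap:
  assumes "F \<in> proper_cyclic_flats E \<B>" "G \<in> proper_cyclic_flats E \<B>" "F \<noteq> G"
  shows "card (F \<inter> G) + rk \<B> E \<le> rk \<B> F + rk \<B> G"
  using assms H_overlap proper_cyclic_flat_is_cap by metis

lemma rk_less_card_proper_cyclic_flat:
  assumes "F \<in> proper_cyclic_flats E \<B>"
  shows "rk \<B> F < card F"
  using proper_cyclic_flat_is_cap[OF assms] by metis

text \<open>Forwards, the intersection has rank at most its size and the union at most
  \<open>rk \<B> E\<close>, which squeezes the overlap inequality to an equality. Backwards,
  equality makes the intersection independent and the union spanning.\<close>

lemma modular_iff:
  assumes F: "F \<in> proper_cyclic_flats E \<B>" and G: "G \<in> proper_cyclic_flats E \<B>" and ne: "F \<noteq> G"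
  shows "rk \<B> F + rk \<B> G = rk \<B> (F \<inter> G) + rk \<B> (F \<union> G) \<longleftrightarrow>
    card (F \<inter> G) + rk \<B> E = rk \<B> F + rk \<B> G"
    and "card (F \<inter> G) + rk \<B> E = rk \<B> F + rk \<B> G \<Longrightarrow> rk \<B> (F \<inter> G) = card (F \<inter> G)"
proof -
  have FE: "F \<subseteq> E" "G \<subseteq> E"
    using F G by (auto simp: proper_cyclic_flats_def cyclic_flat_def flat_def)
  have fin: "finite F" "finite G" using FE finite_ground by (auto intro: finite_subset)
  have rkF: "rk \<B> F < rk \<B> E" "rk \<B> G < rk \<B> E"
    using F G rk_proper_flat by (auto simp: proper_cyclic_flats_def cyclic_flat_def)
  obtain i where i: "i \<in> {1..q}" "F = H i" "rk \<B> F = s i" "s i < card F"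
    using proper_cyclic_flat_is_cap[OF F] by blast
  obtain j where j: "j \<in> {1..q}" "G = H j" "rk \<B> G = s j" "s j < card G"
    using proper_cyclic_flat_is_cap[OF G] by blast
  have int: "rk \<B> (F \<inter> G) = card (F \<inter> G)" if eq: "card (F \<inter> G) + rk \<B> E = rk \<B> F + rk \<B> G"
  proof -
    have FGE: "F \<inter> G \<subseteq> E" using FE by blast
    have "card (F \<inter> G \<inter> H l) \<le> s l" if l: "l \<in> {1..q}" for l
    proof (cases "l = i")
      case True
      then have "F \<inter> G \<inter> H l = F \<inter> G" using i by blast
      then show ?thesis using eq rkF i True by simp
    next
      case False
      have "card (F \<inter> G \<inter> H l) \<le> card (H i \<inter> H l)" using fin i by (intro card_mono) auto
      then show ?thesis using H_overlap[OF i(1) l] False rkF i by simp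
    qed
    moreover have "card (F \<inter> G) \<le> rk \<B> E" using eq rkF by simp
    ultimately have "indep \<B> (F \<inter> G)" using indep_iff[OF FGE] by blast
    then have "card (F \<inter> G) \<le> rk \<B> (F \<inter> G)" by (rule rk_ge_card_indep) simp
    moreover have "rk \<B> (F \<inter> G) \<le> card (F \<inter> G)" using fin by (intro rk_le_card) simp
    ultimately show ?thesis by simp
  qed
  show "rk \<B> (F \<inter> G) = card (F \<inter> G)" if "card (F \<inter> G) + rk \<B> E = rk \<B> F + rk \<B> G"
    using int[OF that] .
  show "rk \<B> F + rk \<B> G = rk \<B> (F \<inter> G) + rk \<B> (F \<union> G) \<longleftrightarrow>
    card (F \<inter> G) + rk \<B> E = rk \<B> F + rk \<B> G"
  proof
    assume m: "rk \<B> F + rk \<B> G = rk \<B> (F \<inter> G) + rk \<B> (F \<union> G)"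
    have "rk \<B> (F \<inter> G) \<le> card (F \<inter> G)" using fin by (intro rk_le_card) simp
    then show "card (F \<inter> G) + rk \<B> E = rk \<B> F + rk \<B> G"
      using m rk_le_rk_ground[of "F \<union> G"] proper_cyclic_flats_overlap[OF F G ne] by simp
  next
    assume eq: "card (F \<inter> G) + rk \<B> E = rk \<B> F + rk \<B> G"
    obtain I where I: "indep \<B> I" "I \<subseteq> F" "card I = rk \<B> F" by (rule rk_attained)
    obtain Y where Y: "indep \<B> Y" "I \<subseteq> Y" "Y \<subseteq> F \<union> G" "card Y = rk \<B> (F \<union> G)"
      using indep_extend[OF I(1), of "F \<union> G"] I(2) by blast
    have YE: "Y \<subseteq> E" using Y(3) FE by blast
    have finY: "finite Y" using indep_finite[OF Y(1)] .
    have feas: "card (Y \<inter> H l) \<le> s l" if "l \<in> {1..q}" for l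
      using Y(1) indep_iff[OF YE] that by blast
    have "card I \<le> card (Y \<inter> H i)" using Y(2) I(2) i(2) finY by (intro card_mono) auto
    then have tight: "card (Y \<inter> H i) = s i" using feas[OF i(1)] I(3) i(3) by simp
    have "card Y = rk \<B> E"
    proof (rule ccontr)
      assume "card Y \<noteq> rk \<B> E"
      then have lt: "card Y < rk \<B> E" using Y(4) rk_le_rk_ground[of "F \<union> G"] by simp
      have GY: "G - F \<subseteq> Y"
      proof
        fix e assume e: "e \<in> G - F"
        show "e \<in> Y"
        proof (rule ccontr)
          assume "e \<notin> Y"
          have "indep \<B> (insert e Y)"
            by (rule indep_insert[OF Y(1) lt i(1) tight]) (use e i(2) \<open>e \<notin> Y\<close> FE in auto)
          then have "card (insert e Y) \<le> rk \<B> (F \<union> G)"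
            using e Y(3) by (intro rk_ge_card_indep) auto
          then show False using \<open>e \<notin> Y\<close> finY Y(4) by simp
        qed
      qed
      \<comment> \<open>Now \<open>Y\<close> has at least \<open>rk \<B> F + card (G - F)\<close>
        elements, which exceeds \<open>rk \<B> E\<close> because \<open>card G\<close> exceeds
        \<open>rk \<B> G\<close>.\<close>
      have "card (G - F) \<le> card (Y - H i)"
        using GY i(2) finY by (intro card_mono) auto
      moreover have "card Y = card (Y \<inter> H i) + card (Y - H i)" using finY by (metis card_Int_Diff)
      moreover have "card G = card (F \<inter> G) + card (G - F)"
        using fin by (metis Int_commute card_Int_Diff)
      ultimately show False using eq lt tight i(3) j by simp
    qed
    then show "rk \<B> F + rk \<B> G = rk \<B> (F \<inter> G) + rk \<B> (F \<union> G)" using eq int[OF eq] Y(4) by simp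
  qed
qed

end

section \<open>Direct sums, uniform matroids and connectedness\<close>

lemma matroid_sum:
  assumes "matroid E1 \<B>1" "matroid E2 \<B>2" and disj: "E1 \<inter> E2 = {}"
  shows "matroid (E1 \<union> E2) (sum_bases \<B>1 \<B>2)"
proof -
  interpret M1: matroid E1 \<B>1 by fact
  interpret M2: matroid E2 \<B>2 by fact
  show ?thesis
  proof
    show "finite (E1 \<union> E2)" using M1.finite_ground M2.finite_ground by simp
    show "sum_bases \<B>1 \<B>2 \<noteq> {}"
      using M1.bases_nonempty M2.bases_nonempty by (auto simp: sum_bases_def)
    show "B \<subseteq> E1 \<union> E2" if "B \<in> sum_bases \<B>1 \<B>2" for B
      using that M1.bases_subset M2.bases_subset by (fastforce simp: sum_bases_def)
    fix A B x assume A: "A \<in> sum_bases \<B>1 \<B>2" and B: "B \<in> sum_bases \<B>1 \<B>2" and x: "x \<in> A - B"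
    obtain A1 A2 where A12: "A = A1 \<union> A2" "A1 \<in> \<B>1" "A2 \<in> \<B>2" using A by (auto simp: sum_bases_def)
    obtain B1 B2 where B12: "B = B1 \<union> B2" "B1 \<in> \<B>1" "B2 \<in> \<B>2" using B by (auto simp: sum_bases_def)
    have sub: "A1 \<subseteq> E1" "B1 \<subseteq> E1" "A2 \<subseteq> E2" "B2 \<subseteq> E2"
      using A12 B12 M1.bases_subset M2.bases_subset by blast+
    show "\<exists>y\<in>B - A. insert y (A - {x}) \<in> sum_bases \<B>1 \<B>2"
    proof (cases "x \<in> A1")
      case True
      then have "x \<in> A1 - B1" using x B12 by blast
      then obtain y where y: "y \<in> B1 - A1" "insert y (A1 - {x}) \<in> \<B>1"
        using M1.exchange[OF A12(2) B12(2)] by blast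
      have "insert y (A - {x}) = insert y (A1 - {x}) \<union> A2"
        using True sub disj A12(1) by blast
      then have "insert y (A - {x}) \<in> sum_bases \<B>1 \<B>2"
        using y(2) A12(3) unfolding sum_bases_def by blast
      moreover have "y \<in> B - A" using y sub disj A12(1) B12(1) by blast
      ultimately show ?thesis by blast
    next
      case False
      then have "x \<in> A2 - B2" using x A12 B12 by blast
      then obtain y where y: "y \<in> B2 - A2" "insert y (A2 - {x}) \<in> \<B>2"
        using M2.exchange[OF A12(3) B12(3)] by blast
      have "insert y (A - {x}) = A1 \<union> insert y (A2 - {x})"
        using False A12(1) by blast
      then have "insert y (A - {x}) \<in> sum_bases \<B>1 \<B>2"
        using y(2) A12(2) unfolding sum_bases_def by blast
      moreover have "y \<in> B - A" using y sub disj A12(1) B12(1) by blast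
      ultimately show ?thesis by blast
    qed
  qed
qed

lemma matroid_uniform:
  assumes fin: "finite U" and k: "k \<le> card U"
  shows "matroid U (uniform_bases k U)"
proof
  show "finite U" by fact
  show "uniform_bases k U \<noteq> {}"
    using obtain_subset_with_card_n[OF k] by (auto simp: uniform_bases_def)
  show "B \<subseteq> U" if "B \<in> uniform_bases k U" for B using that by (simp add: uniform_bases_def)
  fix A B x assume A: "A \<in> uniform_bases k U" and B: "B \<in> uniform_bases k U" and x: "x \<in> A - B"
  have AU: "A \<subseteq> U" "card A = k" and BU: "B \<subseteq> U" "card B = k"
    using A B by (auto simp: uniform_bases_def)
  have finA: "finite A" and finB: "finite B" using AU BU fin by (auto intro: finite_subset)
  have "\<not> B \<subseteq> A"
  proof
    assume "B \<subseteq> A"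
    then have "B = A" using finA AU(2) BU(2) by (intro card_subset_eq) auto
    then show False using x by blast
  qed
  then obtain y where y: "y \<in> B" "y \<notin> A" by blast
  have "card (insert y (A - {x})) = Suc (card (A - {x}))" using y finA by simp
  also have "\<dots> = card A" using finA x by (intro card_Suc_Diff1) auto
  finally have "insert y (A - {x}) \<in> uniform_bases k U"
    using AU BU y by (auto simp: uniform_bases_def)
  then show "\<exists>y\<in>B - A. insert y (A - {x}) \<in> uniform_bases k U" using y by blast
qed

lemma elementary_split_uniform:
  assumes "finite U" "k \<le> card U"
  shows "elementary_split U (uniform_bases k U)"
proof -
  interpret matroid U "uniform_bases k U" using assms by (rule matroid_uniform)
  obtain B where B: "B \<in> uniform_bases k U" using bases_nonempty by blast
  have "rk (uniform_bases k U) U = k"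
    using rk_ground[OF B] B by (simp add: uniform_bases_def)
  then show ?thesis
    unfolding elementary_split_def using matroid_axioms
    by (intro conjI exI[of _ "0::nat"]) (auto simp: uniform_bases_def)
qed

lemma matroid_split: "split_matroid E \<B> \<Longrightarrow> matroid E \<B>"
proof (induction rule: split_matroid.induct)
  case (elementary E \<B>)
  then show ?case by (simp add: elementary_split_def)
next
  case (sum_uniform E \<B> U k)
  then show ?case by (intro matroid_sum matroid_uniform)
qed

text \<open>Connectedness leaves no direct sum with two nonempty summands. If one is empty, the sum
  either changes nothing or is a uniform matroid, which is elementary split with no caps.\<close>

lemma connected_split_is_elementary:
  assumes "split_matroid E \<B>" "connected_matroid E \<B>"
  shows "elementary_split E \<B>"
  using assms
proof (induction rule: split_matroid.induct)
  case (sum_uniform E \<B> U k)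
  have M: "matroid E \<B>" using sum_uniform.hyps(1) by (rule matroid_split)
  have MU: "matroid U (uniform_bases k U)" using sum_uniform.hyps(2,3) by (rule matroid_uniform)
  consider "U = {}" | "E = {}" | "E \<noteq> {}" "U \<noteq> {}" by blast
  then show ?case
  proof cases
    case 1
    then have "uniform_bases k U = {{}}"
      using sum_uniform.hyps(3) by (auto simp: uniform_bases_def)
    then have "E \<union> U = E" "sum_bases \<B> (uniform_bases k U) = \<B>"
      using 1 by (auto simp: sum_bases_def)
    then show ?thesis using sum_uniform.IH sum_uniform.prems by simp
  next
    case 2
    have "B = {}" if "B \<in> \<B>" for B using matroid.bases_subset[OF M that] 2 by blast
    then have "\<B> = {{}}" using matroid.bases_nonempty[OF M] by blast
    then have "E \<union> U = U" "sum_bases \<B> (uniform_bases k U) = uniform_bases k U"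
      using 2 by (auto simp: sum_bases_def)
    then show ?thesis using elementary_split_uniform[OF sum_uniform.hyps(2,3)] by simp
  next
    case 3
    then show ?thesis
      using sum_uniform.prems M MU sum_uniform.hyps(4) unfolding connected_matroid_def by blast
  qed
qed

text \<open>A loop splits off as a uniform summand of rank 0. The condition
  \<open>E \<noteq> {e}\<close> keeps the other summand nonempty; a single loop is
  connected.\<close>

lemma connected_no_loop:
  assumes conn: "connected_matroid E \<B>" and e: "e \<in> E" "E \<noteq> {e}"
  shows "\<exists>B\<in>\<B>. e \<in> B"
proof (rule ccontr)
  assume loop: "\<not> (\<exists>B\<in>\<B>. e \<in> B)"
  have M: "matroid E \<B>" using conn by (simp add: connected_matroid_def)
  interpret matroid E \<B> by (rule M)
  have "matroid (E - {e}) \<B>"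
    using finite_ground bases_nonempty bases_subset exchange loop by unfold_locales blast+
  moreover have "matroid {e} (uniform_bases 0 {e})" by (rule matroid_uniform) simp_all
  moreover have "\<B> = sum_bases (uniform_bases 0 {e}) \<B>"
  proof -
    have "uniform_bases 0 {e} = {{}}"
      by (auto simp: uniform_bases_def card_eq_0_iff intro: finite_subset)
    then show ?thesis by (auto simp: sum_bases_def)
  qed
  moreover have "E - {e} \<noteq> {}" "E = {e} \<union> (E - {e})" "{e} \<inter> (E - {e}) = {}" using e by blast+
  ultimately show False using conn unfolding connected_matroid_def by blast
qed

lemma elementary_splitE:
  fixes E :: "'a set"
  assumes "elementary_split E \<B>"
  obtains q H s where "elementary_split_matroid E \<B> q H s"
proof -
  have "matroid E \<B>" using assms by (simp add: elementary_split_def)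
  then interpret matroid E \<B> .
  from conjunct2[OF assms[unfolded elementary_split_def]] show ?thesis
  proof (elim exE conjE)
    fix q :: nat and H :: "nat \<Rightarrow> 'a set" and s :: "nat \<Rightarrow> nat"
    assume H: "\<forall>i\<in>{1..q}. H i \<subseteq> E"
      "\<forall>i\<in>{1..q}. \<forall>j\<in>{1..q}. i \<noteq> j \<longrightarrow>
        int (card (H i \<inter> H j)) \<le> int (s i) + int (s j) - int (rk \<B> E)"
      "\<forall>i\<in>{1..q}. card (E - H i) + s i \<ge> rk \<B> E"
      "\<B> = {X. X \<subseteq> E \<and> card X = rk \<B> E \<and> (\<forall>i\<in>{1..q}. card (X \<inter> H i) \<le> s i)}"
    have "elementary_split_matroid E \<B> q H s"
    proof
      show "H i \<subseteq> E" if "i \<in> {1..q}" for i using H(1) that by blast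
      show "card (H i \<inter> H j) + rk \<B> E \<le> s i + s j"
        if "i \<in> {1..q}" "j \<in> {1..q}" "i \<noteq> j" for i j
        using H(2)[rule_format, OF that] by simp
      show "rk \<B> E \<le> card (E - H i) + s i" if "i \<in> {1..q}" for i using H(3) that by blast
      show "\<B> = {X. X \<subseteq> E \<and> card X = rk \<B> E \<and> (\<forall>i\<in>{1..q}. card (X \<inter> H i) \<le> s i)}"
        by (rule H(4))
    qed
    then show ?thesis by (rule that)
  qed
qed

section \<open>Assembling the formula\<close>

context elementary_split_matroid
begin

abbreviation flats :: "'a set set" ("\<F>") where "\<F> \<equiv> proper_cyclic_flats E \<B>"

lemma capped_family_proper_cyclic_flats:
  "capped_family E (rk \<B> E) (\<F>) (rk \<B>)"
proof
  show "finite E" by (rule finite_ground)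
  show "F \<subseteq> E" if "F \<in> \<F>" for F
    using that by (simp add: proper_cyclic_flats_def cyclic_flat_def flat_def)
  show "rk \<B> F \<le> rk \<B> E" for F by (rule rk_le_rk_ground)
  show "card (F \<inter> G) + rk \<B> E \<le> rk \<B> F + rk \<B> G"
    if "F \<in> \<F>" "G \<in> \<F>" "F \<noteq> G" for F G
    using that by (rule proper_cyclic_flats_overlap)
qed

sublocale capped_family E "rk \<B> E" "\<F>" "rk \<B>"
  by (rule capped_family_proper_cyclic_flats)

lemma base_polytope_eq_capped_hypersimplex:
  "base_polytope \<B> = capped_hypersimplex E (rk \<B> E) (\<F>) (rk \<B>)"
  unfolding base_polytope_def capped_hypersimplex_eq_hull capped_sets_def
  using bases_by_cyclic_flats by simp

text \<open>In a modular pair the union has full rank, so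
  \<open>rk \<B> F - rk \<B> (F \<inter> G)\<close> equals \<open>rk \<B> E - rk \<B> G\<close>:
  \<alpha> is the corank of the other member, and likewise for \<beta>.\<close>

definition pair_label :: "'a set \<Rightarrow> 'a set \<Rightarrow> nat \<times> nat \<times> nat \<times> nat" where
  "pair_label F G = (rk \<B> E - rk \<B> G, rk \<B> E - rk \<B> F, card (F - G), card (G - F))"

definition labelled_pairs :: "nat \<times> nat \<times> nat \<times> nat \<Rightarrow> 'a set set set" where
  "labelled_pairs l = {{F, G} | F G. F \<in> \<F> \<and> G \<in> \<F> \<and>
     F \<noteq> G \<and> card (F \<inter> G) + rk \<B> E = rk \<B> F + rk \<B> G \<and> l = pair_label F G}"

lemma labelled_pairsE:
  assumes "p \<in> labelled_pairs l"
  obtains F G where "p = {F, G}" "F \<in> \<F>" "G \<in> \<F>"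
    "F \<noteq> G" "card (F \<inter> G) + rk \<B> E = rk \<B> F + rk \<B> G" "l = pair_label F G"
  using assms unfolding labelled_pairs_def by (elim CollectE exE conjE) (rule that)

lemma mu_count_eq: "mu_count E \<B> \<alpha> \<beta> a b = card (labelled_pairs (\<alpha>, \<beta>, a, b))"
proof -
  have "(rk \<B> F + rk \<B> G = rk \<B> (F \<inter> G) + rk \<B> (F \<union> G) \<and> a = card (F - G) \<and> b = card (G - F) \<and>
        int \<alpha> = int (rk \<B> F) - int (rk \<B> (F \<inter> G)) \<and> int \<beta> = int (rk \<B> G) - int (rk \<B> (F \<inter> G))) \<longleftrightarrow>
      (card (F \<inter> G) + rk \<B> E = rk \<B> F + rk \<B> G \<and> (\<alpha>, \<beta>, a, b) = pair_label F G)"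
    if "F \<in> \<F>" "G \<in> \<F>" "F \<noteq> G" for F G
  proof (cases "card (F \<inter> G) + rk \<B> E = rk \<B> F + rk \<B> G")
    case True
    have "rk \<B> F \<le> rk \<B> E" "rk \<B> G \<le> rk \<B> E" by (rule rk_le_rk_ground)+
    then show ?thesis
      using modular_iff[OF that] True by (auto simp: pair_label_def)
  next
    case False
    then show ?thesis using modular_iff(1)[OF that] by simp
  qed
  then have "{{F, G} | F G. F \<in> \<F> \<and> G \<in> \<F> \<and> F \<noteq> G \<and>
     rk \<B> F + rk \<B> G = rk \<B> (F \<inter> G) + rk \<B> (F \<union> G) \<and> a = card (F - G) \<and> b = card (G - F) \<and>
     int \<alpha> = int (rk \<B> F) - int (rk \<B> (F \<inter> G)) \<and>
     int \<beta> = int (rk \<B> G) - int (rk \<B> (F \<inter> G))} = labelled_pairs (\<alpha>, \<beta>, a, b)"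
    unfolding labelled_pairs_def by (intro Collect_cong ex_cong1) blast
  then show ?thesis unfolding mu_count_def by simp
qed

lemma labelled_pairs_subset: "labelled_pairs l \<subseteq> modular_pairs"
  by (auto simp: labelled_pairs_def modular_pairs_def)

text \<open>Proper flats have positive corank. Moreover \<open>a - \<alpha>\<close> equals
  \<open>card F - rk \<B> F\<close>, which is positive for a proper cyclic flat, and the same holds
  for \<open>G\<close>.\<close>

lemma pair_label_positive:
  assumes F: "F \<in> \<F>" and G: "G \<in> \<F>"
    and eq: "card (F \<inter> G) + rk \<B> E = rk \<B> F + rk \<B> G" and l: "pair_label F G = (\<alpha>, \<beta>, a, b)"
  shows "0 < \<alpha>" "\<alpha> < a" "0 < \<beta>" "\<beta> < b"
proof -
  have "rk \<B> F < rk \<B> E" "rk \<B> G < rk \<B> E"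
    using F G rk_proper_flat by (auto simp: proper_cyclic_flats_def cyclic_flat_def)
  moreover have "rk \<B> F < card F" "rk \<B> G < card G"
    using F G rk_less_card_proper_cyclic_flat by blast+
  moreover have "card F = card (F \<inter> G) + card (F - G)" "card G = card (F \<inter> G) + card (G - F)"
    using finite_member F G by (metis card_Int_Diff, metis Int_commute card_Int_Diff)
  ultimately show "0 < \<alpha>" "\<alpha> < a" "0 < \<beta>" "\<beta> < b"
    using eq l by (auto simp: pair_label_def)
qed

lemma mu_support_iff:
  "(\<alpha>, \<beta>, a, b) \<in> mu_support E \<B> \<longleftrightarrow>
    labelled_pairs (\<alpha>, \<beta>, a, b) \<noteq> {} \<and> (a < b \<or> a = b \<and> \<alpha> \<le> \<beta>)"
proof -
  have "finite (labelled_pairs (\<alpha>, \<beta>, a, b))"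
    using finite_modular_pairs labelled_pairs_subset by (rule finite_subset[rotated])
  then have "mu_count E \<B> \<alpha> \<beta> a b \<noteq> 0 \<longleftrightarrow> labelled_pairs (\<alpha>, \<beta>, a, b) \<noteq> {}"
    by (simp add: mu_count_eq)
  moreover have "0 < \<alpha> \<and> \<alpha> < a \<and> 0 < \<beta> \<and> \<beta> < b" if ne: "labelled_pairs (\<alpha>, \<beta>, a, b) \<noteq> {}"
  proof -
    obtain p where "p \<in> labelled_pairs (\<alpha>, \<beta>, a, b)" using ne by blast
    then obtain F G where FG: "F \<in> \<F>" "G \<in> \<F>"
      "card (F \<inter> G) + rk \<B> E = rk \<B> F + rk \<B> G" "(\<alpha>, \<beta>, a, b) = pair_label F G"
      by (rule labelled_pairsE)
    then show ?thesis using pair_label_positive[OF FG(1-3) FG(4)[symmetric]] by simp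
  qed
  ultimately show ?thesis by (auto simp: mu_support_def)
qed

text \<open>The two labels of a pair arise from each other by swapping \<alpha> with \<beta> and
  \<open>a\<close> with \<open>b\<close>. The index condition admits at least one of them, and both
  only if they coincide.\<close>

lemma modular_pairs_partition:
  "modular_pairs = (\<Union>l\<in>mu_support E \<B>. labelled_pairs l)"
  "l \<in> mu_support E \<B> \<Longrightarrow> l' \<in> mu_support E \<B> \<Longrightarrow> l \<noteq> l' \<Longrightarrow> labelled_pairs l \<inter> labelled_pairs l' = {}"
proof -
  have mem: "{F, G} \<in> labelled_pairs (pair_label F G)"
    if "F \<in> \<F>" "G \<in> \<F>" "F \<noteq> G"
      "card (F \<inter> G) + rk \<B> E = rk \<B> F + rk \<B> G" for F G
    using that unfolding labelled_pairs_def by blast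
  show "modular_pairs = (\<Union>l\<in>mu_support E \<B>. labelled_pairs l)"
  proof (intro equalityI subsetI)
    fix p assume "p \<in> modular_pairs"
    then obtain F G where p: "p = {F, G}" "F \<in> \<F>" "G \<in> \<F>"
      "F \<noteq> G" "card (F \<inter> G) + rk \<B> E = rk \<B> F + rk \<B> G"
      by (auto simp: modular_pairs_def)
    have FG: "p \<in> labelled_pairs (pair_label F G)" using mem p by simp
    have GF: "p \<in> labelled_pairs (pair_label G F)"
      using mem[of G F] p by (simp add: insert_commute Int_commute add.commute)
    have "pair_label F G \<in> mu_support E \<B> \<or> pair_label G F \<in> mu_support E \<B>"
      using FG GF unfolding pair_label_def mu_support_iff by force
    then show "p \<in> (\<Union>l\<in>mu_support E \<B>. labelled_pairs l)" using FG GF by blast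
  next
    fix p assume "p \<in> (\<Union>l\<in>mu_support E \<B>. labelled_pairs l)"
    then show "p \<in> modular_pairs" using labelled_pairs_subset by blast
  qed
  assume l: "l \<in> mu_support E \<B>" and l': "l' \<in> mu_support E \<B>" and ne: "l \<noteq> l'"
  show "labelled_pairs l \<inter> labelled_pairs l' = {}"
  proof (rule ccontr)
    assume "labelled_pairs l \<inter> labelled_pairs l' \<noteq> {}"
    then obtain p where "p \<in> labelled_pairs l" "p \<in> labelled_pairs l'" by blast
    then obtain F G F' G' where p: "p = {F, G}" "l = pair_label F G" "p = {F', G'}" "l' = pair_label F' G'"
      by (elim labelled_pairsE) (rule that)
    then have "F = F' \<and> G = G' \<or> F = G' \<and> G = F'" by (metis doubleton_eq_iff)
    then have "l' = pair_label G F" using p ne by auto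
    note labels = l[unfolded p(2) pair_label_def mu_support_iff] l'[unfolded this pair_label_def mu_support_iff]
    have "pair_label F G = pair_label G F"
      using conjunct2[OF labels(1)] conjunct2[OF labels(2)] unfolding pair_label_def by auto
    then show False using ne p(2) \<open>l' = pair_label G F\<close> by simp
  qed
qed

lemma sum_modular_pairs:
  "(\<Sum>p\<in>modular_pairs. \<Sum>(I, S)\<in>cells E (rk \<B> E). pair_poly E (rk \<B> E) (rk \<B>) p I S) =
    (\<Sum>(\<alpha>, \<beta>, a, b)\<in>mu_support E \<B>. of_nat (mu_count E \<B> \<alpha> \<beta> a b) * w_poly \<alpha> \<beta> a b)"
proof -
  let ?W = "\<lambda>p. \<Sum>(I, S)\<in>cells E (rk \<B> E). pair_poly E (rk \<B> E) (rk \<B>) p I S"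
  have fin: "finite (labelled_pairs l)" for l
    using finite_modular_pairs labelled_pairs_subset by (rule finite_subset[rotated])
  have "(\<Sum>p\<in>modular_pairs. ?W p) = (\<Sum>l\<in>mu_support E \<B>. \<Sum>p\<in>labelled_pairs l. ?W p)"
    unfolding modular_pairs_partition(1)
    using finite_mu_support[OF finite_ground] fin modular_pairs_partition(2)
    by (intro sum.UNION_disjoint) auto
  also have "\<dots> = (\<Sum>(\<alpha>, \<beta>, a, b)\<in>mu_support E \<B>. of_nat (mu_count E \<B> \<alpha> \<beta> a b) * w_poly \<alpha> \<beta> a b)"
  proof (rule sum.cong[OF refl])
    fix l assume "l \<in> mu_support E \<B>"
    obtain \<alpha> \<beta> a b where l: "l = (\<alpha>, \<beta>, a, b)" by (metis prod.exhaust)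
    have "?W p = w_poly \<alpha> \<beta> a b" if mem: "p \<in> labelled_pairs l" for p
    proof -
      obtain F G where p: "p = {F, G}" "F \<in> \<F>" "G \<in> \<F>"
        "F \<noteq> G" "card (F \<inter> G) + rk \<B> E = rk \<B> F + rk \<B> G" "l = pair_label F G"
        using mem by (rule labelled_pairsE)
      have "w_poly (rk \<B> E - rk \<B> G) (rk \<B> E - rk \<B> F) (card (F - G)) (card (G - F)) = ?W p"
        unfolding p(1)
        by (rule w_poly_eq_sum_pair_poly[OF finite_ground family_subset[OF p(2)] family_subset[OF p(3)]
              p(4) le_rank[OF p(2)] le_rank[OF p(3)] p(5)])
      then show ?thesis using p(6) l by (simp add: pair_label_def)
    qed
    then have "(\<Sum>p\<in>labelled_pairs l. ?W p) = (\<Sum>p\<in>labelled_pairs l. w_poly \<alpha> \<beta> a b)"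
      by (rule sum.cong[OF refl])
    then show "(\<Sum>p\<in>labelled_pairs l. ?W p) =
        (case l of (\<alpha>, \<beta>, a, b) \<Rightarrow> of_nat (mu_count E \<B> \<alpha> \<beta> a b) * w_poly \<alpha> \<beta> a b)"
      by (simp add: l mu_count_eq)
  qed
  finally show ?thesis .
qed

text \<open>Flats are grouped by rank and size. The bound \<open>0 < r\<close> comes from
  connectedness: a nonempty flat of rank 0 would consist of loops.\<close>

lemma sum_proper_cyclic_flats:
  assumes conn: "connected_matroid E \<B>"
  shows "(\<Sum>F\<in>\<F>. u_poly (rk \<B> F) k (card F) n) =
    (\<Sum>(r, h)\<in>{(r, h). 0 < r \<and> r < h \<and> h < card E}. of_nat (lambda_count E \<B> r h) * u_poly r k h n)"
proof -
  let ?T = "{(r, h). 0 < r \<and> r < h \<and> h < card E}"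
  have "finite ?T" by (rule finite_subset[of _ "{..card E} \<times> {..card E}"]) auto
  moreover have "(\<lambda>F. (rk \<B> F, card F)) ` \<F> \<subseteq> ?T"
  proof
    fix l assume "l \<in> (\<lambda>F. (rk \<B> F, card F)) ` \<F>"
    then obtain F where F: "F \<in> \<F>" "l = (rk \<B> F, card F)" by blast
    have sub: "F \<subset> E" and ne: "F \<noteq> {}"
      using F(1) by (auto simp: proper_cyclic_flats_def cyclic_flat_def flat_def)
    obtain e where e: "e \<in> F" using ne by blast
    have "E \<noteq> {e}" using e sub by blast
    then obtain B where "B \<in> \<B>" "e \<in> B" using connected_no_loop[OF conn] e sub by blast
    then have "indep \<B> {e}" by (auto simp: indep_def)
    then have "card {e} \<le> rk \<B> F" using e by (intro rk_ge_card_indep) auto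
    moreover have "card F < card E" using sub finite_ground by (intro psubset_card_mono)
    ultimately show "l \<in> ?T" using rk_less_card_proper_cyclic_flat[OF F(1)] F(2) by simp
  qed
  ultimately have "(\<Sum>F\<in>\<F>. u_poly (rk \<B> F) k (card F) n) =
      (\<Sum>l\<in>?T. \<Sum>F\<in>{F \<in> \<F>. (rk \<B> F, card F) = l}. u_poly (rk \<B> F) k (card F) n)"
    using finite_family by (intro sum.group[symmetric])
  also have "\<dots> = (\<Sum>(r, h)\<in>?T. of_nat (lambda_count E \<B> r h) * u_poly r k h n)"
  proof (rule sum.cong[OF refl])
    fix l assume "l \<in> ?T"
    obtain r h where l: "l = (r, h)" by (cases l)
    have "(\<Sum>F\<in>{F \<in> \<F>. (rk \<B> F, card F) = l}. u_poly (rk \<B> F) k (card F) n) =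
        (\<Sum>F\<in>{F \<in> \<F>. rk \<B> F = r \<and> card F = h}. u_poly r k h n)"
      by (intro sum.cong) (auto simp: l)
    then show "(\<Sum>F\<in>{F \<in> \<F>. (rk \<B> F, card F) = l}. u_poly (rk \<B> F) k (card F) n) =
        (case l of (r, h) \<Rightarrow> of_nat (lambda_count E \<B> r h) * u_poly r k h n)"
      by (simp add: l lambda_count_def)
  qed
  finally show ?thesis .
qed

end

theorem theorem2p5:
  fixes E :: "'a set" and \<B> :: "'a set set" and k n :: nat
  assumes "matroid E \<B>"
    and "connected_matroid E \<B>"
    and "split_matroid E \<B>"
    and "rk \<B> E = k"
    and "card E = n"
  shows "face_poly (base_polytope \<B>) =
      face_poly (hypersimplex k n)
      - (\<Sum>(r, h)\<in>{(r, h). 0 < r \<and> r < h \<and> h < n}.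
           of_nat (lambda_count E \<B> r h) * u_poly r k h n)
      - (\<Sum>(\<alpha>, \<beta>, a, b)\<in>mu_support E \<B>.
           of_nat (mu_count E \<B> \<alpha> \<beta> a b) * w_poly \<alpha> \<beta> a b)"
proof -
  obtain q H s where "elementary_split_matroid E \<B> q H s"
    using connected_split_is_elementary[OF assms(3,2)] by (rule elementary_splitE)
  then interpret elementary_split_matroid E \<B> q H s .
  show ?thesis
    unfolding base_polytope_eq_capped_hypersimplex face_poly_capped_hypersimplex
      sum_proper_cyclic_flats[OF assms(2)] sum_modular_pairs
    by (simp only: assms(4,5))
qed

end
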